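(* Let $\mathcal{C}$ be a pseudounitary modular category. Then $\mathcal{C}_{ad}=(\mathcal{C}_{pt})'$.
   Context: $k$ is an algebraically closed field of characteristic $0$. A fusion category is a $k$-linear semisimple rigid tensor category with finitely many isomorphism classes of simple objects, finite-dimensional morphism spaces, and simple unit object; a fusion subcategory is a full tensor subcategory. $\mathrm{FPdim}$ of objects is given by the unique ring homomorphism $K_0(\mathcal{C})\to\mathbb{R}$ positive on simple objects, and $\mathrm{FPdim}(\mathcal{C})$ is the sum of squares of dimensions of the simple objects. $\mathcal{C}$ is pseudounitary if its categorical dimension equals $\mathrm{FPdim}(\mathcal{C})$. A modular category is a ribbon fusion category with simple objects $X_i$, $i\in\mathcal{I}$, braiding $c$, and non-degenerate $S$-matrix $s_{ij}=\mathrm{tr}_q(c_{X_i,X_j}\circ c_{X_j,X_i})$ (whose entries lie in a cyclotomic field and are regarded as complex numbers); $d_i$ is the categorical dimension of $X_i$. A pseudounitary modular category is always equipped with its canonical spherical structure, for which $d_i=\mathrm{FPdim}(X_i)$. $\mathcal{C}_{ad}$ is the full tensor subcategory generated by all subobjects of $X\otimes X^*$, $X$ simple in $\mathcal{C}$. $\mathcal{C}_{pt}$ is the maximal pointed fusion subcategory, generated by all invertible objects of $\mathcal{C}$. The (Müger) centralizer $\mathcal{K}'$ of a fusion subcategory $\mathcal{K}\subseteq\mathcal{C}$ is the fusion subcategory generated by all simple $X_i$ such that $s_{ij}=d_id_j$ for all simple $X_j\in\mathcal{K}$. *)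

theory Defs
  imports Complex_Main "HOL-Computational_Algebra.Computational_Algebra"
    "HOL-Algebra.Generated_Fields" "HOL-Algebra.Algebraic_Closure_Type"
begin

no_notation Polynomials.var ("X\<index>") (* X, Y, Z are objects below *)

section \<open>Linear and abelian categories\<close>

text \<open>
  The objects are the elements of the type \<open>'o\<close>. All morphisms live in one ambient vector space
  \<open>'m\<close>, of which the spaces \<open>Hom X Y\<close> are subspaces; composition and tensor product of morphisms
  are constrained on the Hom spaces only. The Hom spaces may overlap, and need not span \<open>'m\<close>.
  Every small linear category has this form: take for \<open>'m\<close> the direct sum of its Hom spaces.
\<close>

record ('k, 'o, 'm) linear_data =
  smult :: "'k \<Rightarrow> 'm \<Rightarrow> 'm" (infixr "\<cdot>\<^sub>s\<index>" 75)
  Hom :: "'o \<Rightarrow> 'o \<Rightarrow> 'm set" ("Hom\<index>")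
  ide :: "'o \<Rightarrow> 'm" ("ide\<index>")
  comp :: "'m \<Rightarrow> 'm \<Rightarrow> 'm" (infixr "\<bullet>\<index>" 70)

locale linear_category = vector_space "smult C"
  for C :: "('k::field, 'o, 'm::ab_group_add, 'z) linear_data_scheme" (structure) +
  assumes subspace_Hom: "subspace (Hom X Y)"
    and ide_in_Hom: "ide X \<in> Hom X X"
    and comp_in_Hom: "\<lbrakk>g \<in> Hom Y Z; f \<in> Hom X Y\<rbrakk> \<Longrightarrow> g \<bullet> f \<in> Hom X Z"
    and comp_assoc: "\<lbrakk>h \<in> Hom Z W; g \<in> Hom Y Z; f \<in> Hom X Y\<rbrakk> \<Longrightarrow> (h \<bullet> g) \<bullet> f = h \<bullet> (g \<bullet> f)"
    and comp_ide_left: "f \<in> Hom X Y \<Longrightarrow> ide Y \<bullet> f = f"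
    and comp_ide_right: "f \<in> Hom X Y \<Longrightarrow> f \<bullet> ide X = f"
    and comp_add_left:
      "\<lbrakk>g \<in> Hom Y Z; g' \<in> Hom Y Z; f \<in> Hom X Y\<rbrakk> \<Longrightarrow> (g + g') \<bullet> f = g \<bullet> f + g' \<bullet> f"
    and comp_add_right:
      "\<lbrakk>g \<in> Hom Y Z; f \<in> Hom X Y; f' \<in> Hom X Y\<rbrakk> \<Longrightarrow> g \<bullet> (f + f') = g \<bullet> f + g \<bullet> f'"
    and comp_smult_left: "\<lbrakk>g \<in> Hom Y Z; f \<in> Hom X Y\<rbrakk> \<Longrightarrow> (a \<cdot>\<^sub>s g) \<bullet> f = a \<cdot>\<^sub>s (g \<bullet> f)"
    and comp_smult_right: "\<lbrakk>g \<in> Hom Y Z; f \<in> Hom X Y\<rbrakk> \<Longrightarrow> g \<bullet> (a \<cdot>\<^sub>s f) = a \<cdot>\<^sub>s (g \<bullet> f)"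
begin

definition inverses :: "'o \<Rightarrow> 'o \<Rightarrow> 'm \<Rightarrow> 'm \<Rightarrow> bool" where
  "inverses X Y f g \<longleftrightarrow> f \<in> Hom X Y \<and> g \<in> Hom Y X \<and> g \<bullet> f = ide X \<and> f \<bullet> g = ide Y"

definition is_iso :: "'o \<Rightarrow> 'o \<Rightarrow> 'm \<Rightarrow> bool" where
  "is_iso X Y f \<longleftrightarrow> (\<exists>g. inverses X Y f g)"

definition inv_mor :: "'o \<Rightarrow> 'o \<Rightarrow> 'm \<Rightarrow> 'm" where
  "inv_mor X Y f = (THE g. inverses X Y f g)"

definition isomorphic :: "'o \<Rightarrow> 'o \<Rightarrow> bool" where
  "isomorphic X Y \<longleftrightarrow> (\<exists>f. is_iso X Y f)"

definition is_zero_obj :: "'o \<Rightarrow> bool" where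
  "is_zero_obj Z \<longleftrightarrow> (\<forall>X. Hom X Z = {0} \<and> Hom Z X = {0})"

definition is_mono :: "'o \<Rightarrow> 'o \<Rightarrow> 'm \<Rightarrow> bool" where
  "is_mono X Y f \<longleftrightarrow> f \<in> Hom X Y \<and>
     (\<forall>W. \<forall>g\<in>Hom W X. \<forall>h\<in>Hom W X. f \<bullet> g = f \<bullet> h \<longrightarrow> g = h)"

definition is_epi :: "'o \<Rightarrow> 'o \<Rightarrow> 'm \<Rightarrow> bool" where
  "is_epi X Y f \<longleftrightarrow> f \<in> Hom X Y \<and>
     (\<forall>W. \<forall>g\<in>Hom Y W. \<forall>h\<in>Hom Y W. g \<bullet> f = h \<bullet> f \<longrightarrow> g = h)"

text \<open>\<open>k : K \<rightarrow> X\<close> is a kernel of \<open>f : X \<rightarrow> Y\<close>, and dually \<open>c : Y \<rightarrow> Q\<close> is a cokernel of it.\<close>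

definition is_kernel :: "'o \<Rightarrow> 'm \<Rightarrow> 'o \<Rightarrow> 'o \<Rightarrow> 'm \<Rightarrow> bool" where
  "is_kernel K k X Y f \<longleftrightarrow> f \<in> Hom X Y \<and> k \<in> Hom K X \<and> f \<bullet> k = 0 \<and>
     (\<forall>W. \<forall>g\<in>Hom W X. f \<bullet> g = 0 \<longrightarrow> (\<exists>!u. u \<in> Hom W K \<and> k \<bullet> u = g))"

definition is_cokernel :: "'o \<Rightarrow> 'm \<Rightarrow> 'o \<Rightarrow> 'o \<Rightarrow> 'm \<Rightarrow> bool" where
  "is_cokernel Q c X Y f \<longleftrightarrow> f \<in> Hom X Y \<and> c \<in> Hom Y Q \<and> c \<bullet> f = 0 \<and>
     (\<forall>W. \<forall>g\<in>Hom Y W. g \<bullet> f = 0 \<longrightarrow> (\<exists>!u. u \<in> Hom Q W \<and> u \<bullet> c = g))"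

text \<open>The empty list is included: \<open>is_direct_sum X []\<close> says that \<open>X\<close> is a zero object.\<close>

definition is_direct_sum :: "'o \<Rightarrow> 'o list \<Rightarrow> bool" where
  "is_direct_sum X Xs \<longleftrightarrow>
     (\<exists>i p. (\<forall>j<length Xs. i j \<in> Hom (Xs ! j) X \<and> p j \<in> Hom X (Xs ! j)) \<and>
        (\<forall>j<length Xs. \<forall>l<length Xs. p j \<bullet> i l = (if j = l then ide (Xs ! j) else 0)) \<and>
        (\<Sum>j<length Xs. i j \<bullet> p j) = ide X)"

definition simple :: "'o \<Rightarrow> bool" where
  "simple X \<longleftrightarrow> \<not> is_zero_obj X \<and>
     (\<forall>Y f. is_mono Y X f \<longrightarrow> is_zero_obj Y \<or> is_iso Y X f)"

end

locale abelian_category = linear_category C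
  for C :: "('k::field, 'o, 'm::ab_group_add, 'z) linear_data_scheme" (structure) +
  assumes direct_sum_exists: "\<exists>X. is_direct_sum X Xs"
    and kernel_exists: "f \<in> Hom X Y \<Longrightarrow> \<exists>K k. is_kernel K k X Y f"
    and cokernel_exists: "f \<in> Hom X Y \<Longrightarrow> \<exists>Q c. is_cokernel Q c X Y f"
    and mono_is_kernel: "is_mono X Y f \<Longrightarrow> \<exists>Z g. is_kernel X f Y Z g"
    and epi_is_cokernel: "is_epi X Y f \<Longrightarrow> \<exists>Z g. is_cokernel Y f Z X g"


section \<open>Monoidal categories and duals\<close>

record ('k, 'o, 'm) monoidal_data = "('k, 'o, 'm) linear_data" +
  tensor_obj :: "'o \<Rightarrow> 'o \<Rightarrow> 'o" (infixr "\<otimes>\<^sub>o\<index>" 75)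
  tensor_mor :: "'m \<Rightarrow> 'm \<Rightarrow> 'm" (infixr "\<otimes>\<^sub>m\<index>" 75)
  unit_obj :: "'o" ("\<one>\<^sub>o\<index>")
  assoc :: "'o \<Rightarrow> 'o \<Rightarrow> 'o \<Rightarrow> 'm" ("assoc\<index>")
  lunit :: "'o \<Rightarrow> 'm" ("lunit\<index>")
  runit :: "'o \<Rightarrow> 'm" ("runit\<index>")

locale linear_monoidal_category = linear_category C
  for C :: "('k::field, 'o, 'm::ab_group_add, 'z) monoidal_data_scheme" (structure) +
  assumes tensor_in_Hom: "\<lbrakk>f \<in> Hom X X'; g \<in> Hom Y Y'\<rbrakk> \<Longrightarrow> f \<otimes>\<^sub>m g \<in> Hom (X \<otimes>\<^sub>o Y) (X' \<otimes>\<^sub>o Y')"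
    and tensor_ide: "ide X \<otimes>\<^sub>m ide Y = ide (X \<otimes>\<^sub>o Y)"
    and tensor_comp:
      "\<lbrakk>f \<in> Hom X X'; f' \<in> Hom X' X''; g \<in> Hom Y Y'; g' \<in> Hom Y' Y''\<rbrakk> \<Longrightarrow>
         (f' \<bullet> f) \<otimes>\<^sub>m (g' \<bullet> g) = (f' \<otimes>\<^sub>m g') \<bullet> (f \<otimes>\<^sub>m g)"
    and tensor_add_left:
      "\<lbrakk>f \<in> Hom X X'; f' \<in> Hom X X'; g \<in> Hom Y Y'\<rbrakk> \<Longrightarrow> (f + f') \<otimes>\<^sub>m g = f \<otimes>\<^sub>m g + f' \<otimes>\<^sub>m g"
    and tensor_add_right:
      "\<lbrakk>f \<in> Hom X X'; g \<in> Hom Y Y'; g' \<in> Hom Y Y'\<rbrakk> \<Longrightarrow> f \<otimes>\<^sub>m (g + g') = f \<otimes>\<^sub>m g + f \<otimes>\<^sub>m g'"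
    and tensor_smult_left:
      "\<lbrakk>f \<in> Hom X X'; g \<in> Hom Y Y'\<rbrakk> \<Longrightarrow> (a \<cdot>\<^sub>s f) \<otimes>\<^sub>m g = a \<cdot>\<^sub>s (f \<otimes>\<^sub>m g)"
    and tensor_smult_right:
      "\<lbrakk>f \<in> Hom X X'; g \<in> Hom Y Y'\<rbrakk> \<Longrightarrow> f \<otimes>\<^sub>m (a \<cdot>\<^sub>s g) = a \<cdot>\<^sub>s (f \<otimes>\<^sub>m g)"
    and assoc_iso: "is_iso ((X \<otimes>\<^sub>o Y) \<otimes>\<^sub>o Z) (X \<otimes>\<^sub>o (Y \<otimes>\<^sub>o Z)) (assoc X Y Z)"
    and lunit_iso: "is_iso (\<one>\<^sub>o \<otimes>\<^sub>o X) X (lunit X)"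
    and runit_iso: "is_iso (X \<otimes>\<^sub>o \<one>\<^sub>o) X (runit X)"
    and assoc_natural:
      "\<lbrakk>f \<in> Hom X X'; g \<in> Hom Y Y'; h \<in> Hom Z Z'\<rbrakk> \<Longrightarrow>
         assoc X' Y' Z' \<bullet> ((f \<otimes>\<^sub>m g) \<otimes>\<^sub>m h) = (f \<otimes>\<^sub>m (g \<otimes>\<^sub>m h)) \<bullet> assoc X Y Z"
    and lunit_natural: "f \<in> Hom X Y \<Longrightarrow> lunit Y \<bullet> (ide \<one>\<^sub>o \<otimes>\<^sub>m f) = f \<bullet> lunit X"
    and runit_natural: "f \<in> Hom X Y \<Longrightarrow> runit Y \<bullet> (f \<otimes>\<^sub>m ide \<one>\<^sub>o) = f \<bullet> runit X"
    and pentagon: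
      "assoc X Y (Z \<otimes>\<^sub>o W) \<bullet> assoc (X \<otimes>\<^sub>o Y) Z W =
       (ide X \<otimes>\<^sub>m assoc Y Z W) \<bullet> assoc X (Y \<otimes>\<^sub>o Z) W \<bullet> (assoc X Y Z \<otimes>\<^sub>m ide W)"
    and triangle: "(ide X \<otimes>\<^sub>m lunit Y) \<bullet> assoc X \<one>\<^sub>o Y = runit X \<otimes>\<^sub>m ide Y"
begin

definition assoc_inv :: "'o \<Rightarrow> 'o \<Rightarrow> 'o \<Rightarrow> 'm" where
  "assoc_inv X Y Z = inv_mor ((X \<otimes>\<^sub>o Y) \<otimes>\<^sub>o Z) (X \<otimes>\<^sub>o (Y \<otimes>\<^sub>o Z)) (assoc X Y Z)"

text \<open>\<open>Y\<close> is a left dual of \<open>X\<close> (equivalently, \<open>X\<close> is a right dual of \<open>Y\<close>) with evaluation \<open>e\<close> and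
  coevaluation \<open>c\<close>. The zigzag identities are written with the unit constraints moved to the
  other side.\<close>

definition is_left_dual :: "'o \<Rightarrow> 'o \<Rightarrow> 'm \<Rightarrow> 'm \<Rightarrow> bool" where
  "is_left_dual X Y e c \<longleftrightarrow> e \<in> Hom (Y \<otimes>\<^sub>o X) \<one>\<^sub>o \<and> c \<in> Hom \<one>\<^sub>o (X \<otimes>\<^sub>o Y) \<and>
     runit X \<bullet> (ide X \<otimes>\<^sub>m e) \<bullet> assoc X Y X \<bullet> (c \<otimes>\<^sub>m ide X) = lunit X \<and>
     lunit Y \<bullet> (e \<otimes>\<^sub>m ide Y) \<bullet> assoc_inv Y X Y \<bullet> (ide Y \<otimes>\<^sub>m c) = runit Y"

definition invertible :: "'o \<Rightarrow> bool" where
  "invertible X \<longleftrightarrow> (\<exists>Y. isomorphic (X \<otimes>\<^sub>o Y) \<one>\<^sub>o \<and> isomorphic (Y \<otimes>\<^sub>o X) \<one>\<^sub>o)"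

end


section \<open>Fusion categories\<close>

text \<open>
  The data comprise a choice of left duals and a set \<open>Irr\<close> of representatives \<open>X\<^sub>i\<close>,
  \<open>i \<in> \<I>\<close>, of the isomorphism classes of simple objects.
\<close>

record ('k, 'o, 'm) fusion_data = "('k, 'o, 'm) monoidal_data" +
  dual :: "'o \<Rightarrow> 'o" ("dual\<index>")
  ev :: "'o \<Rightarrow> 'm" ("ev\<index>")
  coev :: "'o \<Rightarrow> 'm" ("coev\<index>")
  Irr :: "'o set" ("Irr\<index>")

locale fusion_category = abelian_category C + linear_monoidal_category C
  for C :: "('k::{alg_closed_field,field_char_0}, 'o, 'm::ab_group_add, 'z) fusion_data_scheme"
    (structure) +
  assumes Hom_finite_dim: "\<exists>B. finite B \<and> Hom X Y = span B"
    and semisimple: "\<exists>Xs. (\<forall>Y\<in>set Xs. simple Y) \<and> is_direct_sum X Xs"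
    and left_dual: "is_left_dual X (dual X) (ev X) (coev X)"
    and right_dual_exists: "\<exists>Y e c. is_left_dual Y X e c"
    and unit_simple: "simple \<one>\<^sub>o"
    and finite_Irr: "finite Irr"
    and Irr_simple: "X \<in> Irr \<Longrightarrow> simple X"
    and Irr_represents: "simple X \<Longrightarrow> \<exists>!Y. Y \<in> Irr \<and> isomorphic X Y"
begin

definition dual_mor :: "'o \<Rightarrow> 'o \<Rightarrow> 'm \<Rightarrow> 'm" where
  "dual_mor X Y f =
     lunit (dual X) \<bullet> (ev Y \<otimes>\<^sub>m ide (dual X)) \<bullet> ((ide (dual Y) \<otimes>\<^sub>m f) \<otimes>\<^sub>m ide (dual X)) \<bullet>
     assoc_inv (dual Y) X (dual X) \<bullet> (ide (dual Y) \<otimes>\<^sub>m coev X) \<bullet>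
     inv_mor (dual Y \<otimes>\<^sub>o \<one>\<^sub>o) (dual Y) (runit (dual Y))"

text \<open>
  The Grothendieck ring is the free abelian group on \<open>Irr\<close>, realised as the functions
  \<open>Irr \<rightarrow> \<int>\<close> extended by zero, with the product that extends \<open>[X][Y] = [X \<otimes> Y]\<close> bilinearly.
  Since the ground field is algebraically closed, the multiplicity of a simple object \<open>Z\<close> in \<open>X\<close>
  is the dimension of \<open>Hom Z X\<close>.
\<close>

definition obj_class :: "'o \<Rightarrow> 'o \<Rightarrow> int" where
  "obj_class X = (\<lambda>Z. if Z \<in> Irr then int (dim (Hom Z X)) else 0)"

definition K0 :: "('o \<Rightarrow> int) ring" where
  "K0 = \<lparr>carrier = {a. \<forall>Z. Z \<notin> Irr \<longrightarrow> a Z = 0},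
         monoid.mult = (\<lambda>a b Z. \<Sum>X\<in>Irr. \<Sum>Y\<in>Irr. a X * b Y * obj_class (X \<otimes>\<^sub>o Y) Z),
         one = obj_class \<one>\<^sub>o,
         zero = (\<lambda>Z. 0),
         add = (\<lambda>a b Z. a Z + b Z)\<rparr>"

text \<open>
  There is exactly one ring homomorphism from the Grothendieck ring to the reals that is positive
  on simple objects, so this predicate holds of one \<open>\<phi>\<close> up to its values outside the carrier.
\<close>

definition is_FPdim_hom :: "(('o \<Rightarrow> int) \<Rightarrow> real) \<Rightarrow> bool" where
  "is_FPdim_hom \<phi> \<longleftrightarrow> \<phi> \<in> ring_hom K0 ring_of_type_algebra \<and>
     (\<forall>X. simple X \<longrightarrow> \<phi> (obj_class X) > 0)"

definition FPdim_cat :: "(('o \<Rightarrow> int) \<Rightarrow> real) \<Rightarrow> real" where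
  "FPdim_cat \<phi> = (\<Sum>X\<in>Irr. (\<phi> (obj_class X))\<^sup>2)"

text \<open>Full subcategories are given by their sets of objects. Closure under subobjects includes
  closure under isomorphism.\<close>

definition fusion_subcategory :: "'o set \<Rightarrow> bool" where
  "fusion_subcategory D \<longleftrightarrow> \<one>\<^sub>o \<in> D \<and>
     (\<forall>X\<in>D. \<forall>Y\<in>D. X \<otimes>\<^sub>o Y \<in> D) \<and>
     (\<forall>X\<in>D. dual X \<in> D) \<and>
     (\<forall>X Xs. set Xs \<subseteq> D \<and> is_direct_sum X Xs \<longrightarrow> X \<in> D) \<and>
     (\<forall>X Y f. Y \<in> D \<and> is_mono X Y f \<longrightarrow> X \<in> D)"

definition generated_subcategory :: "'o set \<Rightarrow> 'o set" where
  "generated_subcategory S = \<Inter>{D. fusion_subcategory D \<and> S \<subseteq> D}"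

definition adjoint_subcategory :: "'o set" where
  "adjoint_subcategory = generated_subcategory {Z. \<exists>X f. simple X \<and> is_mono Z (X \<otimes>\<^sub>o dual X) f}"

definition pointed_subcategory :: "'o set" where
  "pointed_subcategory = generated_subcategory {X. invertible X}"

end


section \<open>Ribbon and modular categories\<close>

record ('k, 'o, 'm) ribbon_data = "('k, 'o, 'm) fusion_data" +
  braid :: "'o \<Rightarrow> 'o \<Rightarrow> 'm" ("braid\<index>")
  twist :: "'o \<Rightarrow> 'm" ("twist\<index>")

locale ribbon_fusion_category = fusion_category C
  for C :: "('k::{alg_closed_field,field_char_0}, 'o, 'm::ab_group_add, 'z) ribbon_data_scheme"
    (structure) +
  assumes braid_iso: "is_iso (X \<otimes>\<^sub>o Y) (Y \<otimes>\<^sub>o X) (braid X Y)"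
    and braid_natural:
      "\<lbrakk>f \<in> Hom X X'; g \<in> Hom Y Y'\<rbrakk> \<Longrightarrow> braid X' Y' \<bullet> (f \<otimes>\<^sub>m g) = (g \<otimes>\<^sub>m f) \<bullet> braid X Y"
    and hexagon1:
      "assoc Y Z X \<bullet> braid X (Y \<otimes>\<^sub>o Z) \<bullet> assoc X Y Z =
       (ide Y \<otimes>\<^sub>m braid X Z) \<bullet> assoc Y X Z \<bullet> (braid X Y \<otimes>\<^sub>m ide Z)"
    and hexagon2:
      "assoc_inv Z X Y \<bullet> braid (X \<otimes>\<^sub>o Y) Z \<bullet> assoc_inv X Y Z =
       (braid X Z \<otimes>\<^sub>m ide Y) \<bullet> assoc_inv X Z Y \<bullet> (ide X \<otimes>\<^sub>m braid Y Z)"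
    and twist_iso: "is_iso X X (twist X)"
    and twist_natural: "f \<in> Hom X Y \<Longrightarrow> twist Y \<bullet> f = f \<bullet> twist X"
    and twist_tensor: "twist (X \<otimes>\<^sub>o Y) = braid Y X \<bullet> braid X Y \<bullet> (twist X \<otimes>\<^sub>m twist Y)"
    and twist_dual: "twist (dual X) = dual_mor X X (twist X)"
begin

text \<open>The quantum trace of an endomorphism \<open>f\<close> of \<open>X\<close> is an endomorphism
  \<open>1 \<rightarrow> X \<otimes> X* \<rightarrow> X* \<otimes> X \<rightarrow> 1\<close> of the unit object, which is identified with a scalar. The twist
  and the braiding in this formula encode the spherical structure of the ribbon category.\<close>

definition qtrace :: "'o \<Rightarrow> 'm \<Rightarrow> 'k" where
  "qtrace X f = (THE a. ev X \<bullet> braid X (dual X) \<bullet> ((twist X \<bullet> f) \<otimes>\<^sub>m ide (dual X)) \<bullet> coev X =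
                        a \<cdot>\<^sub>s ide \<one>\<^sub>o)"

definition qdim :: "'o \<Rightarrow> 'k" where
  "qdim X = qtrace X (ide X)"

definition smatrix :: "'o \<Rightarrow> 'o \<Rightarrow> 'k" where
  "smatrix X Y = qtrace (Y \<otimes>\<^sub>o X) (braid X Y \<bullet> braid Y X)"

definition smatrix_nondegenerate :: bool where
  "smatrix_nondegenerate \<longleftrightarrow>
     (\<exists>t. \<forall>X\<in>Irr. \<forall>Y\<in>Irr.
        (\<Sum>Z\<in>Irr. smatrix X Z * t Z Y) = (if X = Y then 1 else 0) \<and>
        (\<Sum>Z\<in>Irr. t X Z * smatrix Z Y) = (if X = Y then 1 else 0))"

definition categorical_dim :: 'k where
  "categorical_dim = (\<Sum>X\<in>Irr. (qdim X)\<^sup>2)"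

definition centralizer :: "'o set \<Rightarrow> 'o set" where
  "centralizer K =
     generated_subcategory {X. simple X \<and> (\<forall>Y\<in>K. simple Y \<longrightarrow> smatrix X Y = qdim X * qdim Y)}"

text \<open>
  Entries of the S-matrix are regarded as complex numbers through a field embedding \<open>\<iota>\<close> of the
  subfield that they generate; its values elsewhere are irrelevant. (The entries are cyclotomic,
  so every embedding of the cyclotomic subfield of the ground field restricts to such an
  embedding, and every \<open>\<iota>\<close> arises in this way.) Pseudounitarity refers to this identification.
\<close>

definition smatrix_field :: "'k set" where
  "smatrix_field = generate_field ring_of_type_algebra {smatrix X Y |X Y. X \<in> Irr \<and> Y \<in> Irr}"

definition is_complex_embedding :: "('k \<Rightarrow> complex) \<Rightarrow> bool" where
  "is_complex_embedding \<iota> \<longleftrightarrow>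
     \<iota> \<in> ring_hom (ring_of_type_algebra\<lparr>carrier := smatrix_field\<rparr>) ring_of_type_algebra"

definition pseudounitary :: "('k \<Rightarrow> complex) \<Rightarrow> (('o \<Rightarrow> int) \<Rightarrow> real) \<Rightarrow> bool" where
  "pseudounitary \<iota> \<phi> \<longleftrightarrow> \<iota> categorical_dim = of_real (FPdim_cat \<phi>)"

text \<open>The spherical structure given by the twist is the canonical one.\<close>

definition canonical_spherical :: "('k \<Rightarrow> complex) \<Rightarrow> (('o \<Rightarrow> int) \<Rightarrow> real) \<Rightarrow> bool" where
  "canonical_spherical \<iota> \<phi> \<longleftrightarrow> (\<forall>X\<in>Irr. \<iota> (qdim X) = of_real (\<phi> (obj_class X)))"

end

locale modular_category = ribbon_fusion_category C
  for C :: "('k::{alg_closed_field,field_char_0}, 'o, 'm::ab_group_add, 'z) ribbon_data_scheme"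
    (structure) +
  assumes nondegenerate: smatrix_nondegenerate

end

theory Submission
  imports Defs
begin

text \<open>Let \<open>d\<close> be the Frobenius-Perron dimensions and \<open>s\<close> the S-matrix. Each \<open>\<chi>\<^sub>i(j) = s\<^sub>i\<^sub>j / d\<^sub>i\<close> is a
  character of the Grothendieck ring, because the scalar by which a loop coloured by \<open>X\<close> around a
  simple strand acts is multiplicative in \<open>X\<close>. Distinct characters are orthogonal with respect to the
  Casimir element, which gives \<open>\<chi>\<^sub>i(j\<^sup>*) = cnj (\<chi>\<^sub>i(j))\<close>, the formula for the square of \<open>s\<close>, and
  \<open>J'' = J\<close> for the centralizers of fusion subcategories. If \<open>g\<close> is invertible then
  \<open>\<bar>s\<^sub>g\<^sub>k\<bar> = d\<^sub>k\<close>, and \<open>d\<^sub>k\<^sup>2 = s\<^sub>g\<^sub>k s\<^sub>g\<^sub>k\<^sub>* = \<Sum>\<^sub>l N\<^sub>k\<^sub>k\<^sub>*\<^sup>l s\<^sub>g\<^sub>l\<close> forces \<open>s\<^sub>g\<^sub>l = d\<^sub>l\<close> for all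
  constituents \<open>l\<close> of \<open>k \<otimes> k\<^sup>*\<close>. Conversely, if \<open>i\<close> centralizes the adjoint subcategory then
  \<open>dim = \<Sum>\<^sub>k s\<^sub>i\<^sub>k s\<^sub>i\<^sub>k\<^sub>* = d\<^sub>i\<^sup>2 dim\<close>, so \<open>i\<close> is invertible.

  The diagrammatic computations take place in a strict category whose objects are lists of objects:
  a list stands for the endofunctor \<open>X\<^sub>1 \<otimes> (\<dots> (X\<^sub>n \<otimes> -))\<close>, and strictness is composition of functors.\<close>

section \<open>Semisimple linear categories\<close>

text \<open>Composition is constrained on Hom sets only and the tensor product is not strict, so
  diagrams drawn directly in the category would drown in membership conditions and associators.
  Functors compose strictly, and a junk value makes composition total. Only transformations
  compatible with tensoring on the right are kept: they are determined by their value at the unit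
  object, hence come from morphisms, so equations between diagrams can be carried back.

  Non-degeneracy enters twice: it makes the unit row of \<open>s\<close> equal to \<open>d\<close>,
  and it makes the characters pairwise distinct. Positivity of \<open>d\<close>, supplied by the
  canonical spherical structure, keeps the Casimir sums away from zero.

  Each inclusion is tested against an arbitrary fusion subcategory \<open>D\<close> that contains
  the generators. If \<open>D\<close> contains those of the adjoint subcategory, a simple object
  centralizing \<open>D\<close> is invertible. Hence whatever centralizes the invertible objects
  also centralizes the centralizer of \<open>D\<close>, and so lies in \<open>D\<close>.\<close>

context linear_category
begin

lemma zero_in_Hom [simp]: "0 \<in> Hom X Y"
  using subspace_Hom subspace_0 by blast

lemma add_in_Hom: "\<lbrakk>f \<in> Hom X Y; g \<in> Hom X Y\<rbrakk> \<Longrightarrow> f + g \<in> Hom X Y"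
  using subspace_Hom subspace_add by blast

lemma diff_in_Hom: "\<lbrakk>f \<in> Hom X Y; g \<in> Hom X Y\<rbrakk> \<Longrightarrow> f - g \<in> Hom X Y"
  using subspace_Hom subspace_diff by blast

lemma smult_in_Hom: "f \<in> Hom X Y \<Longrightarrow> a \<cdot>\<^sub>s f \<in> Hom X Y"
  using subspace_Hom subspace_scale by blast

lemma sum_in_Hom: "(\<And>a. a \<in> A \<Longrightarrow> f a \<in> Hom X Y) \<Longrightarrow> (\<Sum>a\<in>A. f a) \<in> Hom X Y"
  using subspace_Hom subspace_sum by blast

lemma comp_zero_left [simp]: "f \<in> Hom X Y \<Longrightarrow> 0 \<bullet> f = 0"
  using comp_add_left[of 0 Y Y 0 f X] by simp

lemma comp_zero_right [simp]: "g \<in> Hom Y Z \<Longrightarrow> g \<bullet> 0 = 0"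
  using comp_add_right[of g Y Z 0 Y 0] by simp

lemma comp_diff_left:
  "\<lbrakk>g \<in> Hom Y Z; g' \<in> Hom Y Z; f \<in> Hom X Y\<rbrakk> \<Longrightarrow> (g - g') \<bullet> f = g \<bullet> f - g' \<bullet> f"
  using comp_add_left[of "g - g'" Y Z g' f X] diff_in_Hom by (simp add: algebra_simps)

lemma comp_diff_right:
  "\<lbrakk>g \<in> Hom Y Z; f \<in> Hom X Y; f' \<in> Hom X Y\<rbrakk> \<Longrightarrow> g \<bullet> (f - f') = g \<bullet> f - g \<bullet> f'"
  using comp_add_right[of g Y Z "f - f'" X f'] diff_in_Hom by (simp add: algebra_simps)

lemma comp_sum_left:
  assumes "f \<in> Hom X Y" "\<And>a. a \<in> A \<Longrightarrow> g a \<in> Hom Y Z"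
  shows "(\<Sum>a\<in>A. g a) \<bullet> f = (\<Sum>a\<in>A. g a \<bullet> f)"
  using assms(2)
proof (induction A rule: infinite_finite_induct)
  case (insert a A)
  then show ?case
    using comp_add_left[of "g a" Y Z "sum g A" f X] sum_in_Hom[of A g Y Z] assms(1) by simp
qed (use assms(1) in simp_all)

lemma comp_sum_right:
  assumes "g \<in> Hom Y Z" "\<And>a. a \<in> A \<Longrightarrow> f a \<in> Hom X Y"
  shows "g \<bullet> (\<Sum>a\<in>A. f a) = (\<Sum>a\<in>A. g \<bullet> f a)"
  using assms(2)
proof (induction A rule: infinite_finite_induct)
  case (insert a A)
  then show ?case
    using comp_add_right[of g Y Z "f a" X "sum f A"] sum_in_Hom[of A f X Y] assms(1) by simp
qed (use assms(1) in simp_all)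

lemma comp_middle:
  assumes "d \<in> Hom V W" "c \<in> Hom W X" "b \<in> Hom X Y" "a \<in> Hom Y Z"
  shows "(a \<bullet> b) \<bullet> (c \<bullet> d) = a \<bullet> ((b \<bullet> c) \<bullet> d)"
  using comp_assoc[OF assms(4,3) comp_in_Hom[OF assms(2,1)]] comp_assoc[OF assms(3,2,1)] by simp

lemma inversesD:
  assumes "inverses X Y f g"
  shows "f \<in> Hom X Y" "g \<in> Hom Y X" "g \<bullet> f = ide X" "f \<bullet> g = ide Y"
  using assms by (auto simp: inverses_def)

lemma inverses_unique:
  assumes "inverses X Y f g" "inverses X Y f h"
  shows "g = h"
proof -
  note a = inversesD[OF assms(1)] and b = inversesD[OF assms(2)]
  show ?thesis
    using comp_assoc[OF a(2,1) b(2)] a(3) b(4) comp_ide_left[OF b(2)] comp_ide_right[OF a(2)] by simp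
qed

lemma inv_mor_inverses: "is_iso X Y f \<Longrightarrow> inverses X Y f (inv_mor X Y f)"
  unfolding is_iso_def inv_mor_def by (metis inverses_unique theI)

lemmas inv_mor_in_Hom = inversesD(2)[OF inv_mor_inverses]
  and inv_mor_comp = inversesD(3)[OF inv_mor_inverses]
  and comp_inv_mor = inversesD(4)[OF inv_mor_inverses]

lemma is_iso_in_Hom: "is_iso X Y f \<Longrightarrow> f \<in> Hom X Y"
  by (auto simp: is_iso_def inverses_def)

lemma inverses_sym: "inverses X Y f g \<Longrightarrow> inverses Y X g f"
  by (auto simp: inverses_def)

lemma inverses_comp:
  assumes "inverses X Y f g" "inverses Y Z f' g'"
  shows "inverses X Z (f' \<bullet> f) (g \<bullet> g')"
proof -
  note a = inversesD[OF assms(1)] and b = inversesD[OF assms(2)]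
  have "(g \<bullet> g') \<bullet> (f' \<bullet> f) = g \<bullet> ((g' \<bullet> f') \<bullet> f)"
    by (rule comp_middle[OF a(1) b(1,2) a(2)])
  moreover have "(f' \<bullet> f) \<bullet> (g \<bullet> g') = f' \<bullet> ((f \<bullet> g) \<bullet> g')"
    by (rule comp_middle[OF b(2) a(2,1) b(1)])
  ultimately show ?thesis
    using a b by (auto simp: inverses_def comp_ide_left intro: comp_in_Hom)
qed

lemma is_iso_comp: "\<lbrakk>is_iso X Y f; is_iso Y Z g\<rbrakk> \<Longrightarrow> is_iso X Z (g \<bullet> f)"
  unfolding is_iso_def using inverses_comp by blast

lemma is_iso_ide: "is_iso X X (ide X)"
  unfolding is_iso_def inverses_def using ide_in_Hom comp_ide_left by blast

lemma isomorphic_refl: "isomorphic X X"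
  unfolding isomorphic_def using is_iso_ide by blast

lemma isomorphic_sym: "isomorphic X Y \<Longrightarrow> isomorphic Y X"
  unfolding isomorphic_def is_iso_def using inverses_sym by blast

lemma isomorphic_trans: "\<lbrakk>isomorphic X Y; isomorphic Y Z\<rbrakk> \<Longrightarrow> isomorphic X Z"
  unfolding isomorphic_def using is_iso_comp by blast

lemma iso_cancel_left:
  assumes "is_iso Y Z g" "f \<in> Hom X Y" "f' \<in> Hom X Y" "g \<bullet> f = g \<bullet> f'"
  shows "f = f'"
proof -
  note g = inversesD[OF inv_mor_inverses[OF assms(1)]]
  have "h = inv_mor Y Z g \<bullet> (g \<bullet> h)" if "h \<in> Hom X Y" for h
    using comp_assoc[OF g(2,1) that] g(3) comp_ide_left[OF that] by simp
  then show ?thesis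
    using assms by metis
qed

lemma iso_cancel_right:
  assumes "is_iso X Y g" "f \<in> Hom Y Z" "f' \<in> Hom Y Z" "f \<bullet> g = f' \<bullet> g"
  shows "f = f'"
proof -
  note g = inversesD[OF inv_mor_inverses[OF assms(1)]]
  have "h = (h \<bullet> g) \<bullet> inv_mor X Y g" if "h \<in> Hom Y Z" for h
    using comp_assoc[OF that g(1,2)] g(4) comp_ide_right[OF that] by simp
  then show ?thesis
    using assms by metis
qed

lemma is_zero_obj_iff: "is_zero_obj X \<longleftrightarrow> ide X = 0"
proof
  assume "ide X = 0"
  then have "f = 0" if "f \<in> Hom X Y" for f Y
    using comp_ide_right[OF that] comp_zero_right[OF that] \<open>ide X = 0\<close> by simp
  moreover have "f = 0" if "f \<in> Hom Y X" for f Y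
    using comp_ide_left[OF that] comp_zero_left[OF that] \<open>ide X = 0\<close> by simp
  ultimately show "is_zero_obj X"
    by (auto simp: is_zero_obj_def)
next
  assume "is_zero_obj X"
  then show "ide X = 0"
    using ide_in_Hom unfolding is_zero_obj_def by blast
qed

lemma iso_is_mono: "is_iso X Y f \<Longrightarrow> is_mono X Y f"
  unfolding is_mono_def using iso_cancel_left is_iso_in_Hom by blast

lemma split_mono_is_mono:
  assumes "i \<in> Hom X Y" "p \<in> Hom Y X" "p \<bullet> i = ide X"
  shows "is_mono X Y i"
  unfolding is_mono_def
proof (intro conjI allI ballI impI assms(1))
  fix W g h assume gh: "g \<in> Hom W X" "h \<in> Hom W X" "i \<bullet> g = i \<bullet> h"
  have "f = p \<bullet> (i \<bullet> f)" if "f \<in> Hom W X" for f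
    using comp_assoc[OF assms(2,1) that] assms(3) comp_ide_left[OF that] by simp
  then show "g = h"
    using gh by metis
qed

lemma is_mono_comp:
  assumes f: "is_mono X Y f" and g: "is_mono Y Z g"
  shows "is_mono X Z (g \<bullet> f)"
  unfolding is_mono_def
proof (intro conjI allI ballI impI)
  have fg: "f \<in> Hom X Y" "g \<in> Hom Y Z"
    using f g by (auto simp: is_mono_def)
  then show "g \<bullet> f \<in> Hom X Z"
    by (rule comp_in_Hom[rotated])
  fix W h h' assume h: "h \<in> Hom W X" "h' \<in> Hom W X" "(g \<bullet> f) \<bullet> h = (g \<bullet> f) \<bullet> h'"
  then have "g \<bullet> (f \<bullet> h) = g \<bullet> (f \<bullet> h')"
    using comp_assoc[OF fg(2,1)] by simp
  then have "f \<bullet> h = f \<bullet> h'"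
    using g h(1,2) fg(1) comp_in_Hom unfolding is_mono_def by blast
  then show "h = h'"
    using f h(1,2) unfolding is_mono_def by blast
qed

lemma kernel_is_mono:
  assumes "is_kernel K k X Y f"
  shows "is_mono K X k"
  unfolding is_mono_def
proof (intro conjI allI ballI impI)
  have k: "f \<in> Hom X Y" "k \<in> Hom K X" "f \<bullet> k = 0"
    using assms by (auto simp: is_kernel_def)
  show "k \<in> Hom K X" by fact
  fix W g h assume gh: "g \<in> Hom W K" "h \<in> Hom W K" "k \<bullet> g = k \<bullet> h"
  have "f \<bullet> (k \<bullet> g) = 0"
    using comp_assoc[OF k(1,2) gh(1)] k(3) comp_zero_left[OF gh(1)] by simp
  then have "\<exists>!u. u \<in> Hom W K \<and> k \<bullet> u = k \<bullet> g"
    using assms comp_in_Hom[OF k(2) gh(1)] unfolding is_kernel_def by blast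
  then show "g = h"
    using gh by metis
qed

text \<open>Unlike in \<open>is_direct_sum\<close>, the summands are indexed by an arbitrary finite
  set: a refined decomposition is indexed by a dependent sum and a tensor product of decompositions
  by a product, with no arithmetic on list positions.\<close>

definition biproduct :: "'o \<Rightarrow> 'a set \<Rightarrow> ('a \<Rightarrow> 'o) \<Rightarrow> ('a \<Rightarrow> 'm) \<Rightarrow> ('a \<Rightarrow> 'm) \<Rightarrow> bool" where
  "biproduct X A F i p \<longleftrightarrow> finite A \<and>
     (\<forall>a\<in>A. i a \<in> Hom (F a) X \<and> p a \<in> Hom X (F a)) \<and>
     (\<forall>a\<in>A. \<forall>b\<in>A. p a \<bullet> i b = (if a = b then ide (F a) else 0)) \<and>
     (\<Sum>a\<in>A. i a \<bullet> p a) = ide X"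

lemma is_direct_sum_iff:
  "is_direct_sum X Xs \<longleftrightarrow> (\<exists>i p. biproduct X {..<length Xs} (nth Xs) i p)"
  unfolding is_direct_sum_def biproduct_def by (simp add: Ball_def)

lemma biproductD:
  assumes "biproduct X A F i p"
  shows "finite A" "\<And>a. a \<in> A \<Longrightarrow> i a \<in> Hom (F a) X" "\<And>a. a \<in> A \<Longrightarrow> p a \<in> Hom X (F a)"
    "\<And>a. a \<in> A \<Longrightarrow> p a \<bullet> i a = ide (F a)"
    "\<And>a b. \<lbrakk>a \<in> A; b \<in> A; a \<noteq> b\<rbrakk> \<Longrightarrow> p a \<bullet> i b = 0"
    "(\<Sum>a\<in>A. i a \<bullet> p a) = ide X"
  using assms by (auto simp: biproduct_def)

text \<open>Serves to refine any decomposition into one with simple summands. Orthogonality is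
  inherited because \<open>p a \<bullet> i a'\<close> is already zero or an identity.\<close>

lemma biproduct_Sigma:
  assumes b: "biproduct X A F i p" and c: "\<And>a. a \<in> A \<Longrightarrow> biproduct (F a) (B a) (G a) (j a) (q a)"
  shows "biproduct X (Sigma A B) (\<lambda>(a, b). G a b) (\<lambda>(a, b). i a \<bullet> j a b) (\<lambda>(a, b). q a b \<bullet> p a)"
proof -
  note bD = biproductD[OF b] and cD = biproductD[OF c]
  have orth: "(q a b \<bullet> p a) \<bullet> (i a' \<bullet> j a' b') = (if (a, b) = (a', b') then ide (G a b) else 0)"
    if ab: "a \<in> A" "b \<in> B a" "a' \<in> A" "b' \<in> B a'" for a b a' b'
  proof -
    have "(q a b \<bullet> p a) \<bullet> (i a' \<bullet> j a' b') = q a b \<bullet> (p a \<bullet> (i a' \<bullet> j a' b'))"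
      by (rule comp_assoc[OF cD(3)[OF ab(1,2)] bD(3)[OF ab(1)] comp_in_Hom[OF bD(2)[OF ab(3)] cD(2)[OF ab(3,4)]]])
    also have "p a \<bullet> (i a' \<bullet> j a' b') = (p a \<bullet> i a') \<bullet> j a' b'"
      by (rule comp_assoc[OF bD(3)[OF ab(1)] bD(2)[OF ab(3)] cD(2)[OF ab(3,4)], symmetric])
    finally have *: "(q a b \<bullet> p a) \<bullet> (i a' \<bullet> j a' b') = q a b \<bullet> ((p a \<bullet> i a') \<bullet> j a' b')" .
    show ?thesis
    proof (cases "a = a'")
      case True
      then have "(q a b \<bullet> p a) \<bullet> (i a' \<bullet> j a' b') = q a b \<bullet> j a b'"
        using * bD(4)[OF ab(1)] comp_ide_left[OF cD(2)[OF ab(3,4)]] by simp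
      then show ?thesis
        using True cD(4,5)[OF ab(1)] ab by (cases "b = b'") auto
    next
      case False
      then show ?thesis
        using * bD(5)[OF ab(1,3)] comp_zero_left[OF cD(2)[OF ab(3,4)]]
          comp_zero_right[OF cD(3)[OF ab(1,2)]] by simp
    qed
  qed
  have "(\<Sum>(a, b)\<in>Sigma A B. (i a \<bullet> j a b) \<bullet> (q a b \<bullet> p a)) =
      (\<Sum>a\<in>A. \<Sum>b\<in>B a. (i a \<bullet> j a b) \<bullet> (q a b \<bullet> p a))"
    using bD(1) cD(1) by (subst sum.Sigma) auto
  also have "\<dots> = (\<Sum>a\<in>A. i a \<bullet> p a)"
  proof (rule sum.cong[OF refl])
    fix a assume a: "a \<in> A"
    have "(\<Sum>b\<in>B a. (i a \<bullet> j a b) \<bullet> (q a b \<bullet> p a)) = (\<Sum>b\<in>B a. i a \<bullet> ((j a b \<bullet> q a b) \<bullet> p a))"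
    proof (rule sum.cong[OF refl])
      fix b assume b: "b \<in> B a"
      show "(i a \<bullet> j a b) \<bullet> (q a b \<bullet> p a) = i a \<bullet> ((j a b \<bullet> q a b) \<bullet> p a)"
        by (rule comp_middle[OF bD(3)[OF a] cD(3,2)[OF a b] bD(2)[OF a]])
    qed
    also have "\<dots> = i a \<bullet> (\<Sum>b\<in>B a. (j a b \<bullet> q a b) \<bullet> p a)"
      using comp_in_Hom[OF comp_in_Hom[OF cD(2)[OF a] cD(3)[OF a]] bD(3)[OF a]]
      by (intro comp_sum_right[symmetric, where X = X, OF bD(2)[OF a]])
    also have "(\<Sum>b\<in>B a. (j a b \<bullet> q a b) \<bullet> p a) = (\<Sum>b\<in>B a. j a b \<bullet> q a b) \<bullet> p a"
      using comp_in_Hom[OF cD(2)[OF a] cD(3)[OF a]]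
      by (intro comp_sum_left[symmetric, where Z = "F a", OF bD(3)[OF a]])
    finally show "(\<Sum>b\<in>B a. (i a \<bullet> j a b) \<bullet> (q a b \<bullet> p a)) = i a \<bullet> p a"
      using cD(6)[OF a] comp_ide_left[OF bD(3)[OF a]] by simp
  qed
  finally have "(\<Sum>x\<in>Sigma A B. (case x of (a, b) \<Rightarrow> i a \<bullet> j a b) \<bullet> (case x of (a, b) \<Rightarrow> q a b \<bullet> p a)) = ide X"
    using bD(6) by (simp add: case_prod_unfold)
  moreover have "finite (Sigma A B)"
    using bD(1) cD(1) by auto
  moreover have "i a \<bullet> j a b \<in> Hom (G a b) X" "q a b \<bullet> p a \<in> Hom X (G a b)"
    if "a \<in> A" "b \<in> B a" for a b
    using that comp_in_Hom bD(2,3) cD(2,3) by blast+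
  ultimately show ?thesis
    unfolding biproduct_def using orth by auto
qed

text \<open>The source of isomorphism invariance: an invariant that is additive on biproducts agrees
  on isomorphic objects, since both decompose into the same summands.\<close>

lemma biproduct_iso:
  assumes "biproduct X A F i p" "inverses X Y f g"
  shows "biproduct Y A F (\<lambda>a. f \<bullet> i a) (\<lambda>a. p a \<bullet> g)"
proof -
  note bD = biproductD[OF assms(1)] and fg = inversesD[OF assms(2)]
  have "(p a \<bullet> g) \<bullet> (f \<bullet> i b) = p a \<bullet> i b" if "a \<in> A" "b \<in> A" for a b
    using comp_middle[OF bD(2)[OF that(2)] fg(1,2) bD(3)[OF that(1)]] fg(3)
      comp_ide_left[OF bD(2)[OF that(2)]] by simp
  moreover have "(\<Sum>a\<in>A. (f \<bullet> i a) \<bullet> (p a \<bullet> g)) = f \<bullet> ((\<Sum>a\<in>A. i a \<bullet> p a) \<bullet> g)"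
  proof -
    have "(f \<bullet> i a) \<bullet> (p a \<bullet> g) = f \<bullet> ((i a \<bullet> p a) \<bullet> g)" if "a \<in> A" for a
      by (rule comp_middle[OF fg(2) bD(3,2)[OF that] fg(1)])
    then have "(\<Sum>a\<in>A. (f \<bullet> i a) \<bullet> (p a \<bullet> g)) = (\<Sum>a\<in>A. f \<bullet> ((i a \<bullet> p a) \<bullet> g))"
      by simp
    also have "\<dots> = f \<bullet> (\<Sum>a\<in>A. (i a \<bullet> p a) \<bullet> g)"
      using comp_in_Hom[OF comp_in_Hom[OF bD(2) bD(3)] fg(2)]
      by (intro comp_sum_right[symmetric, where X = Y, OF fg(1)])
    also have "(\<Sum>a\<in>A. (i a \<bullet> p a) \<bullet> g) = (\<Sum>a\<in>A. i a \<bullet> p a) \<bullet> g"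
      using comp_in_Hom[OF bD(2) bD(3)]
      by (intro comp_sum_left[symmetric, where Z = X, OF fg(2)])
    finally show ?thesis .
  qed
  ultimately show ?thesis
    using bD fg comp_in_Hom[OF fg(1)] comp_in_Hom[OF _ fg(2)] comp_ide_left[OF fg(2)]
    unfolding biproduct_def by auto
qed

end

section \<open>Schur's lemma: morphisms between simple objects\<close>

context abelian_category
begin

text \<open>The kernel of \<open>f\<close> is a subobject of the simple \<open>X\<close>, so it is
  zero or all of \<open>X\<close>; the latter would make \<open>f\<close> vanish. With zero kernel,
  \<open>f\<close> can be cancelled by passing to differences.\<close>

lemma nonzero_from_simple_is_mono:
  assumes "simple X" "f \<in> Hom X Y" "f \<noteq> 0"
  shows "is_mono X Y f"
proof -
  obtain K k where k: "is_kernel K k X Y f"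
    using kernel_exists assms(2) by blast
  then have kk: "k \<in> Hom K X" "f \<bullet> k = 0"
    by (auto simp: is_kernel_def)
  have "\<not> is_iso K X k"
  proof
    assume "is_iso K X k"
    from iso_cancel_right[OF this assms(2) zero_in_Hom] kk show False
      using assms(3) by simp
  qed
  then have K: "is_zero_obj K"
    using assms(1) kernel_is_mono[OF k] unfolding simple_def by blast
  have "g = h" if gh: "g \<in> Hom W X" "h \<in> Hom W X" "f \<bullet> g = f \<bullet> h" for g h W
  proof -
    have "f \<bullet> (g - h) = 0"
      using comp_diff_right[OF assms(2) gh(1,2)] gh(3) by simp
    then obtain u where "u \<in> Hom W K" "k \<bullet> u = g - h"
      using k diff_in_Hom[OF gh(1,2)] unfolding is_kernel_def by blast
    then show ?thesis
      using K comp_zero_right[OF kk(1)] unfolding is_zero_obj_def by force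
  qed
  then show ?thesis
    using assms(2) by (auto simp: is_mono_def)
qed

lemma Schur_iso:
  assumes "simple X" "simple Y" "f \<in> Hom X Y" "f \<noteq> 0"
  shows "is_iso X Y f"
  using nonzero_from_simple_is_mono[OF assms(1,3,4)] assms(1,2) unfolding simple_def by blast

text \<open>A subobject of \<open>Y\<close> becomes a subobject of \<open>X\<close> after
  composition with the inverse isomorphism.\<close>

lemma simple_iso:
  assumes "simple X" "isomorphic X Y"
  shows "simple Y"
proof -
  obtain f g where fg: "inverses X Y f g"
    using assms(2) unfolding isomorphic_def is_iso_def by blast
  note fgD = inversesD[OF fg]
  have "ide Y \<noteq> 0"
  proof
    assume 0: "ide Y = 0"
    then have "g = 0"
      using comp_ide_right[OF fgD(2)] comp_zero_right[OF fgD(2)] by simp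
    then have "ide X = 0"
      using comp_zero_left[OF fgD(1)] fgD(3) by simp
    then show False
      using assms(1) by (simp add: simple_def is_zero_obj_iff)
  qed
  moreover have "is_zero_obj W \<or> is_iso W Y h" if h: "is_mono W Y h" for W h
  proof -
    have "is_mono W X (g \<bullet> h)"
      using is_mono_comp[OF h] iso_is_mono fg inverses_sym unfolding is_iso_def by blast
    then have "is_zero_obj W \<or> is_iso W X (g \<bullet> h)"
      using assms(1) by (auto simp: simple_def)
    moreover have "h = f \<bullet> (g \<bullet> h)"
      using comp_assoc[OF fgD(1,2), of h W] h fgD(4) comp_ide_left[of h W Y] by (simp add: is_mono_def)
    ultimately show ?thesis
      using is_iso_comp fg unfolding is_iso_def by metis
  qed
  ultimately show ?thesis
    by (auto simp: simple_def is_zero_obj_iff)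
qed

end

section \<open>Additivity of the tensor product\<close>

context linear_monoidal_category
begin

lemma tensor_zero_left: "g \<in> Hom Y Y' \<Longrightarrow> 0 \<otimes>\<^sub>m g = 0"
  using tensor_add_left[of 0 Y Y 0 g] by simp

lemma tensor_zero_right: "f \<in> Hom X X' \<Longrightarrow> f \<otimes>\<^sub>m 0 = 0"
  using tensor_add_right[of f X X' 0 X X 0] by simp

lemma tensor_sum_left:
  assumes "g \<in> Hom Y Y'" "\<And>a. a \<in> A \<Longrightarrow> f a \<in> Hom X X'"
  shows "(\<Sum>a\<in>A. f a) \<otimes>\<^sub>m g = (\<Sum>a\<in>A. f a \<otimes>\<^sub>m g)"
  using assms(2)
proof (induction A rule: infinite_finite_induct)
  case (insert a A)
  then show ?case
    using tensor_add_left[of "f a" X X' "sum f A" g] sum_in_Hom[of A f X X'] assms(1) by simp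
qed (use tensor_zero_left[OF assms(1)] in simp_all)

lemma tensor_sum_right:
  assumes "f \<in> Hom X X'" "\<And>a. a \<in> A \<Longrightarrow> g a \<in> Hom Y Y'"
  shows "f \<otimes>\<^sub>m (\<Sum>a\<in>A. g a) = (\<Sum>a\<in>A. f \<otimes>\<^sub>m g a)"
  using assms(2)
proof (induction A rule: infinite_finite_induct)
  case (insert a A)
  then show ?case
    using tensor_add_right[of f X X' "g a" Y Y' "sum g A"] sum_in_Hom[of A g Y Y'] assms(1) by simp
qed (use tensor_zero_right[OF assms(1)] in simp_all)

lemma inverses_tensor:
  assumes "inverses X X' f f'" "inverses Y Y' g g'"
  shows "inverses (X \<otimes>\<^sub>o Y) (X' \<otimes>\<^sub>o Y') (f \<otimes>\<^sub>m g) (f' \<otimes>\<^sub>m g')"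
proof -
  note f = inversesD[OF assms(1)] and g = inversesD[OF assms(2)]
  show ?thesis
    unfolding inverses_def
    using tensor_in_Hom[OF f(1) g(1)] tensor_in_Hom[OF f(2) g(2)]
      tensor_comp[OF f(1,2) g(1,2)] tensor_comp[OF f(2,1) g(2,1)] f(3,4) g(3,4) tensor_ide by simp
qed

lemma is_iso_tensor:
  "\<lbrakk>is_iso X X' f; is_iso Y Y' g\<rbrakk> \<Longrightarrow> is_iso (X \<otimes>\<^sub>o Y) (X' \<otimes>\<^sub>o Y') (f \<otimes>\<^sub>m g)"
  unfolding is_iso_def using inverses_tensor by blast

lemma isomorphic_tensor:
  "\<lbrakk>isomorphic X X'; isomorphic Y Y'\<rbrakk> \<Longrightarrow> isomorphic (X \<otimes>\<^sub>o Y) (X' \<otimes>\<^sub>o Y')"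
  unfolding isomorphic_def using is_iso_tensor by blast

lemma biproduct_tensor:
  assumes b: "biproduct X A F i p" and c: "biproduct Y B G j q"
  shows "biproduct (X \<otimes>\<^sub>o Y) (A \<times> B) (\<lambda>(a, b). F a \<otimes>\<^sub>o G b) (\<lambda>(a, b). i a \<otimes>\<^sub>m j b) (\<lambda>(a, b). p a \<otimes>\<^sub>m q b)"
proof -
  note bD = biproductD[OF b] and cD = biproductD[OF c]
  have orth: "(p a \<otimes>\<^sub>m q b) \<bullet> (i a' \<otimes>\<^sub>m j b') = (if (a, b) = (a', b') then ide (F a \<otimes>\<^sub>o G b) else 0)"
    if ab: "a \<in> A" "b \<in> B" "a' \<in> A" "b' \<in> B" for a b a' b'
  proof -
    have *: "(p a \<otimes>\<^sub>m q b) \<bullet> (i a' \<otimes>\<^sub>m j b') = (p a \<bullet> i a') \<otimes>\<^sub>m (q b \<bullet> j b')"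
      by (rule tensor_comp[symmetric, OF bD(2)[OF ab(3)] bD(3)[OF ab(1)] cD(2)[OF ab(4)] cD(3)[OF ab(2)]])
    show ?thesis
      using * ab bD(4,5) cD(4,5) tensor_ide
        tensor_zero_left[OF comp_in_Hom[OF cD(3)[OF ab(2)] cD(2)[OF ab(4)]]]
        tensor_zero_right[OF comp_in_Hom[OF bD(3)[OF ab(1)] bD(2)[OF ab(3)]]]
      by (cases "a = a'"; cases "b = b'") auto
  qed
  have "(\<Sum>(a, b)\<in>A \<times> B. (i a \<otimes>\<^sub>m j b) \<bullet> (p a \<otimes>\<^sub>m q b)) = (\<Sum>a\<in>A. \<Sum>b\<in>B. (i a \<bullet> p a) \<otimes>\<^sub>m (j b \<bullet> q b))"
    using tensor_comp[OF bD(3,2) cD(3,2)] by (simp add: sum.cartesian_product[symmetric])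
  also have "\<dots> = (\<Sum>a\<in>A. (i a \<bullet> p a) \<otimes>\<^sub>m (\<Sum>b\<in>B. j b \<bullet> q b))"
    using comp_in_Hom[OF bD(2,3)] comp_in_Hom[OF cD(2,3)]
    by (intro sum.cong refl tensor_sum_right[symmetric, where Y = Y and Y' = Y and X = X and X' = X]) auto
  also have "\<dots> = (\<Sum>a\<in>A. i a \<bullet> p a) \<otimes>\<^sub>m (\<Sum>b\<in>B. j b \<bullet> q b)"
    using comp_in_Hom[OF bD(2,3)] cD(6) ide_in_Hom
    by (intro tensor_sum_left[symmetric, where Y = Y and Y' = Y and X = X and X' = X]) auto
  finally have "(\<Sum>x\<in>A \<times> B. (case x of (a, b) \<Rightarrow> i a \<otimes>\<^sub>m j b) \<bullet> (case x of (a, b) \<Rightarrow> p a \<otimes>\<^sub>m q b)) = ide (X \<otimes>\<^sub>o Y)"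
    using bD(6) cD(6) tensor_ide by (simp add: case_prod_unfold)
  then show ?thesis
    unfolding biproduct_def using orth bD(1) cD(1) tensor_in_Hom[OF bD(2) cD(2)] tensor_in_Hom[OF bD(3) cD(3)]
    by auto
qed

end

section \<open>Scalar endomorphisms, multiplicities and classes in the Grothendieck ring\<close>

context fusion_category
begin

text \<open>The value of a polynomial at the endomorphism \<open>f\<close>, by Horner's scheme.
  Endomorphisms are a subset of the type of all morphisms and form no ring type, so
  \<open>poly\<close> does not apply.\<close>

definition poly_end :: "'o \<Rightarrow> 'm \<Rightarrow> 'k poly \<Rightarrow> 'm" where
  "poly_end X f p = fold_coeffs (\<lambda>a r. a \<cdot>\<^sub>s ide X + f \<bullet> r) p 0"

context
  fixes X f
  assumes f: "f \<in> Hom X X"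
begin

lemma poly_end_0 [simp]: "poly_end X f 0 = 0"
  by (simp add: poly_end_def)

lemma poly_end_pCons: "poly_end X f (pCons a p) = a \<cdot>\<^sub>s ide X + f \<bullet> poly_end X f p"
  using comp_zero_right[OF f] by (cases "p = 0 \<and> a = 0") (auto simp: poly_end_def)

lemma poly_end_in_Hom: "poly_end X f p \<in> Hom X X"
  by (induction p) (auto simp: poly_end_pCons intro!: add_in_Hom smult_in_Hom ide_in_Hom comp_in_Hom[OF f])

lemma poly_end_add: "poly_end X f (p + q) = poly_end X f p + poly_end X f q"
  by (induction p q rule: poly_induct2)
     (auto simp: poly_end_pCons comp_add_right[OF f poly_end_in_Hom poly_end_in_Hom] scale_left_distrib)

lemma poly_end_smult: "poly_end X f (Polynomial.smult c p) = c \<cdot>\<^sub>s poly_end X f p"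
  by (induction p)
     (auto simp: poly_end_pCons comp_smult_right[OF f poly_end_in_Hom] scale_right_distrib)

lemma poly_end_sum: "poly_end X f (\<Sum>a\<in>A. p a) = (\<Sum>a\<in>A. poly_end X f (p a))"
  by (induction A rule: infinite_finite_induct) (auto simp: poly_end_add)

text \<open>Over an algebraically closed field it is enough to split off linear factors, so this is
  the only case of multiplicativity that is proved.\<close>

lemma poly_end_linear_factor:
  "poly_end X f ([:- a, 1:] * q) = (f - a \<cdot>\<^sub>s ide X) \<bullet> poly_end X f q"
proof -
  have "[:- a, 1:] * q = Polynomial.smult (- a) q + pCons 0 q"
    by (simp add: mult_pCons_left)
  then have "poly_end X f ([:- a, 1:] * q) = (- a) \<cdot>\<^sub>s poly_end X f q + f \<bullet> poly_end X f q"
    by (simp only: poly_end_add poly_end_smult poly_end_pCons) simp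
  moreover have "(f - a \<cdot>\<^sub>s ide X) \<bullet> poly_end X f q = f \<bullet> poly_end X f q - a \<cdot>\<^sub>s poly_end X f q"
    using comp_diff_left[OF f smult_in_Hom[OF ide_in_Hom] poly_end_in_Hom, of a q]
      comp_smult_left[OF ide_in_Hom[of X] poly_end_in_Hom, of a q]
      comp_ide_left[OF poly_end_in_Hom] by simp
  ultimately show ?thesis
    by simp
qed

text \<open>The exponents up to \<open>card B\<close> are more numerous than the elements of the
  spanning set \<open>B\<close>, so the powers of \<open>f\<close> satisfy a linear
  relation.\<close>

lemma poly_end_annihilated: "\<exists>p. p \<noteq> 0 \<and> poly_end X f p = 0"
proof -
  obtain B where B: "finite B" "Hom X X = span B"
    using Hom_finite_dim by blast
  define e where "e i = poly_end X f (monom 1 i)" for i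
  have e_smult: "poly_end X f (monom c i) = c \<cdot>\<^sub>s e i" for c i
    unfolding e_def poly_end_smult[symmetric] by (simp add: smult_monom)
  let ?I = "{..card B}"
  \<comment> \<open>Linear dependence is a property of sets, so two coinciding powers must be
    treated separately: their difference is then the relation.\<close>
  show ?thesis
  proof (cases "inj_on e ?I")
    case False
    then obtain i j where ij: "i \<noteq> j" "e i = e j"
      by (auto simp: inj_on_def)
    let ?p = "monom 1 i + Polynomial.smult (- 1) (monom (1::'k) j)"
    have "coeff ?p i = 1"
      using ij by simp
    then have "?p \<noteq> 0"
      by (metis coeff_0 zero_neq_one)
    moreover have "poly_end X f ?p = 0"
      using ij by (simp only: poly_end_add poly_end_smult e_def[symmetric]) simp
    ultimately show ?thesis
      by blast
  next
    case True
    have "dependent (e ` ?I)"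
    proof (rule ccontr)
      assume "\<not> dependent (e ` ?I)"
      then have "card (e ` ?I) \<le> card B"
        using independent_span_bound[OF B(1)] B(2) poly_end_in_Hom by (auto simp: e_def)
      then show False
        using card_image[OF True] by simp
    qed
    then obtain u where u: "\<exists>v\<in>e ` ?I. u v \<noteq> 0" "(\<Sum>v\<in>e ` ?I. u v \<cdot>\<^sub>s v) = 0"
      using dependent_finite[of "e ` ?I"] by auto
    let ?p = "\<Sum>i\<in>?I. monom (u (e i)) i"
    have "poly_end X f ?p = 0"
      using u(2) by (simp add: poly_end_sum e_smult sum.reindex[OF True])
    moreover obtain i where i: "i \<in> ?I" "u (e i) \<noteq> 0"
      using u(1) by blast
    have "coeff ?p i = u (e i)"
      using i by (simp add: coeff_sum)
    then have "?p \<noteq> 0"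
      using i by (metis coeff_0)
    ultimately show ?thesis
      by blast
  qed
qed

end

text \<open>If \<open>f\<close> were not scalar, every \<open>f - a \<cdot>\<^sub>s ide X\<close>
  would be an isomorphism. A non-zero polynomial in \<open>f\<close> is, up to a non-zero constant,
  a composite of such factors and therefore non-zero, which contradicts the annihilating
  polynomial.\<close>

theorem Schur_scalar:
  assumes X: "simple X" and f: "f \<in> Hom X X"
  shows "\<exists>a. f = a \<cdot>\<^sub>s ide X"
proof (rule ccontr)
  assume no: "\<nexists>a. f = a \<cdot>\<^sub>s ide X"
  have "poly_end X f p \<noteq> 0" if "p \<noteq> 0" for p
    using that
  proof (induction "degree p" arbitrary: p rule: less_induct)
    case less
    show ?case
    proof (cases "degree p > 0")
      case True
      then obtain a where "poly p a = 0"
        using alg_closed_imp_poly_has_root by blast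
      then obtain q where q: "p = [:- a, 1:] * q"
        by (auto simp: poly_eq_0_iff_dvd)
      with less.prems have "q \<noteq> 0"
        by auto
      then have "degree q < degree p"
        using q by (simp add: degree_mult_eq del: mult_pCons_left)
      then have "poly_end X f q \<noteq> 0"
        using less.hyps \<open>q \<noteq> 0\<close> by blast
      moreover have h: "f - a \<cdot>\<^sub>s ide X \<in> Hom X X"
        using diff_in_Hom[OF f smult_in_Hom[OF ide_in_Hom]] .
      have "is_iso X X (f - a \<cdot>\<^sub>s ide X)"
        using Schur_iso[OF X X h] no by auto
      ultimately have "(f - a \<cdot>\<^sub>s ide X) \<bullet> poly_end X f q \<noteq> (f - a \<cdot>\<^sub>s ide X) \<bullet> 0"
        using iso_cancel_left[OF _ poly_end_in_Hom[OF f] zero_in_Hom] by blast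
      then show ?thesis
        unfolding q poly_end_linear_factor[OF f] using comp_zero_right[OF h] by simp
    next
      case False
      then obtain c where "p = [:c:]"
        by (meson degree_eq_zeroE not_gr_zero)
      then show ?thesis
        using less.prems X f by (simp add: poly_end_pCons[OF f] poly_end_0[OF f] comp_zero_right[OF f] simple_def is_zero_obj_iff)
    qed
  qed
  then show False
    using poly_end_annihilated[OF f] by blast
qed

lemma simple_ide_nonzero: "simple X \<Longrightarrow> ide X \<noteq> 0"
  by (simp add: simple_def is_zero_obj_iff)

lemma simple_hom_isomorphic:
  assumes "simple X" "simple Y" "f \<in> Hom X Y" "f \<noteq> 0"
  shows "isomorphic X Y"
  using Schur_iso[OF assms] by (auto simp: isomorphic_def)

text \<open>A basis is given by the inclusions of the summands isomorphic to \<open>Z\<close>, each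
  precomposed with a chosen isomorphism. They span because a morphism from \<open>Z\<close> to a
  simple summand is zero or a multiple of that isomorphism.\<close>

lemma dim_Hom_biproduct:
  assumes Z: "simple Z" and b: "biproduct X A F i p" and F: "\<And>a. a \<in> A \<Longrightarrow> simple (F a)"
  shows "dim (Hom Z X) = card {a \<in> A. isomorphic (F a) Z}"
proof -
  note bD = biproductD[OF b]
  define A' where "A' = {a \<in> A. isomorphic (F a) Z}"
  have "\<forall>a\<in>A'. \<exists>u. is_iso Z (F a) u"
    using isomorphic_sym by (auto simp: A'_def isomorphic_def)
  then obtain u where u: "\<And>a. a \<in> A' \<Longrightarrow> is_iso Z (F a) (u a)"
    by metis
  note uH = is_iso_in_Hom[OF u]
  have A': "a \<in> A" if "a \<in> A'" for a
    using that by (simp add: A'_def)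
  define v where "v a = i a \<bullet> u a" for a
  have vH: "v a \<in> Hom Z X" if "a \<in> A'" for a
    unfolding v_def by (rule comp_in_Hom[OF bD(2)[OF A'[OF that]] uH[OF that]])
  have pv: "p a \<bullet> v c = (if a = c then u c else 0)" if "a \<in> A" "c \<in> A'" for a c
    unfolding v_def
    using comp_assoc[OF bD(3)[OF that(1)] bD(2)[OF A'[OF that(2)]] uH[OF that(2)]] bD(4,5) A'[OF that(2)]
      comp_ide_left[OF uH[OF that(2)]] comp_zero_left[OF uH[OF that(2)]] that by auto
  have u0: "u a \<noteq> 0" if "a \<in> A'" for a
  proof
    assume "u a = 0"
    then have "ide Z = 0"
      using inv_mor_comp[OF u[OF that]] comp_zero_right[OF inv_mor_in_Hom[OF u[OF that]]] by simp
    then show False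
      using simple_ide_nonzero[OF Z] by simp
  qed
  have fin: "finite A'"
    using bD(1) by (simp add: A'_def)
  have inj: "inj_on v A'"
  proof (rule inj_onI)
    fix a c assume ac: "a \<in> A'" "c \<in> A'" "v a = v c"
    then have "p a \<bullet> v a = p a \<bullet> v c"
      by simp
    then show "a = c"
      using pv[OF A'[OF ac(1)]] ac u0 by (metis (full_types))
  qed
  have "independent (v ` A')"
  proof
    assume "dependent (v ` A')"
    then obtain w where w: "\<exists>x\<in>v ` A'. w x \<noteq> 0" "(\<Sum>x\<in>v ` A'. w x \<cdot>\<^sub>s x) = 0"
      using dependent_finite[of "v ` A'"] fin by auto
    have sum0: "(\<Sum>a\<in>A'. w (v a) \<cdot>\<^sub>s v a) = 0"
      using w(2) by (simp add: sum.reindex[OF inj])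
    obtain c where c: "c \<in> A'" "w (v c) \<noteq> 0"
      using w(1) by blast
    have "0 = p c \<bullet> (\<Sum>a\<in>A'. w (v a) \<cdot>\<^sub>s v a)"
      using sum0 comp_zero_right[OF bD(3)[OF A'[OF c(1)]]] by simp
    also have "\<dots> = (\<Sum>a\<in>A'. p c \<bullet> (w (v a) \<cdot>\<^sub>s v a))"
      using vH by (intro comp_sum_right[where X = Z, OF bD(3)[OF A'[OF c(1)]]] smult_in_Hom)
    also have "\<dots> = (\<Sum>a\<in>A'. if a = c then w (v c) \<cdot>\<^sub>s u c else 0)"
      using comp_smult_right[OF bD(3)[OF A'[OF c(1)]] vH] pv[OF A'[OF c(1)]]
      by (intro sum.cong) auto
    also have "\<dots> = w (v c) \<cdot>\<^sub>s u c"
      using c fin by simp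
    finally show False
      using c u0 by simp
  qed
  moreover have "span (v ` A') = span (Hom Z X)"
  proof -
    have "Hom Z X \<subseteq> span (v ` A')"
    proof
      fix g assume g: "g \<in> Hom Z X"
      have "i a \<bullet> (p a \<bullet> g) \<in> span (v ` A')" if a: "a \<in> A" for a
      proof (cases "p a \<bullet> g = 0")
        case True
        then show ?thesis
          using comp_zero_right[OF bD(2)[OF a]] span_zero by simp
      next
        case False
        have pg: "p a \<bullet> g \<in> Hom Z (F a)"
          by (rule comp_in_Hom[OF bD(3)[OF a] g])
        then have a': "a \<in> A'"
          using simple_hom_isomorphic[OF Z F[OF a] _ False] isomorphic_sym a by (auto simp: A'_def)
        have "inv_mor Z (F a) (u a) \<bullet> (p a \<bullet> g) \<in> Hom Z Z"
          by (rule comp_in_Hom[OF inv_mor_in_Hom[OF u[OF a']] pg])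
        then obtain c where c: "inv_mor Z (F a) (u a) \<bullet> (p a \<bullet> g) = c \<cdot>\<^sub>s ide Z"
          using Schur_scalar[OF Z] by blast
        have "p a \<bullet> g = u a \<bullet> (inv_mor Z (F a) (u a) \<bullet> (p a \<bullet> g))"
          using comp_assoc[OF uH[OF a'] inv_mor_in_Hom[OF u[OF a']] pg] comp_inv_mor[OF u[OF a']]
            comp_ide_left[OF pg] by simp
        also have "\<dots> = c \<cdot>\<^sub>s u a"
          using c comp_smult_right[OF uH[OF a'] ide_in_Hom] comp_ide_right[OF uH[OF a']] by simp
        finally have "i a \<bullet> (p a \<bullet> g) = c \<cdot>\<^sub>s v a"
          using comp_smult_right[OF bD(2)[OF a] uH[OF a']] by (simp add: v_def)
        then show ?thesis
          using a' by (simp add: span_base span_scale)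
      qed
      then have "(\<Sum>a\<in>A. i a \<bullet> (p a \<bullet> g)) \<in> span (v ` A')"
        by (rule span_sum)
      also have "(\<Sum>a\<in>A. i a \<bullet> (p a \<bullet> g)) = (\<Sum>a\<in>A. (i a \<bullet> p a) \<bullet> g)"
        using comp_assoc[OF bD(2) bD(3) g] by simp
      also have "\<dots> = (\<Sum>a\<in>A. i a \<bullet> p a) \<bullet> g"
        using comp_in_Hom[OF bD(2) bD(3)] by (intro comp_sum_left[symmetric, where Z = X, OF g])
      finally show "g \<in> span (v ` A')"
        using bD(6) comp_ide_left[OF g] by simp
    qed
    then show ?thesis
      using vH span_mono[of "v ` A'" "Hom Z X"] span_mono[of "Hom Z X" "span (v ` A')"] span_span by auto
  qed
  ultimately have "dim (Hom Z X) = card (v ` A')"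
    by (intro dim_eq_card)
  then show ?thesis
    using card_image[OF inj] by (simp add: A'_def)
qed

lemma semisimple_biproduct:
  "\<exists>A F i p. biproduct X (A::nat set) F i p \<and> (\<forall>a\<in>A. simple (F a))"
proof -
  obtain Xs where Xs: "\<forall>Y\<in>set Xs. simple Y" "is_direct_sum X Xs"
    using semisimple by blast
  then show ?thesis
    unfolding is_direct_sum_iff by (metis lessThan_iff nth_mem)
qed

lemma obj_class_biproduct_simple:
  assumes "biproduct X A F i p" "\<And>a. a \<in> A \<Longrightarrow> simple (F a)" "Z \<in> Irr"
  shows "obj_class X Z = int (card {a \<in> A. isomorphic (F a) Z})"
  using dim_Hom_biproduct[OF Irr_simple[OF assms(3)] assms(1,2)] assms(3) by (simp add: obj_class_def)

lemma obj_class_outside [simp]: "Z \<notin> Irr \<Longrightarrow> obj_class X Z = 0"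
  by (simp add: obj_class_def)

lemma obj_class_nonneg: "obj_class X Z \<ge> 0"
  by (simp add: obj_class_def)

text \<open>Each summand is decomposed further into simple objects, and those isomorphic to
  \<open>Z\<close> are counted over the dependent sum.\<close>

lemma obj_class_biproduct:
  assumes b: "biproduct X A F i p"
  shows "obj_class X Z = (\<Sum>a\<in>A. obj_class (F a) Z)"
proof (cases "Z \<in> Irr")
  case True
  have "\<forall>a. \<exists>B G j q. biproduct (F a) (B::nat set) G j q \<and> (\<forall>b\<in>B. simple (G b))"
    using semisimple_biproduct by blast
  then obtain B G j q where c: "\<And>a. biproduct (F a) (B a :: nat set) (G a) (j a) (q a)"
    "\<And>a b. b \<in> B a \<Longrightarrow> simple (G a b)"
    by metis
  have "obj_class X Z = int (card {x \<in> Sigma A B. isomorphic (case x of (a, b) \<Rightarrow> G a b) Z})"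
    using c(2) by (intro obj_class_biproduct_simple[OF biproduct_Sigma[OF b c(1)] _ True]) auto
  also have "{x \<in> Sigma A B. isomorphic (case x of (a, b) \<Rightarrow> G a b) Z} =
      Sigma A (\<lambda>a. {b \<in> B a. isomorphic (G a b) Z})"
    by auto
  also have "card \<dots> = (\<Sum>a\<in>A. card {b \<in> B a. isomorphic (G a b) Z})"
    using biproductD(1)[OF b] biproductD(1)[OF c(1)] by (subst card_SigmaI) auto
  also have "int \<dots> = (\<Sum>a\<in>A. obj_class (F a) Z)"
    using obj_class_biproduct_simple[OF c(1) c(2) True] by simp
  finally show ?thesis .
qed simp

lemma obj_class_iso:
  assumes "isomorphic X Y"
  shows "obj_class X = obj_class Y"
proof
  fix Z
  obtain f g where fg: "inverses X Y f g"
    using assms unfolding isomorphic_def is_iso_def by blast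
  obtain A F i p where b: "biproduct X (A::nat set) F i p"
    using semisimple_biproduct by blast
  show "obj_class X Z = obj_class Y Z"
    using obj_class_biproduct[OF b] obj_class_biproduct[OF biproduct_iso[OF b fg]] by simp
qed

lemma biproduct_self: "biproduct X {()} (\<lambda>_. X) (\<lambda>_. ide X) (\<lambda>_. ide X)"
  using ide_in_Hom comp_ide_left[OF ide_in_Hom] by (simp add: biproduct_def)

lemma obj_class_simple:
  assumes "simple X" "Z \<in> Irr"
  shows "obj_class X Z = (if isomorphic X Z then 1 else 0)"
  using obj_class_biproduct_simple[OF biproduct_self _ assms(2), of X] assms(1) by simp

lemma Irr_isomorphic_iff:
  assumes "X \<in> Irr" "Y \<in> Irr"
  shows "isomorphic X Y \<longleftrightarrow> X = Y"
  using assms Irr_represents[OF Irr_simple[OF assms(1)]] isomorphic_refl by blast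

lemma obj_class_Irr: "\<lbrakk>X \<in> Irr; Z \<in> Irr\<rbrakk> \<Longrightarrow> obj_class X Z = (if X = Z then 1 else 0)"
  using obj_class_simple[OF Irr_simple] Irr_isomorphic_iff by simp

definition rep :: "'o \<Rightarrow> 'o" where
  "rep X = (THE Y. Y \<in> Irr \<and> isomorphic X Y)"

lemma rep:
  assumes "simple X"
  shows "rep X \<in> Irr" "isomorphic X (rep X)"
  using theI'[OF Irr_represents[OF assms]] by (auto simp: rep_def)

text \<open>A non-zero morphism has a non-zero component in some simple summand of \<open>X\<close>;
  that summand is then isomorphic to \<open>Z\<close> and is counted by the multiplicity.\<close>

lemma obj_class_nonzero_iff:
  assumes "Z \<in> Irr"
  shows "obj_class X Z \<noteq> 0 \<longleftrightarrow> (\<exists>f\<in>Hom Z X. f \<noteq> 0)"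
proof
  assume nz: "obj_class X Z \<noteq> 0"
  show "\<exists>f\<in>Hom Z X. f \<noteq> 0"
  proof (rule ccontr)
    assume "\<not> (\<exists>f\<in>Hom Z X. f \<noteq> 0)"
    then have "Hom Z X = {0}"
      using zero_in_Hom by blast
    moreover have "dim {0} = 0"
      using dim_eq_card[of "{}" "{0}"] by (auto simp: span_empty span_insert_0 independent_empty)
    ultimately show False
      using nz assms by (simp add: obj_class_def)
  qed
next
  assume "\<exists>f\<in>Hom Z X. f \<noteq> 0"
  then obtain f where f: "f \<in> Hom Z X" "f \<noteq> 0"
    by blast
  obtain A F i p where b: "biproduct X (A::nat set) F i p" "\<And>a. a \<in> A \<Longrightarrow> simple (F a)"
    using semisimple_biproduct by blast
  note bD = biproductD[OF b(1)]
  have "\<exists>a\<in>A. p a \<bullet> f \<noteq> 0"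
  proof (rule ccontr)
    assume "\<not> ?thesis"
    then have "(i a \<bullet> p a) \<bullet> f = 0" if "a \<in> A" for a
      using comp_assoc[OF bD(2,3)[OF that] f(1)] comp_zero_right[OF bD(2)[OF that]] that by simp
    moreover have "(\<Sum>a\<in>A. i a \<bullet> p a) \<bullet> f = (\<Sum>a\<in>A. (i a \<bullet> p a) \<bullet> f)"
      using comp_in_Hom[OF bD(2) bD(3)] by (intro comp_sum_left[where Z = X, OF f(1)])
    ultimately show False
      using bD(6) comp_ide_left[OF f(1)] f(2) by simp
  qed
  then obtain a where a: "a \<in> A" "p a \<bullet> f \<noteq> 0"
    by blast
  have "isomorphic (F a) Z"
    by (rule isomorphic_sym, rule simple_hom_isomorphic[OF Irr_simple[OF assms] b(2)[OF a(1)] comp_in_Hom[OF bD(3)[OF a(1)] f(1)] a(2)])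
  then have "{a \<in> A. isomorphic (F a) Z} \<noteq> {}"
    using a by blast
  then show "obj_class X Z \<noteq> 0"
    using obj_class_biproduct_simple[OF b assms] bD(1) by simp
qed

text \<open>Converts sums over simple summands into sums over \<open>Irr\<close> weighted by
  multiplicities. The target ring is left open because \<open>g\<close> will be integer-valued for
  classes and field-valued for the S-matrix.\<close>

lemma obj_class_simple_summands:
  assumes "biproduct X A F i p" "\<And>a. a \<in> A \<Longrightarrow> simple (F a)"
  shows "(\<Sum>a\<in>A. g (rep (F a))) = (\<Sum>Z\<in>Irr. of_int (obj_class X Z) * (g Z :: 'b::comm_ring_1))"
proof -
  have "(\<Sum>Z\<in>Irr. of_int (obj_class X Z) * g Z) = (\<Sum>Z\<in>Irr. \<Sum>a\<in>A. of_int (obj_class (F a) Z) * g Z)"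
    by (simp add: obj_class_biproduct[OF assms(1)] sum_distrib_right)
  also have "\<dots> = (\<Sum>a\<in>A. \<Sum>Z\<in>Irr. of_int (obj_class (F a) Z) * g Z)"
    by (rule sum.swap)
  also have "\<dots> = (\<Sum>a\<in>A. \<Sum>Z\<in>Irr. if Z = rep (F a) then g Z else 0)"
  proof (intro sum.cong refl)
    fix a Z assume aZ: "a \<in> A" "Z \<in> Irr"
    show "of_int (obj_class (F a) Z) * g Z = (if Z = rep (F a) then g Z else 0)"
      using obj_class_iso[OF rep(2)[OF assms(2)[OF aZ(1)]]] obj_class_Irr[OF rep(1)[OF assms(2)[OF aZ(1)]] aZ(2)]
      by auto
  qed
  also have "\<dots> = (\<Sum>a\<in>A. g (rep (F a)))"
    using finite_Irr rep(1)[OF assms(2)] by (simp add: sum.delta)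
  finally show ?thesis ..
qed

text \<open>Both factors are decomposed into simple objects and the tensor product is distributed;
  this is the product of \<open>K0\<close> evaluated at classes.\<close>

lemma obj_class_tensor:
  "obj_class (X \<otimes>\<^sub>o Y) Z = (\<Sum>V\<in>Irr. \<Sum>W\<in>Irr. obj_class X V * obj_class Y W * obj_class (V \<otimes>\<^sub>o W) Z)"
proof -
  obtain A F i p where b: "biproduct X (A::nat set) F i p" "\<And>a. a \<in> A \<Longrightarrow> simple (F a)"
    using semisimple_biproduct by blast
  obtain B G j q where c: "biproduct Y (B::nat set) G j q" "\<And>a. a \<in> B \<Longrightarrow> simple (G a)"
    using semisimple_biproduct by blast
  have "obj_class (X \<otimes>\<^sub>o Y) Z = (\<Sum>(a, b)\<in>A \<times> B. obj_class (F a \<otimes>\<^sub>o G b) Z)"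
    using obj_class_biproduct[OF biproduct_tensor[OF b(1) c(1)], of Z] by (simp add: case_prod_unfold)
  also have "\<dots> = (\<Sum>a\<in>A. \<Sum>b\<in>B. obj_class (rep (F a) \<otimes>\<^sub>o rep (G b)) Z)"
    unfolding sum.cartesian_product[symmetric]
  proof (intro sum.cong refl)
    fix x y assume "x \<in> A" "y \<in> B"
    then have "isomorphic (F x \<otimes>\<^sub>o G y) (rep (F x) \<otimes>\<^sub>o rep (G y))"
      using isomorphic_tensor rep(2) b(2) c(2) by blast
    then show "obj_class (F x \<otimes>\<^sub>o G y) Z = obj_class (rep (F x) \<otimes>\<^sub>o rep (G y)) Z"
      by (simp add: obj_class_iso)
  qed
  also have "\<dots> = (\<Sum>V\<in>Irr. obj_class X V * (\<Sum>W\<in>Irr. obj_class Y W * obj_class (V \<otimes>\<^sub>o W) Z))"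
    using obj_class_simple_summands[OF c, where g = "\<lambda>W. obj_class (V \<otimes>\<^sub>o W) Z" for V]
      obj_class_simple_summands[OF b, where g = "\<lambda>V. \<Sum>W\<in>Irr. obj_class Y W * obj_class (V \<otimes>\<^sub>o W) Z"]
    by simp
  finally show ?thesis
    by (simp add: sum_distrib_left mult.assoc)
qed

lemma obj_class_in_carrier: "obj_class X \<in> carrier K0"
  by (auto simp: K0_def)

lemma obj_class_tensor_K0: "obj_class (X \<otimes>\<^sub>o Y) = obj_class X \<otimes>\<^bsub>K0\<^esub> obj_class Y"
  using obj_class_tensor[of X Y] by (simp add: K0_def fun_eq_iff)

end

section \<open>Strict ribbon categories\<close>

text \<open>Arrows form one type with a predicate \<open>arr\<close>. A composite satisfies it
  exactly when its parts are composable arrows, which lets both associativity laws hold without side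
  conditions and serve as rewriting rules. Objects are lists, with append as tensor product.\<close>

locale strict_monoidal =
  fixes arr :: "'a \<Rightarrow> bool" and src tgt :: "'a \<Rightarrow> 'b list"
    and cmp :: "'a \<Rightarrow> 'a \<Rightarrow> 'a" (infixr "\<odot>" 80)
    and tns :: "'a \<Rightarrow> 'a \<Rightarrow> 'a" (infixr "\<boxtimes>" 75)
    and one :: "'b list \<Rightarrow> 'a"
  assumes arr_cmp [simp]: "arr (g \<odot> f) \<longleftrightarrow> arr g \<and> arr f \<and> tgt f = src g"
    and src_cmp [simp]: "\<lbrakk>arr g; arr f; tgt f = src g\<rbrakk> \<Longrightarrow> src (g \<odot> f) = src f"
    and tgt_cmp [simp]: "\<lbrakk>arr g; arr f; tgt f = src g\<rbrakk> \<Longrightarrow> tgt (g \<odot> f) = tgt g"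
    and cmp_assoc: "(h \<odot> g) \<odot> f = h \<odot> (g \<odot> f)"
    and arr_tns [simp]: "arr (f \<boxtimes> g) \<longleftrightarrow> arr f \<and> arr g"
    and src_tns [simp]: "\<lbrakk>arr f; arr g\<rbrakk> \<Longrightarrow> src (f \<boxtimes> g) = src f @ src g"
    and tgt_tns [simp]: "\<lbrakk>arr f; arr g\<rbrakk> \<Longrightarrow> tgt (f \<boxtimes> g) = tgt f @ tgt g"
    and tns_assoc: "(f \<boxtimes> g) \<boxtimes> h = f \<boxtimes> (g \<boxtimes> h)"
    and arr_one [simp]: "arr (one x)"
    and src_one [simp]: "src (one x) = x"
    and tgt_one [simp]: "tgt (one x) = x"
    and cmp_one_right: "arr f \<Longrightarrow> f \<odot> one (src f) = f"
    and cmp_one_left: "arr f \<Longrightarrow> one (tgt f) \<odot> f = f"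
    and one_append: "one (x @ y) = one x \<boxtimes> one y"
    and one_Nil_tns [simp]: "arr f \<Longrightarrow> one [] \<boxtimes> f = f"
    and tns_one_Nil [simp]: "arr f \<Longrightarrow> f \<boxtimes> one [] = f"
    and interchange: "\<lbrakk>arr g; arr f; tgt f = src g; arr g'; arr f'; tgt f' = src g'\<rbrakk> \<Longrightarrow>
      (g \<boxtimes> g') \<odot> (f \<boxtimes> f') = (g \<odot> f) \<boxtimes> (g' \<odot> f')"
begin

abbreviation hom :: "'a \<Rightarrow> 'b list \<Rightarrow> 'b list \<Rightarrow> bool" where
  "hom f x y \<equiv> arr f \<and> src f = x \<and> tgt f = y"

definition iso :: "'a \<Rightarrow> bool" where
  "iso f \<longleftrightarrow> arr f \<and> (\<exists>g. hom g (tgt f) (src f) \<and> g \<odot> f = one (src f) \<and> f \<odot> g = one (tgt f))"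

lemma cmp_one [simp]:
  "\<lbrakk>arr f; src f = x\<rbrakk> \<Longrightarrow> f \<odot> one x = f" "\<lbrakk>arr f; tgt f = x\<rbrakk> \<Longrightarrow> one x \<odot> f = f"
  using cmp_one_right cmp_one_left by blast+

lemma interchange_cmp:
  "\<lbrakk>arr g; arr f; tgt f = src g; arr g'; arr f'; tgt f' = src g'\<rbrakk> \<Longrightarrow>
     (g \<boxtimes> g') \<odot> (f \<boxtimes> f') \<odot> h = ((g \<odot> f) \<boxtimes> (g' \<odot> f')) \<odot> h"
  by (simp add: cmp_assoc[symmetric] interchange)

lemma whisker_right:
  "\<lbrakk>arr g; arr f; tgt f = src g\<rbrakk> \<Longrightarrow> (g \<odot> f) \<boxtimes> one x = (g \<boxtimes> one x) \<odot> (f \<boxtimes> one x)"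
  by (simp add: interchange)

lemma whisker_left:
  "\<lbrakk>arr g; arr f; tgt f = src g\<rbrakk> \<Longrightarrow> one x \<boxtimes> g \<odot> f = (one x \<boxtimes> g) \<odot> (one x \<boxtimes> f)"
  by (simp add: interchange)

lemma whisker_right2:
  "\<lbrakk>arr g; arr f; tgt f = src g\<rbrakk> \<Longrightarrow>
     (g \<odot> f) \<boxtimes> one x \<boxtimes> one y = (g \<boxtimes> one x \<boxtimes> one y) \<odot> (f \<boxtimes> one x \<boxtimes> one y)"
  by (simp add: one_append[symmetric] interchange)

lemmas whiskers = whisker_left whisker_right whisker_right2 tns_assoc one_append cmp_assoc

text \<open>Composites are kept nested to the right, where \<open>g \<odot> f\<close> is not a
  subterm as soon as something follows; this form rewrites it in front of the tail
  \<open>k\<close>.\<close>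

lemma cmp_reassoc: "g \<odot> f = h \<Longrightarrow> g \<odot> f \<odot> k = h \<odot> k"
  by (simp add: cmp_assoc[symmetric])

text \<open>Together with \<open>slide_right\<close> it exchanges the heights of two morphisms on
  disjoint strands.\<close>

lemma slide_left: "\<lbrakk>hom f x x'; hom g y y'\<rbrakk> \<Longrightarrow> (f \<boxtimes> one y') \<odot> (one x \<boxtimes> g) = f \<boxtimes> g"
  by (simp add: interchange)

lemma slide_right: "\<lbrakk>hom f x x'; hom g y y'\<rbrakk> \<Longrightarrow> (one x' \<boxtimes> g) \<odot> (f \<boxtimes> one y) = f \<boxtimes> g"
  by (simp add: interchange)

lemma iso_cancel:
  assumes "iso k" "arr f" "arr g" "src f = tgt k" "src g = tgt k" "f \<odot> k = g \<odot> k"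
  shows "f = g"
proof -
  obtain k' where k: "hom k' (tgt k) (src k)" "k \<odot> k' = one (tgt k)"
    using assms(1) by (auto simp: iso_def)
  have "f \<odot> k \<odot> k' = g \<odot> k \<odot> k'"
    using assms(6) by (simp add: cmp_assoc[symmetric])
  then show ?thesis
    using k assms by simp
qed

lemma iso_tns: "\<lbrakk>iso f; iso g\<rbrakk> \<Longrightarrow> iso (f \<boxtimes> g)"
proof -
  assume "iso f" "iso g"
  then obtain f' g' where "arr f" "hom f' (tgt f) (src f)" "f' \<odot> f = one (src f)" "f \<odot> f' = one (tgt f)"
     "arr g" "hom g' (tgt g) (src g)" "g' \<odot> g = one (src g)" "g \<odot> g' = one (tgt g)"
    by (auto simp: iso_def)
  then show ?thesis
    unfolding iso_def by (auto intro!: exI[of _ "f' \<boxtimes> g'"] simp: interchange one_append)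
qed

lemma iso_one: "iso (one x)"
  unfolding iso_def by (auto intro!: exI[of _ "one x"])

lemma iso_cmp: "\<lbrakk>iso f; iso g; tgt f = src g\<rbrakk> \<Longrightarrow> iso (g \<odot> f)"
proof -
  assume fg: "iso f" "iso g" "tgt f = src g"
  then obtain f' g' where *: "arr f" "hom f' (tgt f) (src f)" "f' \<odot> f = one (src f)" "f \<odot> f' = one (tgt f)"
     "arr g" "hom g' (tgt g) (src g)" "g' \<odot> g = one (src g)" "g \<odot> g' = one (tgt g)"
    by (auto simp: iso_def)
  have "(f' \<odot> g') \<odot> (g \<odot> f) = f' \<odot> (g' \<odot> g) \<odot> f" "(g \<odot> f) \<odot> (f' \<odot> g') = g \<odot> (f \<odot> f') \<odot> g'"
    by (simp_all add: cmp_assoc)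
  then show ?thesis
    unfolding iso_def using * fg(3) by (auto intro!: exI[of _ "f' \<odot> g'"])
qed

text \<open>Here \<open>y\<close> is the left dual of \<open>x\<close>, with evaluation
  \<open>e\<close> and coevaluation \<open>c\<close>; the constraints that occur in
  \<open>is_left_dual\<close> have become identities.\<close>

definition dual_pair :: "'b list \<Rightarrow> 'b list \<Rightarrow> 'a \<Rightarrow> 'a \<Rightarrow> bool" where
  "dual_pair x y e c \<longleftrightarrow> hom e (y @ x) [] \<and> hom c [] (x @ y) \<and>
     (one x \<boxtimes> e) \<odot> (c \<boxtimes> one x) = one x \<and> (e \<boxtimes> one y) \<odot> (one y \<boxtimes> c) = one y"

lemma dual_pairD:
  assumes "dual_pair x y e c"
  shows "arr e" "src e = y @ x" "tgt e = []" "arr c" "src c = []" "tgt c = x @ y"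
    "(one x \<boxtimes> e) \<odot> (c \<boxtimes> one x) = one x" "(e \<boxtimes> one y) \<odot> (one y \<boxtimes> c) = one y"
  using assms by (auto simp: dual_pair_def)

text \<open>A bent strand is straightened. With \<open>dual_pair_coev_inj\<close>, bending along
  \<open>c\<close> becomes a bijection between morphisms from \<open>y\<close> to \<open>z\<close>
  and morphisms from \<open>[]\<close> to \<open>x @ z\<close>.\<close>

lemma dual_pair_coev_surj:
  assumes d: "dual_pair x y e c" and m: "hom m [] (x @ z)"
  shows "(one x \<boxtimes> (e \<boxtimes> one z) \<odot> (one y \<boxtimes> m)) \<odot> c = m"
proof -
  note dD [simp] = dual_pairD(1-6)[OF d] and zz = dual_pairD(7,8)[OF d]
  have "(one x \<boxtimes> (e \<boxtimes> one z) \<odot> (one y \<boxtimes> m)) \<odot> c = (one x \<boxtimes> e \<boxtimes> one z) \<odot> (one (x @ y) \<boxtimes> m) \<odot> c"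
    using m by (simp add: interchange_cmp one_append tns_assoc)
  also have "(one (x @ y) \<boxtimes> m) \<odot> c = (c \<boxtimes> one (x @ z)) \<odot> m"
    using slide_left[of c "[]" "x @ y" m "[]" "x @ z"] slide_right[of c "[]" "x @ y" m "[]" "x @ z"] m by simp
  also have "(one x \<boxtimes> e \<boxtimes> one z) \<odot> (c \<boxtimes> one (x @ z)) \<odot> m =
      (((one x \<boxtimes> e) \<boxtimes> one z) \<odot> ((c \<boxtimes> one x) \<boxtimes> one z)) \<odot> m"
    by (simp add: cmp_assoc tns_assoc one_append)
  also have "((one x \<boxtimes> e) \<boxtimes> one z) \<odot> ((c \<boxtimes> one x) \<boxtimes> one z) = one (x @ z)"
    by (subst interchange) (simp_all add: zz one_append)
  finally show ?thesis
    using m by simp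
qed

lemma dual_pair_coev_inj:
  assumes d: "dual_pair x y e c" and f: "hom f y z"
  shows "(e \<boxtimes> one z) \<odot> (one y \<boxtimes> (one x \<boxtimes> f) \<odot> c) = f"
proof -
  note dD [simp] = dual_pairD(1-6)[OF d] and zz = dual_pairD(7,8)[OF d]
  have "(e \<boxtimes> one z) \<odot> (one y \<boxtimes> (one x \<boxtimes> f) \<odot> c) = ((e \<boxtimes> one z) \<odot> (one (y @ x) \<boxtimes> f)) \<odot> (one y \<boxtimes> c)"
    using f by (simp add: interchange cmp_assoc one_append tns_assoc)
  also have "(e \<boxtimes> one z) \<odot> (one (y @ x) \<boxtimes> f) = f \<odot> (e \<boxtimes> one y)"
    using slide_left[of e "y @ x" "[]" f y z] slide_right[of e "y @ x" "[]" f y z] f by simp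
  finally show ?thesis
    using f zz by (simp add: cmp_assoc)
qed

text \<open>The mirror image: morphisms from \<open>[]\<close> to \<open>z @ y\<close> unbend to
  morphisms from \<open>x\<close> to \<open>z\<close>.\<close>

lemma dual_pair_coev_surj':
  assumes d: "dual_pair x y e c" and m: "hom m [] (z @ y)"
  shows "((one z \<boxtimes> e) \<odot> (m \<boxtimes> one x) \<boxtimes> one y) \<odot> c = m"
proof -
  note dD [simp] = dual_pairD(1-6)[OF d] and zz = dual_pairD(7,8)[OF d]
  have "((one z \<boxtimes> e) \<odot> (m \<boxtimes> one x) \<boxtimes> one y) \<odot> c = (one z \<boxtimes> e \<boxtimes> one y) \<odot> (m \<boxtimes> one (x @ y)) \<odot> c"
    using m interchange_cmp[of "one z \<boxtimes> e" "m \<boxtimes> one x" "one y" "one y" c]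
    by (simp add: one_append tns_assoc)
  also have "(m \<boxtimes> one (x @ y)) \<odot> c = (one (z @ y) \<boxtimes> c) \<odot> m"
    using slide_left[of m "[]" "z @ y" c "[]" "x @ y"] slide_right[of m "[]" "z @ y" c "[]" "x @ y"] m by simp
  also have "(one z \<boxtimes> e \<boxtimes> one y) \<odot> (one (z @ y) \<boxtimes> c) \<odot> m =
      (one z \<boxtimes> (e \<boxtimes> one y) \<odot> (one y \<boxtimes> c)) \<odot> m"
    by (simp add: interchange_cmp tns_assoc one_append)
  finally show ?thesis
    using m zz by (simp add: one_append[symmetric])
qed

text \<open>The dual morphism of \<open>f\<close>, pointing from the dual \<open>y'\<close> of the
  target to the dual \<open>y\<close> of the source.\<close>

definition transpose :: "'b list \<Rightarrow> 'a \<Rightarrow> 'b list \<Rightarrow> 'a \<Rightarrow> 'a \<Rightarrow> 'a" where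
  "transpose y c y' e' f = (e' \<boxtimes> one y) \<odot> (one y' \<boxtimes> (f \<boxtimes> one y) \<odot> c)"

text \<open>The morphism \<open>f\<close> may be pushed past the coevaluations and past the
  evaluations at the price of transposing it; the zigzag identities straighten the strands that
  arise.\<close>

lemma transpose:
  assumes d: "dual_pair x y e c" and d': "dual_pair x' y' e' c'" and f: "hom f x x'"
  shows "hom (transpose y c y' e' f) y' y"
    and "(one x' \<boxtimes> transpose y c y' e' f) \<odot> c' = (f \<boxtimes> one y) \<odot> c"
    and "e \<odot> (transpose y c y' e' f \<boxtimes> one x) = e' \<odot> (one y' \<boxtimes> f)"
proof -
  note dD [simp] = dual_pairD(1-6)[OF d] dual_pairD(1-6)[OF d']
    and zz = dual_pairD(7,8)[OF d] dual_pairD(7,8)[OF d']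
  show "hom (transpose y c y' e' f) y' y"
    using f by (simp add: transpose_def)
  show "(one x' \<boxtimes> transpose y c y' e' f) \<odot> c' = (f \<boxtimes> one y) \<odot> c"
    unfolding transpose_def using dual_pair_coev_surj[OF d'] f by simp
  have "e \<odot> (transpose y c y' e' f \<boxtimes> one x) =
      e \<odot> (e' \<boxtimes> one (y @ x)) \<odot> (one y' \<boxtimes> f \<boxtimes> one (y @ x)) \<odot> (one y' \<boxtimes> c \<boxtimes> one x)"
    using f by (simp add: transpose_def whiskers)
  also have "\<dots> = (e \<odot> (e' \<boxtimes> one (y @ x))) \<odot> (one y' \<boxtimes> f \<boxtimes> one (y @ x)) \<odot> (one y' \<boxtimes> c \<boxtimes> one x)"
    by (simp add: cmp_assoc)
  also have "e \<odot> (e' \<boxtimes> one (y @ x)) = e' \<odot> (one (y' @ x') \<boxtimes> e)"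
    using slide_left[of e' "y' @ x'" "[]" e "y @ x" "[]"] slide_right[of e' "y' @ x'" "[]" e "y @ x" "[]"] by simp
  also have "(e' \<odot> (one (y' @ x') \<boxtimes> e)) \<odot> (one y' \<boxtimes> f \<boxtimes> one (y @ x)) \<odot> (one y' \<boxtimes> c \<boxtimes> one x) =
      e' \<odot> (one y' \<boxtimes> f \<boxtimes> e) \<odot> (one y' \<boxtimes> c \<boxtimes> one x)"
    using f by (simp add: cmp_assoc interchange interchange_cmp tns_assoc one_append[of y' x'])
  also have "(one y' \<boxtimes> f \<boxtimes> e) \<odot> (one y' \<boxtimes> c \<boxtimes> one x) = one y' \<boxtimes> f \<odot> (one x \<boxtimes> e) \<odot> (c \<boxtimes> one x)"
    using slide_right[of f x x' e "y @ x" "[]"] slide_left[of f x x' e "y @ x" "[]"] f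
    by (simp add: interchange cmp_assoc[symmetric])
  finally show "e \<odot> (transpose y c y' e' f \<boxtimes> one x) = e' \<odot> (one y' \<boxtimes> f)"
    using f zz by simp
qed

text \<open>Evaluations and coevaluations are nested, which is why the order of the duals is
  reversed.\<close>

lemma dual_pair_tensor:
  assumes d: "dual_pair x y e c" and d': "dual_pair x' y' e' c'"
  shows "dual_pair (x @ x') (y' @ y) (e' \<odot> (one y' \<boxtimes> e \<boxtimes> one x')) ((one x \<boxtimes> c' \<boxtimes> one y) \<odot> c)"
proof -
  note dD [simp] = dual_pairD(1-6)[OF d] dual_pairD(1-6)[OF d']
    and zz = dual_pairD(7,8)[OF d] dual_pairD(7,8)[OF d']
  let ?e = "e' \<odot> (one y' \<boxtimes> e \<boxtimes> one x')" and ?c = "(one x \<boxtimes> c' \<boxtimes> one y) \<odot> c"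
  have "(one (x @ x') \<boxtimes> ?e) \<odot> (?c \<boxtimes> one (x @ x')) =
      (one x \<boxtimes> one x' \<boxtimes> e') \<odot> ((one (x @ x' @ y') \<boxtimes> e \<boxtimes> one x') \<odot> (one x \<boxtimes> c' \<boxtimes> one (y @ x @ x'))) \<odot> (c \<boxtimes> one x \<boxtimes> one x')"
    by (simp add: whiskers)
  also have "(one (x @ x' @ y') \<boxtimes> e \<boxtimes> one x') \<odot> (one x \<boxtimes> c' \<boxtimes> one (y @ x @ x')) =
      (one x \<boxtimes> c' \<boxtimes> one x') \<odot> (one x \<boxtimes> e \<boxtimes> one x')"
    using slide_left[of c' "[]" "x' @ y'" "e \<boxtimes> one x'" "y @ x @ x'" x']
      slide_right[of c' "[]" "x' @ y'" "e \<boxtimes> one x'" "y @ x @ x'" x']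
    by (simp add: interchange tns_assoc one_append)
  also have "(one x \<boxtimes> one x' \<boxtimes> e') \<odot> ((one x \<boxtimes> c' \<boxtimes> one x') \<odot> (one x \<boxtimes> e \<boxtimes> one x')) \<odot> (c \<boxtimes> one x \<boxtimes> one x') =
      (one x \<boxtimes> (one x' \<boxtimes> e') \<odot> (c' \<boxtimes> one x')) \<odot> ((one x \<boxtimes> e) \<boxtimes> one x') \<odot> ((c \<boxtimes> one x) \<boxtimes> one x')"
    by (simp add: interchange_cmp tns_assoc cmp_assoc)
  also have "\<dots> = one (x @ x')"
    using interchange[of "one x \<boxtimes> e" "c \<boxtimes> one x" "one x'" "one x'"] by (simp add: zz one_append[symmetric])
  finally have 1: "(one (x @ x') \<boxtimes> ?e) \<odot> (?c \<boxtimes> one (x @ x')) = one (x @ x')" .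
  have "(?e \<boxtimes> one (y' @ y)) \<odot> (one (y' @ y) \<boxtimes> ?c) =
      (e' \<boxtimes> one y' \<boxtimes> one y) \<odot> ((one y' \<boxtimes> e \<boxtimes> one (x' @ y' @ y)) \<odot> (one (y' @ y @ x) \<boxtimes> c' \<boxtimes> one y)) \<odot> (one y' \<boxtimes> one y \<boxtimes> c)"
    by (simp add: whiskers)
  also have "(one y' \<boxtimes> e \<boxtimes> one (x' @ y' @ y)) \<odot> (one (y' @ y @ x) \<boxtimes> c' \<boxtimes> one y) =
      (one y' \<boxtimes> c' \<boxtimes> one y) \<odot> (one y' \<boxtimes> e \<boxtimes> one y)"
    using slide_left[of e "y @ x" "[]" "c' \<boxtimes> one y" y "x' @ y' @ y"]
      slide_right[of e "y @ x" "[]" "c' \<boxtimes> one y" y "x' @ y' @ y"]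
    by (simp add: interchange tns_assoc one_append)
  also have "(e' \<boxtimes> one y' \<boxtimes> one y) \<odot> ((one y' \<boxtimes> c' \<boxtimes> one y) \<odot> (one y' \<boxtimes> e \<boxtimes> one y)) \<odot> (one y' \<boxtimes> one y \<boxtimes> c) =
      (((e' \<boxtimes> one y') \<boxtimes> one y) \<odot> ((one y' \<boxtimes> c') \<boxtimes> one y)) \<odot> (one y' \<boxtimes> (e \<boxtimes> one y) \<odot> (one y \<boxtimes> c))"
    by (simp add: whiskers)
  also have "\<dots> = one (y' @ y)"
    using interchange[of "e' \<boxtimes> one y'" "one y' \<boxtimes> c'" "one y" "one y"] by (simp add: zz one_append[symmetric])
  finally have 2: "(?e \<boxtimes> one (y' @ y)) \<odot> (one (y' @ y) \<boxtimes> ?c) = one (y' @ y)" .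
  show ?thesis
    unfolding dual_pair_def using 1 2 by simp
qed

end

text \<open>Braiding and twist are indexed by lists: the hexagon axioms become the two rules for
  appended lists, and \<open>twist_append\<close> is the balancing axiom.\<close>

locale strict_ribbon = strict_monoidal +
  fixes B :: "'b list \<Rightarrow> 'b list \<Rightarrow> 'a" and \<theta> :: "'b list \<Rightarrow> 'a"
  assumes B_iso: "iso (B x y)"
    and src_B [simp]: "src (B x y) = x @ y"
    and tgt_B [simp]: "tgt (B x y) = y @ x"
    and B_natural: "\<lbrakk>hom f x x'; hom g y y'\<rbrakk> \<Longrightarrow> B x' y' \<odot> (f \<boxtimes> g) = (g \<boxtimes> f) \<odot> B x y"
    and B_append_right: "B x (y @ z) = (one y \<boxtimes> B x z) \<odot> (B x y \<boxtimes> one z)"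
    and B_append_left: "B (x @ y) z = (B x z \<boxtimes> one y) \<odot> (one x \<boxtimes> B y z)"
    and arr_twist [simp]: "arr (\<theta> x)"
    and src_twist [simp]: "src (\<theta> x) = x"
    and tgt_twist [simp]: "tgt (\<theta> x) = x"
    and twist_natural: "hom f x y \<Longrightarrow> \<theta> y \<odot> f = f \<odot> \<theta> x"
    and twist_append: "\<theta> (x @ y) = B y x \<odot> B x y \<odot> (\<theta> x \<boxtimes> \<theta> y)"
begin

lemma arr_B [simp]: "arr (B x y)"
  using B_iso by (simp add: iso_def)

text \<open>The hexagon rule for two empty lists makes \<open>B x []\<close> an idempotent, and an
  idempotent isomorphism is an identity.\<close>

lemma B_Nil_right: "B x [] = one x"
  using B_append_right[of x "[]" "[]"] iso_cancel[OF B_iso[of x "[]"], of "B x []" "one x"] by simp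

text \<open>The cap \<open>x \<otimes> x\<^sup>* \<rightarrow> 1\<close> on the unusual side encodes the spherical structure; \<open>ptr v x y e c\<close> is the
  right partial trace over \<open>x\<close>.\<close>

definition cap :: "'b list \<Rightarrow> 'b list \<Rightarrow> 'a \<Rightarrow> 'a" where
  "cap x y e = e \<odot> B x y \<odot> (\<theta> x \<boxtimes> one y)"

definition ptr :: "'b list \<Rightarrow> 'b list \<Rightarrow> 'b list \<Rightarrow> 'a \<Rightarrow> 'a \<Rightarrow> 'a \<Rightarrow> 'a" where
  "ptr v x y e c F = (one v \<boxtimes> cap x y e) \<odot> (F \<boxtimes> one y) \<odot> (one v \<boxtimes> c)"

lemma hom_cap: "dual_pair x y e c \<Longrightarrow> hom (cap x y e) (x @ y) []"
  by (simp add: cap_def dual_pairD)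

lemma hom_ptr: "\<lbrakk>dual_pair x y e c; hom F (v @ x) (w @ x); v = w\<rbrakk> \<Longrightarrow> hom (ptr v x y e c F) v v"
  using hom_cap[of x y e c] by (auto simp: ptr_def dual_pairD)

text \<open>The cap obeys the same sliding rule as the evaluation: naturality of the braiding
  carries the transpose to the evaluation, where it turns into \<open>f\<close>, and naturality of
  the twist moves \<open>f\<close> below \<open>\<theta>\<close>.\<close>

lemma cap_transpose:
  assumes d: "dual_pair x y e c" and d': "dual_pair x' y' e' c'" and f: "hom f x x'"
  shows "cap x y e \<odot> (one x \<boxtimes> transpose y c y' e' f) = cap x' y' e' \<odot> (f \<boxtimes> one y')"
proof -
  note dD [simp] = dual_pairD(1-6)[OF d] dual_pairD(1-6)[OF d']
  note t = transpose[OF assms]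
  let ?t = "transpose y c y' e' f"
  have "cap x y e \<odot> (one x \<boxtimes> ?t) = e \<odot> (B x y \<odot> (one x \<boxtimes> ?t)) \<odot> (\<theta> x \<boxtimes> one y')"
    using t(1) by (simp add: cap_def cmp_assoc interchange)
  also have "B x y \<odot> (one x \<boxtimes> ?t) = (?t \<boxtimes> one x) \<odot> B x y'"
    using t(1) by (intro B_natural) auto
  also have "e \<odot> ((?t \<boxtimes> one x) \<odot> B x y') \<odot> (\<theta> x \<boxtimes> one y') = (e \<odot> (?t \<boxtimes> one x)) \<odot> B x y' \<odot> (\<theta> x \<boxtimes> one y')"
    by (simp add: cmp_assoc)
  also have "\<dots> = e' \<odot> ((one y' \<boxtimes> f) \<odot> B x y') \<odot> (\<theta> x \<boxtimes> one y')"
    by (simp add: t(3) cmp_assoc)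
  also have "(one y' \<boxtimes> f) \<odot> B x y' = B x' y' \<odot> (f \<boxtimes> one y')"
    using f by (intro B_natural[symmetric]) auto
  also have "e' \<odot> (B x' y' \<odot> (f \<boxtimes> one y')) \<odot> (\<theta> x \<boxtimes> one y') = e' \<odot> B x' y' \<odot> (f \<odot> \<theta> x \<boxtimes> one y')"
    using f by (simp add: cmp_assoc interchange)
  also have "f \<odot> \<theta> x = \<theta> x' \<odot> f"
    using f by (intro twist_natural[symmetric]) auto
  finally show ?thesis
    using f by (simp add: cap_def cmp_assoc interchange)
qed

text \<open>The morphism \<open>g\<close> travels around the loop: it is transposed at the cap,
  passes \<open>F\<close> on a disjoint strand, and is transposed back at the coevaluation.\<close>

lemma ptr_cyclic:
  assumes d: "dual_pair x y e c" and d': "dual_pair x' y' e' c'"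
    and F: "hom F (v @ x) (v @ x')" and g: "hom g x' x"
  shows "ptr v x y e c ((one v \<boxtimes> g) \<odot> F) = ptr v x' y' e' c' (F \<odot> (one v \<boxtimes> g))"
proof -
  note dD [simp] = dual_pairD(1-6)[OF d] dual_pairD(1-6)[OF d']
  note [simp] = hom_cap[OF d] hom_cap[OF d']
  note t = transpose[OF d' d g] cap_transpose[OF d' d g]
  let ?t = "transpose y' c' y e g"
  note [simp] = t(1)
  have "ptr v x y e c ((one v \<boxtimes> g) \<odot> F) =
      (one v \<boxtimes> cap x y e \<odot> (g \<boxtimes> one y)) \<odot> (F \<boxtimes> one y) \<odot> (one v \<boxtimes> c)"
    using F g by (simp add: ptr_def whiskers)
  also have "cap x y e \<odot> (g \<boxtimes> one y) = cap x' y' e' \<odot> (one x' \<boxtimes> ?t)"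
    by (simp add: t)
  also have "(one v \<boxtimes> cap x' y' e' \<odot> (one x' \<boxtimes> ?t)) \<odot> (F \<boxtimes> one y) \<odot> (one v \<boxtimes> c) =
      (one v \<boxtimes> cap x' y' e') \<odot> ((one (v @ x') \<boxtimes> ?t) \<odot> (F \<boxtimes> one y)) \<odot> (one v \<boxtimes> c)"
    by (simp add: whiskers)
  also have "(one (v @ x') \<boxtimes> ?t) \<odot> (F \<boxtimes> one y) = (F \<boxtimes> one y') \<odot> (one (v @ x) \<boxtimes> ?t)"
    using F slide_left[of F "v @ x" "v @ x'" ?t y y'] slide_right[of F "v @ x" "v @ x'" ?t y y'] by simp
  also have "(one v \<boxtimes> cap x' y' e') \<odot> ((F \<boxtimes> one y') \<odot> (one (v @ x) \<boxtimes> ?t)) \<odot> (one v \<boxtimes> c) =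
      (one v \<boxtimes> cap x' y' e') \<odot> (F \<boxtimes> one y') \<odot> (one v \<boxtimes> (one x \<boxtimes> ?t) \<odot> c)"
    by (simp add: whiskers)
  also have "(one x \<boxtimes> ?t) \<odot> c = (g \<boxtimes> one y') \<odot> c'"
    by (simp add: t)
  also have "(one v \<boxtimes> cap x' y' e') \<odot> (F \<boxtimes> one y') \<odot> (one v \<boxtimes> (g \<boxtimes> one y') \<odot> c') =
      (one v \<boxtimes> cap x' y' e') \<odot> ((F \<boxtimes> one y') \<odot> ((one v \<boxtimes> g) \<boxtimes> one y')) \<odot> (one v \<boxtimes> c')"
    using g by (simp add: whiskers)
  also have "(F \<boxtimes> one y') \<odot> ((one v \<boxtimes> g) \<boxtimes> one y') = (F \<odot> (one v \<boxtimes> g)) \<boxtimes> one y'"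
    using F g by (subst interchange) auto
  finally show ?thesis
    by (simp add: ptr_def)
qed

text \<open>The balancing axiom for the twist of a tensor product is what makes the right cap
  multiplicative.\<close>

lemma cap_tensor:
  assumes d: "dual_pair x y e c" and d': "dual_pair x' y' e' c'"
  shows "cap (x @ x') (y' @ y) (e' \<odot> (one y' \<boxtimes> e \<boxtimes> one x')) = cap x y e \<odot> (one x \<boxtimes> cap x' y' e' \<boxtimes> one y)"
proof -
  note dD [simp] = dual_pairD(1-6)[OF d] dual_pairD(1-6)[OF d']
  let ?b = "e \<odot> B x y" and ?b' = "e' \<odot> B x' y'" and ?w = "y' @ y"
  let ?ee = "e' \<odot> (one y' \<boxtimes> e \<boxtimes> one x')"
  let ?t = "B x x' \<odot> (\<theta> x \<boxtimes> \<theta> x') \<boxtimes> one ?w"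
  let ?Bx = "one x' \<boxtimes> B x ?w"
  let ?By = "one x' \<boxtimes> B x y' \<boxtimes> one y"
  let ?tt = "\<theta> x \<boxtimes> \<theta> x' \<boxtimes> one ?w"
  \<comment> \<open>A strand crossing both legs of the evaluation can be pulled off, since the
    braiding is natural in \<open>e\<close> and trivial with \<open>[]\<close>. The next fact does
    the same for \<open>?b'\<close>.\<close>
  have e_pass: "(e \<boxtimes> one x') \<odot> (one y \<boxtimes> B x' x) \<odot> (B x' y \<boxtimes> one x) = one x' \<boxtimes> e"
    using B_natural[of "one x'" x' x' e "y @ x" "[]"] by (simp add: B_append_right B_Nil_right)
  have b_pass: "(?b' \<boxtimes> one x) \<odot> (one x' \<boxtimes> B x y') \<odot> (B x x' \<boxtimes> one y') = one x \<boxtimes> ?b'"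
    using B_natural[of "one x" x x ?b' "x' @ y'" "[]"] by (simp add: B_append_right B_Nil_right)
  have "?ee \<odot> (one ?w \<boxtimes> B x' x) \<odot> B (x' @ x) ?w =
      e' \<odot> (one y' \<boxtimes> (e \<boxtimes> one x') \<odot> (one y \<boxtimes> B x' x) \<odot> (B x' y \<boxtimes> one x)) \<odot> (B x' y' \<boxtimes> one (y @ x)) \<odot> ?Bx"
  proof -
    have "B (x' @ x) ?w = (B x' ?w \<boxtimes> one x) \<odot> ?Bx"
      by (rule B_append_left)
    also have "B x' ?w \<boxtimes> one x = (one y' \<boxtimes> B x' y \<boxtimes> one x) \<odot> (B x' y' \<boxtimes> one (y @ x))"
      using interchange[of "one y' \<boxtimes> B x' y" "B x' y' \<boxtimes> one y" "one x" "one x"]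
      by (simp add: B_append_right tns_assoc one_append)
    finally show ?thesis
      by (simp add: cmp_assoc interchange_cmp one_append tns_assoc)
  qed
  also have "\<dots> = (e' \<odot> (one y' \<boxtimes> one x' \<boxtimes> e) \<odot> (B x' y' \<boxtimes> one (y @ x))) \<odot> ?Bx"
    by (simp only: e_pass cmp_assoc)
  also have "e' \<odot> (one y' \<boxtimes> one x' \<boxtimes> e) \<odot> (B x' y' \<boxtimes> one (y @ x)) = ?b' \<boxtimes> e"
    using slide_left[of "B x' y'" "x' @ y'" "y' @ x'" e "y @ x" "[]"] slide_right[of "B x' y'" "x' @ y'" "y' @ x'" e "y @ x" "[]"]
      slide_left[of ?b' "x' @ y'" "[]" e "y @ x" "[]"]
    by (simp add: one_append tns_assoc cmp_assoc)
  also have "(?b' \<boxtimes> e) \<odot> ?Bx = (?b' \<boxtimes> ?b) \<odot> ?By"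
  proof -
    have "one x' \<boxtimes> B x ?w = (one (x' @ y') \<boxtimes> B x y) \<odot> ?By"
      by (simp add: B_append_right interchange one_append tns_assoc)
    moreover have "(?b' \<boxtimes> e) \<odot> (one (x' @ y') \<boxtimes> B x y) = ?b' \<boxtimes> ?b"
      by (subst interchange) auto
    ultimately show ?thesis
      by (simp add: cmp_assoc[symmetric])
  qed
  also have "?b' \<boxtimes> ?b = ?b \<odot> ((?b' \<boxtimes> one x) \<boxtimes> one y)"
    using slide_right[of ?b' "x' @ y'" "[]" ?b "x @ y" "[]"] by (simp add: one_append tns_assoc)
  finally have main: "?ee \<odot> (one ?w \<boxtimes> B x' x) \<odot> B (x' @ x) ?w =
      (?b \<odot> ((?b' \<boxtimes> one x) \<boxtimes> one y)) \<odot> ?By" .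
  \<comment> \<open>Balancing splits the twist of \<open>x @ x'\<close> into the two twists and a
    double crossing. The outer crossing \<open>B x' x\<close> is moved through the long braiding by
    naturality, where \<open>main\<close> absorbs it.\<close>
  have "cap (x @ x') ?w ?ee =
      ?ee \<odot> (B (x @ x') ?w \<odot> (B x' x \<boxtimes> one ?w)) \<odot> ?t"
    by (simp add: cap_def twist_append cmp_assoc interchange)
  also have "B (x @ x') ?w \<odot> (B x' x \<boxtimes> one ?w) = (one ?w \<boxtimes> B x' x) \<odot> B (x' @ x) ?w"
    by (intro B_natural) auto
  also have "?ee \<odot> ((one ?w \<boxtimes> B x' x) \<odot> B (x' @ x) ?w) \<odot> ?t =
      (?ee \<odot> (one ?w \<boxtimes> B x' x) \<odot> B (x' @ x) ?w) \<odot> ?t"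
    by (simp add: cmp_assoc)
  also have "\<dots> = ((?b \<odot> ((?b' \<boxtimes> one x) \<boxtimes> one y)) \<odot> ?By) \<odot> ?t"
    by (simp only: main)
  also have "B x x' \<odot> (\<theta> x \<boxtimes> \<theta> x') \<boxtimes> one ?w = ((B x x' \<boxtimes> one y') \<boxtimes> one y) \<odot> ?tt"
    by (simp add: whiskers)
  also have "((?b \<odot> ((?b' \<boxtimes> one x) \<boxtimes> one y)) \<odot> ?By) \<odot> ((B x x' \<boxtimes> one y') \<boxtimes> one y) \<odot> ?tt =
      ?b \<odot> (((?b' \<boxtimes> one x) \<odot> (one x' \<boxtimes> B x y') \<odot> (B x x' \<boxtimes> one y')) \<boxtimes> one y) \<odot> ?tt"
    by (simp add: whiskers)
  also have "\<dots> = ?b \<odot> ((one x \<boxtimes> ?b') \<boxtimes> one y) \<odot> ?tt"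
    by (simp only: b_pass)
  also have "\<dots> = ?b \<odot> (\<theta> x \<boxtimes> ?b' \<odot> (\<theta> x' \<boxtimes> one y') \<boxtimes> one y)"
    by (simp add: interchange tns_assoc one_append) (simp add: whiskers)
  also have "\<dots> = cap x y e \<odot> (one x \<boxtimes> cap x' y' e' \<boxtimes> one y)"
    by (simp add: cap_def cmp_assoc interchange)
  finally show ?thesis .
qed

text \<open>Both the cap and the coevaluation of a double strand are nested, so closing it amounts
  to closing the inner strand \<open>x'\<close> first.\<close>

lemma ptr_tensor:
  assumes d: "dual_pair x y e c" and d': "dual_pair x' y' e' c'" and F: "hom F (v @ x @ x') (v @ x @ x')"
  shows "ptr v (x @ x') (y' @ y) (e' \<odot> (one y' \<boxtimes> e \<boxtimes> one x')) ((one x \<boxtimes> c' \<boxtimes> one y) \<odot> c) F =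
    ptr v x y e c (ptr (v @ x) x' y' e' c' F)"
proof -
  note dD [simp] = dual_pairD(1-6)[OF d] dual_pairD(1-6)[OF d']
  note [simp] = hom_cap[OF d] hom_cap[OF d']
  show ?thesis
    using F by (simp add: ptr_def cap_tensor[OF d d'] whiskers)
qed

text \<open>Once the braidings with \<open>x @ x'\<close> are split, the inner loop
  \<open>x'\<close> closes around \<open>v\<close> alone, between the two crossings of
  \<open>v\<close> with \<open>x\<close>. The resulting endomorphism \<open>?z\<close> of
  \<open>v\<close> slides out past one of these crossings by naturality, and the loop
  \<open>x\<close> remains.\<close>

lemma encircle_tensor:
  assumes d: "dual_pair x y e c" and d': "dual_pair x' y' e' c'"
  shows "ptr v (x @ x') (y' @ y) (e' \<odot> (one y' \<boxtimes> e \<boxtimes> one x')) ((one x \<boxtimes> c' \<boxtimes> one y) \<odot> c)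
      (B (x @ x') v \<odot> B v (x @ x')) =
    ptr v x' y' e' c' (B x' v \<odot> B v x') \<odot> ptr v x y e c (B x v \<odot> B v x)"
proof -
  note dD [simp] = dual_pairD(1-6)[OF d] dual_pairD(1-6)[OF d']
  note [simp] = hom_cap[OF d] hom_cap[OF d']
  let ?M' = "B x' v \<odot> B v x'" and ?M = "B x v \<odot> B v x"
  let ?z = "ptr v x' y' e' c' ?M'"
  let ?cap = "one (v @ x) \<boxtimes> cap x' y' e'"
  let ?Bv = "B x v \<boxtimes> one (x' @ y')"
  let ?Mx = "one x \<boxtimes> ?M' \<boxtimes> one y'"
  let ?cv = "one (x @ v) \<boxtimes> c'"
  have z [simp]: "arr ?z" "src ?z = v" "tgt ?z = v"
    using hom_ptr[OF d', of ?M' v v] by auto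
  have "B (x @ x') v \<odot> B v (x @ x') = (B x v \<boxtimes> one x') \<odot> (one x \<boxtimes> ?M') \<odot> (B v x \<boxtimes> one x')"
    by (simp add: B_append_left B_append_right whiskers)
  then have "ptr (v @ x) x' y' e' c' (B (x @ x') v \<odot> B v (x @ x')) =
      ?cap \<odot> ?Bv \<odot> ?Mx \<odot> (B v x \<boxtimes> one (x' @ y')) \<odot> (one (v @ x) \<boxtimes> c')"
    by (simp add: ptr_def whiskers)
  also have "(B v x \<boxtimes> one (x' @ y')) \<odot> (one (v @ x) \<boxtimes> c') = ?cv \<odot> B v x"
    using slide_left[of "B v x" "v @ x" "x @ v" c' "[]" "x' @ y'"] slide_right[of "B v x" "v @ x" "x @ v" c' "[]" "x' @ y'"]
    by simp
  also have "?cap \<odot> ?Bv \<odot> ?Mx \<odot> ?cv \<odot> B v x =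
      (?cap \<odot> ?Bv) \<odot> ?Mx \<odot> ?cv \<odot> B v x"
    by (simp add: cmp_assoc)
  also have "?cap \<odot> ?Bv = B x v \<odot> (one (x @ v) \<boxtimes> cap x' y' e')"
    using slide_left[of "B x v" "x @ v" "v @ x" "cap x' y' e'" "x' @ y'" "[]"] slide_right[of "B x v" "x @ v" "v @ x" "cap x' y' e'" "x' @ y'" "[]"]
    by simp
  also have "(B x v \<odot> (one (x @ v) \<boxtimes> cap x' y' e')) \<odot> ?Mx \<odot> ?cv \<odot> B v x =
      B x v \<odot> (one x \<boxtimes> ?z) \<odot> B v x"
    by (simp add: ptr_def whiskers)
  also have "\<dots> = (B x v \<odot> (one x \<boxtimes> ?z)) \<odot> B v x"
    by (simp add: cmp_assoc)
  also have "B x v \<odot> (one x \<boxtimes> ?z) = (?z \<boxtimes> one x) \<odot> B x v"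
    by (intro B_natural) auto
  finally have *: "ptr (v @ x) x' y' e' c' (B (x @ x') v \<odot> B v (x @ x')) = (?z \<boxtimes> one x) \<odot> ?M"
    by (simp add: cmp_assoc)
  have "ptr v x y e c ((?z \<boxtimes> one x) \<odot> ?M) =
      ((one v \<boxtimes> cap x y e) \<odot> (?z \<boxtimes> one (x @ y))) \<odot> (?M \<boxtimes> one y) \<odot> (one v \<boxtimes> c)"
    by (simp add: ptr_def[of _ x] whiskers)
  also have "(one v \<boxtimes> cap x y e) \<odot> (?z \<boxtimes> one (x @ y)) = ?z \<odot> (one v \<boxtimes> cap x y e)"
    using slide_left[of ?z v v "cap x y e" "x @ y" "[]"] slide_right[of ?z v v "cap x y e" "x @ y" "[]"]
    by simp
  finally have "ptr v x y e c ((?z \<boxtimes> one x) \<odot> ?M) = ?z \<odot> ptr v x y e c ?M"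
    by (simp add: ptr_def cmp_assoc)
  then show ?thesis
    using ptr_tensor[OF d d', of "B (x @ x') v \<odot> B v (x @ x')" v] * by simp
qed

end

section \<open>Strictification\<close>

no_notation univ_poly (\<open>(\<open>open_block notation=\<open>postfix X\<close>\<close>_ [X]\<index>)\<close> 80) (* frees the list [X] *)

text \<open>A family of morphisms together with the lists it connects. \<open>Undef\<close> is the
  outcome of composing mismatched families; it makes the laws of the strict category
  unconditional.\<close>

datatype ('o, 'm) family = Undef | Family (fsrc: "'o list") (ftgt: "'o list") (fmor: "'o \<Rightarrow> 'm")

context linear_category
begin

lemma comp_eq_right:
  assumes "a \<bullet> b = c \<bullet> d" "a \<in> Hom Y Z" "b \<in> Hom X Y" "c \<in> Hom Y' Z" "d \<in> Hom X Y'" "h \<in> Hom W X"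
  shows "a \<bullet> (b \<bullet> h) = c \<bullet> (d \<bullet> h)"
  using comp_assoc[OF assms(2,3,6)] comp_assoc[OF assms(4,5,6)] assms(1) by simp

end

context linear_monoidal_category
begin

lemma assoc_in_Hom: "assoc X Y Z \<in> Hom ((X \<otimes>\<^sub>o Y) \<otimes>\<^sub>o Z) (X \<otimes>\<^sub>o (Y \<otimes>\<^sub>o Z))"
  by (rule is_iso_in_Hom[OF assoc_iso])

lemma lunit_in_Hom: "lunit X \<in> Hom (\<one>\<^sub>o \<otimes>\<^sub>o X) X"
  by (rule is_iso_in_Hom[OF lunit_iso])

lemma runit_in_Hom: "runit X \<in> Hom (X \<otimes>\<^sub>o \<one>\<^sub>o) X"
  by (rule is_iso_in_Hom[OF runit_iso])

lemma tensor_comp_left: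
  "\<lbrakk>g \<in> Hom Y Z; f \<in> Hom X Y\<rbrakk> \<Longrightarrow> (g \<bullet> f) \<otimes>\<^sub>m ide W = (g \<otimes>\<^sub>m ide W) \<bullet> (f \<otimes>\<^sub>m ide W)"
  using tensor_comp[OF _ _ ide_in_Hom ide_in_Hom] comp_ide_left[OF ide_in_Hom] by metis

lemma tensor_comp_right:
  "\<lbrakk>g \<in> Hom Y Z; f \<in> Hom X Y\<rbrakk> \<Longrightarrow> ide W \<otimes>\<^sub>m (g \<bullet> f) = (ide W \<otimes>\<^sub>m g) \<bullet> (ide W \<otimes>\<^sub>m f)"
  using tensor_comp[OF ide_in_Hom ide_in_Hom] comp_ide_left[OF ide_in_Hom] by metis

lemma tensor_slide:
  assumes "f \<in> Hom X X'" "g \<in> Hom Y Y'"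
  shows "(f \<otimes>\<^sub>m ide Y') \<bullet> (ide X \<otimes>\<^sub>m g) = f \<otimes>\<^sub>m g" "(ide X' \<otimes>\<^sub>m g) \<bullet> (f \<otimes>\<^sub>m ide Y) = f \<otimes>\<^sub>m g"
  using tensor_comp[OF ide_in_Hom assms(1) assms(2) ide_in_Hom] tensor_comp[OF assms(1) ide_in_Hom ide_in_Hom assms(2)]
    comp_ide_left comp_ide_right assms by simp_all

abbreviation tensor_list :: "'o list \<Rightarrow> 'o \<Rightarrow> 'o" where
  "tensor_list Xs V \<equiv> foldr (\<otimes>\<^sub>o) Xs V"

abbreviation whisker :: "'o list \<Rightarrow> 'm \<Rightarrow> 'm" where
  "whisker Xs f \<equiv> foldr (\<lambda>X. (\<otimes>\<^sub>m) (ide X)) Xs f"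

text \<open>The iterated associator from \<open>(Xs \<otimes> V) \<otimes> W\<close> to
  \<open>Xs \<otimes> (V \<otimes> W)\<close>; it is the right module structure of the endofunctor
  attached to \<open>Xs\<close>.\<close>

primrec reassoc :: "'o list \<Rightarrow> 'o \<Rightarrow> 'o \<Rightarrow> 'm" where
  "reassoc [] V W = ide (V \<otimes>\<^sub>o W)"
| "reassoc (X # Xs) V W = (ide X \<otimes>\<^sub>m reassoc Xs V W) \<bullet> assoc X (tensor_list Xs V) W"

lemma whisker_in_Hom: "f \<in> Hom V W \<Longrightarrow> whisker Xs f \<in> Hom (tensor_list Xs V) (tensor_list Xs W)"
  by (induction Xs) (auto intro: tensor_in_Hom ide_in_Hom)

lemma whisker_ide: "whisker Xs (ide V) = ide (tensor_list Xs V)"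
  by (induction Xs) (auto simp: tensor_ide)

lemma whisker_comp:
  assumes "g \<in> Hom V W" "f \<in> Hom U V"
  shows "whisker Xs (g \<bullet> f) = whisker Xs g \<bullet> whisker Xs f"
proof (induction Xs)
  case (Cons X Xs)
  then show ?case
    using tensor_comp_right[OF whisker_in_Hom[OF assms(1)] whisker_in_Hom[OF assms(2)]] by simp
qed simp

lemma reassoc_iso: "is_iso (tensor_list Xs V \<otimes>\<^sub>o W) (tensor_list Xs (V \<otimes>\<^sub>o W)) (reassoc Xs V W)"
proof (induction Xs)
  case (Cons X Xs)
  then show ?case
    using is_iso_comp[OF assoc_iso is_iso_tensor[OF is_iso_ide]] by simp
qed (simp add: is_iso_ide)

lemmas reassoc_in_Hom = is_iso_in_Hom[OF reassoc_iso]

lemma reassoc_natural: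
  assumes f: "f \<in> Hom V V'"
  shows "reassoc Xs V' W \<bullet> (whisker Xs f \<otimes>\<^sub>m ide W) = whisker Xs (f \<otimes>\<^sub>m ide W) \<bullet> reassoc Xs V W"
proof (induction Xs)
  case Nil
  then show ?case
    using comp_ide_left[OF tensor_in_Hom[OF f ide_in_Hom]] comp_ide_right[OF tensor_in_Hom[OF f ide_in_Hom]] by simp
next
  case (Cons X Xs)
  note w = whisker_in_Hom[OF f, of Xs] and w' = whisker_in_Hom[OF tensor_in_Hom[OF f ide_in_Hom], of Xs W]
  have "reassoc (X # Xs) V' W \<bullet> (whisker (X # Xs) f \<otimes>\<^sub>m ide W) =
      (ide X \<otimes>\<^sub>m reassoc Xs V' W) \<bullet> (assoc X (tensor_list Xs V') W \<bullet> ((ide X \<otimes>\<^sub>m whisker Xs f) \<otimes>\<^sub>m ide W))"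
    using comp_assoc[OF tensor_in_Hom[OF ide_in_Hom reassoc_in_Hom] assoc_in_Hom tensor_in_Hom[OF tensor_in_Hom[OF ide_in_Hom w] ide_in_Hom]]
    by simp
  also have "assoc X (tensor_list Xs V') W \<bullet> ((ide X \<otimes>\<^sub>m whisker Xs f) \<otimes>\<^sub>m ide W) =
      (ide X \<otimes>\<^sub>m (whisker Xs f \<otimes>\<^sub>m ide W)) \<bullet> assoc X (tensor_list Xs V) W"
    by (rule assoc_natural[OF ide_in_Hom w ide_in_Hom])
  also have "(ide X \<otimes>\<^sub>m reassoc Xs V' W) \<bullet> ((ide X \<otimes>\<^sub>m (whisker Xs f \<otimes>\<^sub>m ide W)) \<bullet> assoc X (tensor_list Xs V) W) =
      ((ide X \<otimes>\<^sub>m reassoc Xs V' W) \<bullet> (ide X \<otimes>\<^sub>m (whisker Xs f \<otimes>\<^sub>m ide W))) \<bullet> assoc X (tensor_list Xs V) W"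
    by (rule comp_assoc[symmetric, OF tensor_in_Hom[OF ide_in_Hom reassoc_in_Hom] tensor_in_Hom[OF ide_in_Hom tensor_in_Hom[OF w ide_in_Hom]] assoc_in_Hom])
  also have "(ide X \<otimes>\<^sub>m reassoc Xs V' W) \<bullet> (ide X \<otimes>\<^sub>m (whisker Xs f \<otimes>\<^sub>m ide W)) =
      (ide X \<otimes>\<^sub>m whisker Xs (f \<otimes>\<^sub>m ide W)) \<bullet> (ide X \<otimes>\<^sub>m reassoc Xs V W)"
    using tensor_comp_right[OF reassoc_in_Hom tensor_in_Hom[OF w ide_in_Hom], symmetric]
      tensor_comp_right[OF w' reassoc_in_Hom, symmetric] Cons.IH by simp
  also have "((ide X \<otimes>\<^sub>m whisker Xs (f \<otimes>\<^sub>m ide W)) \<bullet> (ide X \<otimes>\<^sub>m reassoc Xs V W)) \<bullet> assoc X (tensor_list Xs V) W =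
      whisker (X # Xs) (f \<otimes>\<^sub>m ide W) \<bullet> reassoc (X # Xs) V W"
    using comp_assoc[OF tensor_in_Hom[OF ide_in_Hom w'] tensor_in_Hom[OF ide_in_Hom reassoc_in_Hom] assoc_in_Hom] by simp
  finally show ?case .
qed

lemma reassoc_append:
  "reassoc (Xs @ Ys) V W = whisker Xs (reassoc Ys V W) \<bullet> reassoc Xs (tensor_list Ys V) W"
proof (induction Xs)
  case Nil
  then show ?case
    using comp_ide_right[OF reassoc_in_Hom] by simp
next
  case (Cons X Xs)
  then show ?case
    using tensor_comp_right[OF whisker_in_Hom[OF reassoc_in_Hom] reassoc_in_Hom]
      comp_assoc[OF tensor_in_Hom[OF ide_in_Hom whisker_in_Hom[OF reassoc_in_Hom]] tensor_in_Hom[OF ide_in_Hom reassoc_in_Hom] assoc_in_Hom]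
    by simp
qed

text \<open>The right module endofunctors \<open>X\<^sub>1 \<otimes> (\<dots> (X\<^sub>n \<otimes> -))\<close> and their module transformations form a
  strict monoidal category equivalent to the given one.\<close>

definition module_family :: "'o list \<Rightarrow> 'o list \<Rightarrow> ('o \<Rightarrow> 'm) \<Rightarrow> bool" where
  "module_family Xs Ys \<alpha> \<longleftrightarrow>
     (\<forall>V. \<alpha> V \<in> Hom (tensor_list Xs V) (tensor_list Ys V)) \<and>
     (\<forall>V W. \<forall>f\<in>Hom V W. \<alpha> W \<bullet> whisker Xs f = whisker Ys f \<bullet> \<alpha> V) \<and>
     (\<forall>V W. \<alpha> (V \<otimes>\<^sub>o W) \<bullet> reassoc Xs V W = reassoc Ys V W \<bullet> (\<alpha> V \<otimes>\<^sub>m ide W))"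

definition farr :: "('o, 'm) family \<Rightarrow> bool" where
  "farr f \<longleftrightarrow> f \<noteq> Undef \<and> module_family (fsrc f) (ftgt f) (fmor f)"

definition fcmp :: "('o, 'm) family \<Rightarrow> ('o, 'm) family \<Rightarrow> ('o, 'm) family" (infixr "\<odot>" 80) where
  "g \<odot> f = (if farr g \<and> farr f \<and> ftgt f = fsrc g then Family (fsrc f) (ftgt g) (\<lambda>V. fmor g V \<bullet> fmor f V) else Undef)"

text \<open>Horizontal composition of natural transformations. Of its two expressions, equal by
  naturality of \<open>f\<close>, the one that applies \<open>g\<close> first is chosen.\<close>

definition ftns :: "('o, 'm) family \<Rightarrow> ('o, 'm) family \<Rightarrow> ('o, 'm) family" (infixr "\<boxtimes>" 75) where
  "f \<boxtimes> g = (if farr f \<and> farr g then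
     Family (fsrc f @ fsrc g) (ftgt f @ ftgt g) (\<lambda>V. fmor f (tensor_list (ftgt g) V) \<bullet> whisker (fsrc f) (fmor g V)) else Undef)"

definition fone :: "'o list \<Rightarrow> ('o, 'm) family" where
  "fone Xs = Family Xs Xs (\<lambda>V. ide (tensor_list Xs V))"

lemma farrD:
  assumes "farr f"
  shows "fmor f V \<in> Hom (tensor_list (fsrc f) V) (tensor_list (ftgt f) V)"
    and "h \<in> Hom V W \<Longrightarrow> fmor f W \<bullet> whisker (fsrc f) h = whisker (ftgt f) h \<bullet> fmor f V"
    and "fmor f (V \<otimes>\<^sub>o W) \<bullet> reassoc (fsrc f) V W = reassoc (ftgt f) V W \<bullet> (fmor f V \<otimes>\<^sub>m ide W)"
  using assms by (auto simp: farr_def module_family_def)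

lemma not_farr_Undef [simp]: "\<not> farr Undef"
  by (simp add: farr_def)

lemma farr_Family: "farr (Family Xs Ys \<alpha>) \<longleftrightarrow> module_family Xs Ys \<alpha>"
  by (simp add: farr_def)

lemma family_eqI:
  assumes "farr f" "farr g" "fsrc f = fsrc g" "ftgt f = ftgt g" "\<And>V. fmor f V = fmor g V"
  shows "f = g"
  using assms by (cases f; cases g) auto

lemma farr_fcmp_aux:
  assumes "farr g" "farr f" "ftgt f = fsrc g"
  shows "module_family (fsrc f) (ftgt g) (\<lambda>V. fmor g V \<bullet> fmor f V)"
  unfolding module_family_def
proof (intro conjI allI ballI)
  note f = farrD[OF assms(2), unfolded assms(3)] and g = farrD[OF assms(1)]
  show "fmor g V \<bullet> fmor f V \<in> Hom (tensor_list (fsrc f) V) (tensor_list (ftgt g) V)" for V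
    by (rule comp_in_Hom[OF g(1) f(1)])
  show "(fmor g W \<bullet> fmor f W) \<bullet> whisker (fsrc f) h = whisker (ftgt g) h \<bullet> (fmor g V \<bullet> fmor f V)"
    if h: "h \<in> Hom V W" for V W h
    using comp_assoc[OF g(1) f(1) whisker_in_Hom[OF h]] f(2)[OF h] g(2)[OF h]
      comp_assoc[OF g(1) whisker_in_Hom[OF h] f(1)] comp_assoc[OF whisker_in_Hom[OF h] g(1) f(1)] by simp
  show "(fmor g (V \<otimes>\<^sub>o W) \<bullet> fmor f (V \<otimes>\<^sub>o W)) \<bullet> reassoc (fsrc f) V W =
      reassoc (ftgt g) V W \<bullet> ((fmor g V \<bullet> fmor f V) \<otimes>\<^sub>m ide W)" for V W
    using comp_assoc[OF g(1) f(1) reassoc_in_Hom] f(3) g(3)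
      comp_assoc[OF g(1) reassoc_in_Hom tensor_in_Hom[OF f(1) ide_in_Hom]]
      comp_assoc[OF reassoc_in_Hom tensor_in_Hom[OF g(1) ide_in_Hom] tensor_in_Hom[OF f(1) ide_in_Hom]]
      tensor_comp_left[OF g(1) f(1)] by simp
qed

lemma farr_ftns_aux:
  assumes "farr f" "farr g"
  shows "module_family (fsrc f @ fsrc g) (ftgt f @ ftgt g)
    (\<lambda>V. fmor f (tensor_list (ftgt g) V) \<bullet> whisker (fsrc f) (fmor g V))"
  unfolding module_family_def foldr_append comp_apply
proof (intro conjI allI ballI)
  note f = farrD[OF assms(1)] and g = farrD[OF assms(2)]
  note wg = whisker_in_Hom[OF g(1)]
  let ?f = "\<lambda>V. fmor f (tensor_list (ftgt g) V)" and ?w = "\<lambda>V. whisker (fsrc f) (fmor g V)"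
  show "?f V \<bullet> ?w V \<in>
      Hom (tensor_list (fsrc f) (tensor_list (fsrc g) V)) (tensor_list (ftgt f) (tensor_list (ftgt g) V))" for V
    by (rule comp_in_Hom[OF f(1) wg])
  show "(?f W \<bullet> ?w W) \<bullet> whisker (fsrc f) (whisker (fsrc g) h) =
      whisker (ftgt f) (whisker (ftgt g) h) \<bullet> (?f V \<bullet> ?w V)"
    if h: "h \<in> Hom V W" for V W h
  proof -
    note wh = whisker_in_Hom[OF h]
    note wwh = whisker_in_Hom[OF wh]
    have "(?f W \<bullet> ?w W) \<bullet> whisker (fsrc f) (whisker (fsrc g) h) =
        ?f W \<bullet> (?w W \<bullet> whisker (fsrc f) (whisker (fsrc g) h))"
      by (rule comp_assoc[OF f(1) wg wwh])
    also have "?w W \<bullet> whisker (fsrc f) (whisker (fsrc g) h) =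
        whisker (fsrc f) (whisker (ftgt g) h) \<bullet> ?w V"
      using whisker_comp[OF g(1) wh] whisker_comp[OF wh g(1)] g(2)[OF h] by simp
    also have "?f W \<bullet> (whisker (fsrc f) (whisker (ftgt g) h) \<bullet> ?w V) =
        whisker (ftgt f) (whisker (ftgt g) h) \<bullet> (?f V \<bullet> ?w V)"
      by (rule comp_eq_right[OF f(2)[OF wh] f(1) wwh wwh f(1) wg])
    finally show ?thesis .
  qed
  show "(?f (V \<otimes>\<^sub>o W) \<bullet> ?w (V \<otimes>\<^sub>o W)) \<bullet> reassoc (fsrc f @ fsrc g) V W =
      reassoc (ftgt f @ ftgt g) V W \<bullet> ((?f V \<bullet> ?w V) \<otimes>\<^sub>m ide W)" for V W
  proof -
    let ?r = "reassoc (ftgt g) V W" and ?F = "?f (V \<otimes>\<^sub>o W)"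
    let ?gW = "fmor g V \<otimes>\<^sub>m ide W" and ?S = "reassoc (fsrc f)"
    note gW = tensor_in_Hom[OF g(1)[of V] ide_in_Hom[of W]]
    have "(?F \<bullet> ?w (V \<otimes>\<^sub>o W)) \<bullet> reassoc (fsrc f @ fsrc g) V W =
        ?F \<bullet> ((?w (V \<otimes>\<^sub>o W) \<bullet> whisker (fsrc f) (reassoc (fsrc g) V W)) \<bullet> ?S (tensor_list (fsrc g) V) W)"
      unfolding reassoc_append by (rule comp_middle[OF reassoc_in_Hom whisker_in_Hom[OF reassoc_in_Hom] wg f(1)])
    also have "?w (V \<otimes>\<^sub>o W) \<bullet> whisker (fsrc f) (reassoc (fsrc g) V W) =
        whisker (fsrc f) ?r \<bullet> whisker (fsrc f) ?gW"
      using whisker_comp[OF g(1) reassoc_in_Hom] whisker_comp[OF reassoc_in_Hom gW] g(3) by simp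
    also have "(whisker (fsrc f) ?r \<bullet> whisker (fsrc f) ?gW) \<bullet> ?S (tensor_list (fsrc g) V) W =
        whisker (fsrc f) ?r \<bullet> (whisker (fsrc f) ?gW \<bullet> ?S (tensor_list (fsrc g) V) W)"
      by (rule comp_assoc[OF whisker_in_Hom[OF reassoc_in_Hom] whisker_in_Hom[OF gW] reassoc_in_Hom])
    also have "whisker (fsrc f) ?gW \<bullet> ?S (tensor_list (fsrc g) V) W =
        ?S (tensor_list (ftgt g) V) W \<bullet> (?w V \<otimes>\<^sub>m ide W)"
      by (rule reassoc_natural[OF g(1), symmetric])
    also have "?F \<bullet> (whisker (fsrc f) ?r \<bullet> (?S (tensor_list (ftgt g) V) W \<bullet> (?w V \<otimes>\<^sub>m ide W))) =
        whisker (ftgt f) ?r \<bullet> (fmor f (tensor_list (ftgt g) V \<otimes>\<^sub>o W) \<bullet> (?S (tensor_list (ftgt g) V) W \<bullet> (?w V \<otimes>\<^sub>m ide W)))"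
      by (rule comp_eq_right[OF f(2)[OF reassoc_in_Hom] f(1) whisker_in_Hom[OF reassoc_in_Hom]
            whisker_in_Hom[OF reassoc_in_Hom] f(1) comp_in_Hom[OF reassoc_in_Hom tensor_in_Hom[OF wg ide_in_Hom]]])
    also have "fmor f (tensor_list (ftgt g) V \<otimes>\<^sub>o W) \<bullet> (?S (tensor_list (ftgt g) V) W \<bullet> (?w V \<otimes>\<^sub>m ide W)) =
        reassoc (ftgt f) (tensor_list (ftgt g) V) W \<bullet> ((?f V \<otimes>\<^sub>m ide W) \<bullet> (?w V \<otimes>\<^sub>m ide W))"
      by (rule comp_eq_right[OF f(3) f(1) reassoc_in_Hom reassoc_in_Hom tensor_in_Hom[OF f(1) ide_in_Hom] tensor_in_Hom[OF wg ide_in_Hom]])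
    also have "(?f V \<otimes>\<^sub>m ide W) \<bullet> (?w V \<otimes>\<^sub>m ide W) =
        (?f V \<bullet> ?w V) \<otimes>\<^sub>m ide W"
      by (rule tensor_comp_left[OF f(1) wg, symmetric])
    also have "whisker (ftgt f) ?r \<bullet> (reassoc (ftgt f) (tensor_list (ftgt g) V) W \<bullet> ((?f V \<bullet> ?w V) \<otimes>\<^sub>m ide W)) =
        reassoc (ftgt f @ ftgt g) V W \<bullet> ((?f V \<bullet> ?w V) \<otimes>\<^sub>m ide W)"
      unfolding reassoc_append
      by (rule comp_assoc[symmetric, OF whisker_in_Hom[OF reassoc_in_Hom] reassoc_in_Hom tensor_in_Hom[OF comp_in_Hom[OF f(1) wg] ide_in_Hom]])
    finally show ?thesis .
  qed
qed

lemma farr_fone: "farr (fone Xs)"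
  using comp_ide_left[OF whisker_in_Hom, of _ _ _ Xs] comp_ide_right[OF whisker_in_Hom, of _ _ _ Xs]
    comp_ide_left[OF reassoc_in_Hom] comp_ide_right[OF reassoc_in_Hom] tensor_ide ide_in_Hom
  by (auto simp: fone_def farr_Family module_family_def)

text \<open>Associativity and units of the tensor product reduce to functoriality of whiskering,
  because composing functors appends their lists. Interchange is naturality of \<open>f\<close> at
  the components of \<open>g'\<close>.\<close>

sublocale E: strict_monoidal farr fsrc ftgt fcmp ftns fone
proof
  fix f g h :: "('o, 'm) family" and Xs Ys :: "'o list"
  show arr_cmp: "farr (g \<odot> f) \<longleftrightarrow> farr g \<and> farr f \<and> ftgt f = fsrc g" for f g
    using farr_fcmp_aux by (auto simp: fcmp_def farr_Family)
  show arr_tns: "farr (f \<boxtimes> g) \<longleftrightarrow> farr f \<and> farr g" for f g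
    using farr_ftns_aux by (auto simp: ftns_def farr_Family)
  show "fsrc (g \<odot> f) = fsrc f" "ftgt (g \<odot> f) = ftgt g" if "farr g" "farr f" "ftgt f = fsrc g"
    using that by (simp_all add: fcmp_def)
  show "fsrc (f \<boxtimes> g) = fsrc f @ fsrc g" "ftgt (f \<boxtimes> g) = ftgt f @ ftgt g" if "farr f" "farr g"
    using that by (simp_all add: ftns_def)
  show "farr (fone Xs)" "fsrc (fone Xs) = Xs" "ftgt (fone Xs) = Xs"
    using farr_fone by (simp_all add: fone_def)
  show "(h \<odot> g) \<odot> f = h \<odot> g \<odot> f"
  proof (cases "farr h \<and> farr g \<and> farr f \<and> ftgt g = fsrc h \<and> ftgt f = fsrc g")
    case True
    then have hgf: "farr h" "farr g" "farr f" and eq: "ftgt g = fsrc h" "ftgt f = fsrc g"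
      by auto
    show ?thesis
      using hgf eq comp_assoc[OF farrD(1)[OF hgf(1)] farrD(1)[OF hgf(2), unfolded eq] farrD(1)[OF hgf(3), unfolded eq]]
        farr_fcmp_aux[OF hgf(2,3) eq(2)] farr_fcmp_aux[OF hgf(1,2) eq(1)]
      by (intro family_eqI; simp add: arr_cmp; simp add: fcmp_def arr_cmp farr_Family)
  next
    case False
    then have "\<not> farr ((h \<odot> g) \<odot> f)" "\<not> farr (h \<odot> g \<odot> f)"
      by (auto simp: arr_cmp) (auto simp: fcmp_def)
    then show ?thesis
      by (metis fcmp_def arr_cmp)
  qed
  show "(f \<boxtimes> g) \<boxtimes> h = f \<boxtimes> g \<boxtimes> h"
  proof (cases "farr f \<and> farr g \<and> farr h")
    case True
    then have fgh: "farr f" "farr g" "farr h"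
      by auto
    show ?thesis
    proof (rule family_eqI)
      fix V
      show "fmor ((f \<boxtimes> g) \<boxtimes> h) V = fmor (f \<boxtimes> g \<boxtimes> h) V"
        using fgh comp_assoc[OF farrD(1)[OF fgh(1)] whisker_in_Hom[OF farrD(1)[OF fgh(2)]]
            whisker_in_Hom[OF whisker_in_Hom[OF farrD(1)[OF fgh(3)]]]]
          whisker_comp[OF farrD(1)[OF fgh(2)] whisker_in_Hom[OF farrD(1)[OF fgh(3)]]]
        by (simp add: ftns_def farr_ftns_aux farr_Family)
    qed (use fgh in \<open>simp_all add: arr_tns, simp_all add: ftns_def farr_Family farr_ftns_aux\<close>)
  next
    case False
    then show ?thesis
      by (auto simp: ftns_def arr_tns farr_Family)
  qed
  show "f \<odot> fone (fsrc f) = f" "fone (ftgt f) \<odot> f = f" if f: "farr f"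
    using f farr_fone comp_ide_right[OF farrD(1)[OF f]] comp_ide_left[OF farrD(1)[OF f]]
    by (intro family_eqI; simp add: arr_cmp; simp add: fcmp_def fone_def)+
  show "fone [] \<boxtimes> f = f" "f \<boxtimes> fone [] = f" if f: "farr f"
    using f farr_fone[of "[]"] comp_ide_right[OF farrD(1)[OF f]] comp_ide_left[OF farrD(1)[OF f]] whisker_ide
    by (intro family_eqI; simp add: arr_tns; simp add: ftns_def fone_def)+
  show "fone (Xs @ Ys) = fone Xs \<boxtimes> fone Ys"
    using farr_fone comp_ide_left[OF ide_in_Hom] whisker_ide
    by (intro family_eqI; simp add: arr_tns; simp add: ftns_def fone_def)
  fix g' f'
  show "(g \<boxtimes> g') \<odot> (f \<boxtimes> f') = g \<odot> f \<boxtimes> g' \<odot> f'"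
    if a: "farr g" "farr f" "ftgt f = fsrc g" "farr g'" "farr f'" "ftgt f' = fsrc g'"
  proof (rule family_eqI)
    fix V
    note F = farrD[OF a(2), unfolded a(3)] and G = farrD[OF a(1)]
      and F' = farrD[OF a(5), unfolded a(6)] and G' = farrD[OF a(4)]
    have "(fmor g (tensor_list (ftgt g') V) \<bullet> whisker (fsrc g) (fmor g' V)) \<bullet> (fmor f (tensor_list (fsrc g') V) \<bullet> whisker (fsrc f) (fmor f' V)) =
        fmor g (tensor_list (ftgt g') V) \<bullet> ((whisker (fsrc g) (fmor g' V) \<bullet> fmor f (tensor_list (fsrc g') V)) \<bullet> whisker (fsrc f) (fmor f' V))"
      by (rule comp_middle[OF whisker_in_Hom[OF F'(1)] F(1) whisker_in_Hom[OF G'(1)] G(1)])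
    also have "whisker (fsrc g) (fmor g' V) \<bullet> fmor f (tensor_list (fsrc g') V) = fmor f (tensor_list (ftgt g') V) \<bullet> whisker (fsrc f) (fmor g' V)"
      using F(2)[OF G'(1)] by simp
    also have "fmor g (tensor_list (ftgt g') V) \<bullet> ((fmor f (tensor_list (ftgt g') V) \<bullet> whisker (fsrc f) (fmor g' V)) \<bullet> whisker (fsrc f) (fmor f' V)) =
        (fmor g (tensor_list (ftgt g') V) \<bullet> fmor f (tensor_list (ftgt g') V)) \<bullet> (whisker (fsrc f) (fmor g' V) \<bullet> whisker (fsrc f) (fmor f' V))"
      by (rule comp_middle[symmetric, OF whisker_in_Hom[OF F'(1)] whisker_in_Hom[OF G'(1)] F(1) G(1)])
    also have "whisker (fsrc f) (fmor g' V) \<bullet> whisker (fsrc f) (fmor f' V) = whisker (fsrc f) (fmor g' V \<bullet> fmor f' V)"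
      by (rule whisker_comp[OF G'(1) F'(1), symmetric])
    finally show "fmor ((g \<boxtimes> g') \<odot> (f \<boxtimes> f')) V = fmor (g \<odot> f \<boxtimes> g' \<odot> f') V"
      using a farr_ftns_aux[OF a(2,5)] by (simp add: ftns_def fcmp_def farr_Family farr_ftns_aux farr_fcmp_aux)
  qed (use a farr_ftns_aux[OF a(2,5)] in \<open>simp_all add: arr_tns arr_cmp, simp_all add: ftns_def fcmp_def farr_Family farr_ftns_aux farr_fcmp_aux\<close>)
qed

end

section \<open>The embedding of the given category into its strictification\<close>

context linear_monoidal_category
begin

lemma fmor_fcmp [simp]: "\<lbrakk>farr g; farr f; ftgt f = fsrc g\<rbrakk> \<Longrightarrow> fmor (g \<odot> f) V = fmor g V \<bullet> fmor f V"
  by (simp add: fcmp_def)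

lemma fmor_ftns [simp]:
  "\<lbrakk>farr f; farr g\<rbrakk> \<Longrightarrow> fmor (f \<boxtimes> g) V = fmor f (tensor_list (ftgt g) V) \<bullet> whisker (fsrc f) (fmor g V)"
  by (simp add: ftns_def)

lemma fmor_fone [simp]: "fmor (fone Xs) V = ide (tensor_list Xs V)"
  by (simp add: fone_def)

text \<open>The pointwise inverses are again natural and compatible with \<open>reassoc\<close>;
  both follow by cancelling the components of \<open>f\<close> on the left.\<close>

lemma iso_family:
  assumes f: "farr f" and inv: "\<And>V. is_iso (tensor_list (fsrc f) V) (tensor_list (ftgt f) V) (fmor f V)"
  shows "E.iso f"
proof -
  define \<beta> where "\<beta> V = inv_mor (tensor_list (fsrc f) V) (tensor_list (ftgt f) V) (fmor f V)" for V
  note fD = farrD[OF f]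
  have b: "\<beta> V \<in> Hom (tensor_list (ftgt f) V) (tensor_list (fsrc f) V)"
    "\<beta> V \<bullet> fmor f V = ide (tensor_list (fsrc f) V)" "fmor f V \<bullet> \<beta> V = ide (tensor_list (ftgt f) V)" for V
    unfolding \<beta>_def using inv_mor_in_Hom[OF inv] inv_mor_comp[OF inv] comp_inv_mor[OF inv] by auto
  have "module_family (ftgt f) (fsrc f) \<beta>"
    unfolding module_family_def
  proof (intro conjI allI ballI)
    show "\<beta> V \<in> Hom (tensor_list (ftgt f) V) (tensor_list (fsrc f) V)" for V
      by (rule b(1))
    show "\<beta> W \<bullet> whisker (ftgt f) h = whisker (fsrc f) h \<bullet> \<beta> V" if h: "h \<in> Hom V W" for V W h
    proof (rule iso_cancel_left[where X = "tensor_list (ftgt f) V", OF inv])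
      note s = whisker_in_Hom[OF h, of "fsrc f"] and t = whisker_in_Hom[OF h, of "ftgt f"]
      show "fmor f W \<bullet> \<beta> W \<bullet> whisker (ftgt f) h = fmor f W \<bullet> whisker (fsrc f) h \<bullet> \<beta> V"
        using comp_assoc[OF fD(1) b(1) t] b(3) comp_ide_left[OF t] comp_assoc[OF fD(1) s b(1)] fD(2)[OF h]
          comp_assoc[OF t fD(1) b(1)] comp_ide_right[OF t] by simp
    qed (intro comp_in_Hom[OF b(1) whisker_in_Hom[OF h]] comp_in_Hom[OF whisker_in_Hom[OF h] b(1)])+
    show "\<beta> (V \<otimes>\<^sub>o W) \<bullet> reassoc (ftgt f) V W = reassoc (fsrc f) V W \<bullet> (\<beta> V \<otimes>\<^sub>m ide W)" for V W
    proof (rule iso_cancel_left[where X = "tensor_list (ftgt f) V \<otimes>\<^sub>o W", OF inv])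
      let ?R = "reassoc (ftgt f) V W" and ?S = "reassoc (fsrc f) V W"
      note tb = tensor_in_Hom[OF b(1) ide_in_Hom[of W]] and tf = tensor_in_Hom[OF fD(1) ide_in_Hom[of W]]
      have "fmor f (V \<otimes>\<^sub>o W) \<bullet> ?S \<bullet> (\<beta> V \<otimes>\<^sub>m ide W) = ?R \<bullet> ((fmor f V \<otimes>\<^sub>m ide W) \<bullet> (\<beta> V \<otimes>\<^sub>m ide W))"
        by (rule comp_eq_right[OF fD(3) fD(1) reassoc_in_Hom reassoc_in_Hom tf tb])
      also have "(fmor f V \<otimes>\<^sub>m ide W) \<bullet> (\<beta> V \<otimes>\<^sub>m ide W) = ide (tensor_list (ftgt f) V \<otimes>\<^sub>o W)"
        using tensor_comp_left[OF fD(1) b(1)] b(3) tensor_ide by simp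
      finally show "fmor f (V \<otimes>\<^sub>o W) \<bullet> \<beta> (V \<otimes>\<^sub>o W) \<bullet> ?R = fmor f (V \<otimes>\<^sub>o W) \<bullet> ?S \<bullet> (\<beta> V \<otimes>\<^sub>m ide W)"
        using comp_assoc[OF fD(1) b(1) reassoc_in_Hom] b(3) comp_ide_left[OF reassoc_in_Hom]
          comp_ide_right[OF reassoc_in_Hom] by simp
    qed (intro comp_in_Hom[OF b(1) reassoc_in_Hom] comp_in_Hom[OF reassoc_in_Hom tensor_in_Hom[OF b(1) ide_in_Hom]])+
  qed
  then have g: "farr (Family (ftgt f) (fsrc f) \<beta>)"
    by (simp add: farr_Family)
  have "Family (ftgt f) (fsrc f) \<beta> \<odot> f = fone (fsrc f)" "f \<odot> Family (ftgt f) (fsrc f) \<beta> = fone (ftgt f)"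
    using f g b by (intro family_eqI; simp)+
  then show ?thesis
    unfolding E.iso_def using f g by (intro conjI exI[of _ "Family (ftgt f) (fsrc f) \<beta>"]) auto
qed

text \<open>A morphism acts on the first factor of \<open>X \<otimes> V\<close>. With
  \<open>emb_inj\<close> and \<open>emb_full\<close> this identifies the given category with the
  one-element lists.\<close>

definition emb :: "'o \<Rightarrow> 'o \<Rightarrow> 'm \<Rightarrow> ('o, 'm) family" where
  "emb X Y f = Family [X] [Y] (\<lambda>V. f \<otimes>\<^sub>m ide V)"

text \<open>Splits one strand coloured \<open>X \<otimes> Y\<close> into two. That the associators
  form a module transformation is the pentagon axiom.\<close>

definition fuse :: "'o \<Rightarrow> 'o \<Rightarrow> ('o, 'm) family" where
  "fuse X Y = Family [X \<otimes>\<^sub>o Y] [X, Y] (assoc X Y)"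

text \<open>Removes a strand coloured by the unit object. Its module condition is
  \<open>lunit_tensor\<close>, which is not among the axioms and is derived below.\<close>

definition ucap :: "('o, 'm) family" where
  "ucap = Family [\<one>\<^sub>o] [] lunit"

lemma emb_simps [simp]: "fsrc (emb X Y f) = [X]" "ftgt (emb X Y f) = [Y]" "fmor (emb X Y f) V = f \<otimes>\<^sub>m ide V"
  by (simp_all add: emb_def)

lemma fuse_simps [simp]: "fsrc (fuse X Y) = [X \<otimes>\<^sub>o Y]" "ftgt (fuse X Y) = [X, Y]" "fmor (fuse X Y) V = assoc X Y V"
  by (simp_all add: fuse_def)

lemma ucap_simps [simp]: "fsrc ucap = [\<one>\<^sub>o]" "ftgt ucap = []" "fmor ucap V = lunit V"
  by (simp_all add: ucap_def)

lemma farr_emb [simp]: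
  assumes f: "f \<in> Hom X Y"
  shows "farr (emb X Y f)"
proof -
  have "(f \<otimes>\<^sub>m ide (V \<otimes>\<^sub>o W)) \<bullet> reassoc [X] V W = reassoc [Y] V W \<bullet> ((f \<otimes>\<^sub>m ide V) \<otimes>\<^sub>m ide W)" for V W
    using assoc_natural[OF f ide_in_Hom ide_in_Hom, of V W] comp_ide_left[OF assoc_in_Hom] tensor_ide by simp
  then show ?thesis
    unfolding emb_def farr_Family module_family_def
    using tensor_in_Hom[OF f ide_in_Hom] tensor_slide[OF f] by auto
qed

lemma farr_fuse [simp]: "farr (fuse X Y)"
proof -
  have "assoc X Y (V \<otimes>\<^sub>o W) \<bullet> reassoc [X \<otimes>\<^sub>o Y] V W = reassoc [X, Y] V W \<bullet> (assoc X Y V \<otimes>\<^sub>m ide W)" for V W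
    using pentagon[of X Y V W] comp_ide_left[OF assoc_in_Hom] tensor_ide
      comp_assoc[OF tensor_in_Hom[OF ide_in_Hom assoc_in_Hom] assoc_in_Hom tensor_in_Hom[OF assoc_in_Hom ide_in_Hom]]
    by simp
  moreover have "assoc X Y W \<bullet> (ide (X \<otimes>\<^sub>o Y) \<otimes>\<^sub>m h) = (ide X \<otimes>\<^sub>m (ide Y \<otimes>\<^sub>m h)) \<bullet> assoc X Y V"
    if "h \<in> Hom V W" for V W h
    using assoc_natural[OF ide_in_Hom ide_in_Hom that] tensor_ide by simp
  ultimately show ?thesis
    unfolding fuse_def farr_Family module_family_def using assoc_in_Hom by simp
qed

text \<open>Kelly's consequence of pentagon and triangle. Tensored with the unit on the left, both
  sides can be compared by means of the pentagon; the extra unit is then removed by naturality of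
  the isomorphism \<open>lunit\<close>.\<close>

lemma lunit_tensor: "lunit (V \<otimes>\<^sub>o W) \<bullet> assoc \<one>\<^sub>o V W = lunit V \<otimes>\<^sub>m ide W"
proof -
  have l1: "lunit (V \<otimes>\<^sub>o W) \<bullet> assoc \<one>\<^sub>o V W \<in> Hom ((\<one>\<^sub>o \<otimes>\<^sub>o V) \<otimes>\<^sub>o W) (V \<otimes>\<^sub>o W)"
    by (rule comp_in_Hom[OF lunit_in_Hom assoc_in_Hom])
  have l2: "lunit V \<otimes>\<^sub>m ide W \<in> Hom ((\<one>\<^sub>o \<otimes>\<^sub>o V) \<otimes>\<^sub>o W) (V \<otimes>\<^sub>o W)"
    by (rule tensor_in_Hom[OF lunit_in_Hom ide_in_Hom])
  let ?I = "\<one>\<^sub>o"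
  let ?c = "assoc ?I (?I \<otimes>\<^sub>o V) W \<bullet> (assoc ?I ?I V \<otimes>\<^sub>m ide W)"
  note aW = tensor_in_Hom[OF assoc_in_Hom[of ?I ?I V] ide_in_Hom[of W]]
  have c: "is_iso (((?I \<otimes>\<^sub>o ?I) \<otimes>\<^sub>o V) \<otimes>\<^sub>o W) (?I \<otimes>\<^sub>o ((?I \<otimes>\<^sub>o V) \<otimes>\<^sub>o W)) ?c"
    by (rule is_iso_comp[OF is_iso_tensor[OF assoc_iso is_iso_ide] assoc_iso])
  note cH = is_iso_in_Hom[OF c]
  have "(ide ?I \<otimes>\<^sub>m (lunit (V \<otimes>\<^sub>o W) \<bullet> assoc ?I V W)) \<bullet> ?c =
      (ide ?I \<otimes>\<^sub>m lunit (V \<otimes>\<^sub>o W)) \<bullet> ((ide ?I \<otimes>\<^sub>m assoc ?I V W) \<bullet> ?c)"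
    using tensor_comp_right[OF lunit_in_Hom assoc_in_Hom]
      comp_assoc[OF tensor_in_Hom[OF ide_in_Hom lunit_in_Hom] tensor_in_Hom[OF ide_in_Hom assoc_in_Hom] cH] by simp
  also have "(ide ?I \<otimes>\<^sub>m assoc ?I V W) \<bullet> ?c = assoc ?I ?I (V \<otimes>\<^sub>o W) \<bullet> assoc (?I \<otimes>\<^sub>o ?I) V W"
    by (rule pentagon[symmetric])
  also have "(ide ?I \<otimes>\<^sub>m lunit (V \<otimes>\<^sub>o W)) \<bullet> (assoc ?I ?I (V \<otimes>\<^sub>o W) \<bullet> assoc (?I \<otimes>\<^sub>o ?I) V W) =
      (runit ?I \<otimes>\<^sub>m ide (V \<otimes>\<^sub>o W)) \<bullet> assoc (?I \<otimes>\<^sub>o ?I) V W"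
    using comp_assoc[OF tensor_in_Hom[OF ide_in_Hom lunit_in_Hom] assoc_in_Hom assoc_in_Hom] triangle by simp
  also have "\<dots> = assoc ?I V W \<bullet> ((runit ?I \<otimes>\<^sub>m ide V) \<otimes>\<^sub>m ide W)"
    using assoc_natural[OF runit_in_Hom ide_in_Hom ide_in_Hom, of ?I V W] tensor_ide by simp
  also have "(runit ?I \<otimes>\<^sub>m ide V) \<otimes>\<^sub>m ide W = ((ide ?I \<otimes>\<^sub>m lunit V) \<otimes>\<^sub>m ide W) \<bullet> (assoc ?I ?I V \<otimes>\<^sub>m ide W)"
    using triangle[of ?I V] tensor_comp_left[OF tensor_in_Hom[OF ide_in_Hom lunit_in_Hom] assoc_in_Hom] by metis
  also have "assoc ?I V W \<bullet> (((ide ?I \<otimes>\<^sub>m lunit V) \<otimes>\<^sub>m ide W) \<bullet> (assoc ?I ?I V \<otimes>\<^sub>m ide W)) =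
      (ide ?I \<otimes>\<^sub>m (lunit V \<otimes>\<^sub>m ide W)) \<bullet> ?c"
    by (rule comp_eq_right[OF assoc_natural[OF ide_in_Hom lunit_in_Hom ide_in_Hom] assoc_in_Hom
          tensor_in_Hom[OF tensor_in_Hom[OF ide_in_Hom lunit_in_Hom] ide_in_Hom]
          tensor_in_Hom[OF ide_in_Hom l2] assoc_in_Hom aW])
  finally have "ide ?I \<otimes>\<^sub>m (lunit (V \<otimes>\<^sub>o W) \<bullet> assoc ?I V W) = ide ?I \<otimes>\<^sub>m (lunit V \<otimes>\<^sub>m ide W)"
    by (rule iso_cancel_right[OF c tensor_in_Hom[OF ide_in_Hom l1] tensor_in_Hom[OF ide_in_Hom l2]])
  then have "(lunit (V \<otimes>\<^sub>o W) \<bullet> assoc ?I V W) \<bullet> lunit ((?I \<otimes>\<^sub>o V) \<otimes>\<^sub>o W) =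
      (lunit V \<otimes>\<^sub>m ide W) \<bullet> lunit ((?I \<otimes>\<^sub>o V) \<otimes>\<^sub>o W)"
    using lunit_natural[OF l1] lunit_natural[OF l2] by simp
  then show ?thesis
    by (rule iso_cancel_right[OF lunit_iso l1 l2])
qed

lemma farr_ucap [simp]: "farr ucap"
  unfolding ucap_def farr_Family module_family_def
  using lunit_in_Hom lunit_natural lunit_tensor comp_ide_left[OF tensor_in_Hom[OF lunit_in_Hom ide_in_Hom]]
    comp_ide_left[OF assoc_in_Hom] tensor_ide
  by simp

lemma iso_fuse: "E.iso (fuse X Y)"
  by (rule iso_family) (simp_all add: assoc_iso)

lemma iso_ucap: "E.iso ucap"
  by (rule iso_family) (simp_all add: lunit_iso)

lemma emb_comp: "\<lbrakk>g \<in> Hom Y Z; f \<in> Hom X Y\<rbrakk> \<Longrightarrow> emb X Z (g \<bullet> f) = emb Y Z g \<odot> emb X Y f"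
  by (rule family_eqI) (simp_all add: comp_in_Hom tensor_comp_left)

lemma emb_comp4:
  assumes "f1 \<in> Hom X1 X2" "f2 \<in> Hom X2 X3" "f3 \<in> Hom X3 X4" "f4 \<in> Hom X4 X5"
  shows "emb X1 X5 (f4 \<bullet> f3 \<bullet> f2 \<bullet> f1) = emb X4 X5 f4 \<odot> emb X3 X4 f3 \<odot> emb X2 X3 f2 \<odot> emb X1 X2 f1"
  using emb_comp[OF assms(4) comp_in_Hom[OF assms(3) comp_in_Hom[OF assms(2,1)]]]
    emb_comp[OF assms(3) comp_in_Hom[OF assms(2,1)]] emb_comp[OF assms(2,1)] by simp

lemma emb_ide: "emb X X (ide X) = fone [X]"
  by (rule family_eqI) (simp_all add: ide_in_Hom tensor_ide)

lemma iso_emb: "is_iso X Y f \<Longrightarrow> E.iso (emb X Y f)"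
  by (rule iso_family) (simp_all add: is_iso_in_Hom is_iso_tensor is_iso_ide)

text \<open>The component at the unit object already determines the morphism, as
  \<open>runit\<close> is a natural isomorphism.\<close>

lemma emb_inj:
  assumes "f \<in> Hom X Y" "g \<in> Hom X Y" "emb X Y f = emb X Y g"
  shows "f = g"
proof (rule iso_cancel_right[OF runit_iso assms(1,2)])
  have "f \<otimes>\<^sub>m ide \<one>\<^sub>o = g \<otimes>\<^sub>m ide \<one>\<^sub>o"
    using assms(3) by (metis emb_simps(3))
  then show "f \<bullet> runit X = g \<bullet> runit X"
    using runit_natural[OF assms(1)] runit_natural[OF assms(2)] by simp
qed

text \<open>The component at the unit object yields \<open>f\<close>. The component at
  \<open>V\<close> is recovered from it by passing through
  \<open>(X \<otimes> 1) \<otimes> V\<close>, where the module condition applies; naturality alone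
  would not determine it.\<close>

lemma emb_full:
  assumes "farr h" "fsrc h = [X]" "ftgt h = [Y]"
  shows "\<exists>f\<in>Hom X Y. h = emb X Y f"
proof -
  note hD = farrD[OF assms(1), unfolded assms(2,3), simplified]
  let ?I = "\<one>\<^sub>o"
  define f where "f = runit Y \<bullet> (fmor h ?I \<bullet> inv_mor (X \<otimes>\<^sub>o ?I) X (runit X))"
  note ri = inv_mor_in_Hom[OF runit_iso[of X]]
  have f: "f \<in> Hom X Y"
    unfolding f_def by (rule comp_in_Hom[OF runit_in_Hom comp_in_Hom[OF hD(1) ri]])
  have fr: "f \<bullet> runit X = runit Y \<bullet> fmor h ?I"
    unfolding f_def
    using comp_assoc[OF runit_in_Hom comp_in_Hom[OF hD(1) ri] runit_in_Hom]
      comp_assoc[OF hD(1) ri runit_in_Hom] inv_mor_comp[OF runit_iso] comp_ide_right[OF hD(1)] by simp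
  have "fmor h V = f \<otimes>\<^sub>m ide V" for V
  proof (rule iso_cancel_right[OF is_iso_tensor[OF runit_iso is_iso_ide] hD(1) tensor_in_Hom[OF f ide_in_Hom]])
    note l = tensor_in_Hom[OF ide_in_Hom lunit_in_Hom]
    have "fmor h V \<bullet> (runit X \<otimes>\<^sub>m ide V) = fmor h V \<bullet> ((ide X \<otimes>\<^sub>m lunit V) \<bullet> assoc X ?I V)"
      by (simp add: triangle)
    also have "\<dots> = (ide Y \<otimes>\<^sub>m lunit V) \<bullet> (fmor h (?I \<otimes>\<^sub>o V) \<bullet> assoc X ?I V)"
      by (rule comp_eq_right[OF hD(2)[OF lunit_in_Hom] hD(1) l l hD(1) assoc_in_Hom])
    also have "fmor h (?I \<otimes>\<^sub>o V) \<bullet> assoc X ?I V = assoc Y ?I V \<bullet> (fmor h ?I \<otimes>\<^sub>m ide V)"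
      using hD(3)[of ?I V] comp_ide_left[OF assoc_in_Hom] tensor_ide by simp
    also have "(ide Y \<otimes>\<^sub>m lunit V) \<bullet> (assoc Y ?I V \<bullet> (fmor h ?I \<otimes>\<^sub>m ide V)) = (runit Y \<otimes>\<^sub>m ide V) \<bullet> (fmor h ?I \<otimes>\<^sub>m ide V)"
      using comp_assoc[OF l assoc_in_Hom tensor_in_Hom[OF hD(1) ide_in_Hom]] triangle by simp
    also have "\<dots> = (f \<otimes>\<^sub>m ide V) \<bullet> (runit X \<otimes>\<^sub>m ide V)"
      using tensor_comp_left[OF runit_in_Hom hD(1)] tensor_comp_left[OF f runit_in_Hom] fr by simp
    finally show "fmor h V \<bullet> (runit X \<otimes>\<^sub>m ide V) = (f \<otimes>\<^sub>m ide V) \<bullet> (runit X \<otimes>\<^sub>m ide V)" .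
  qed
  then have "h = emb X Y f"
    using assms f by (intro family_eqI) auto
  then show ?thesis
    using f by blast
qed

lemma fuse_natural:
  assumes "f \<in> Hom X X'" "g \<in> Hom Y Y'"
  shows "fuse X' Y' \<odot> emb (X \<otimes>\<^sub>o Y) (X' \<otimes>\<^sub>o Y') (f \<otimes>\<^sub>m g) = (emb X X' f \<boxtimes> emb Y Y' g) \<odot> fuse X Y"
  using assms tensor_in_Hom[OF assms]
  by (intro family_eqI)
     (simp_all add: tensor_slide[OF assms(1) tensor_in_Hom[OF assms(2) ide_in_Hom]] assoc_natural[OF assms ide_in_Hom])

text \<open>The pentagon axiom in terms of strands: the two ways of splitting into three strands
  differ by the associator. The triangle axiom and \<open>lunit_tensor\<close> give the two
  analogues for the unit.\<close>

lemma fuse_assoc: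
  "(fone [X] \<boxtimes> fuse Y Z) \<odot> fuse X (Y \<otimes>\<^sub>o Z) \<odot> emb ((X \<otimes>\<^sub>o Y) \<otimes>\<^sub>o Z) (X \<otimes>\<^sub>o Y \<otimes>\<^sub>o Z) (assoc X Y Z) =
   (fuse X Y \<boxtimes> fone [Z]) \<odot> fuse (X \<otimes>\<^sub>o Y) Z"
proof (rule family_eqI)
  fix V
  have "fmor (fone [X] \<boxtimes> fuse Y Z) V = ide X \<otimes>\<^sub>m assoc Y Z V"
    using comp_ide_left[OF tensor_in_Hom[OF ide_in_Hom assoc_in_Hom]] by simp
  moreover have "fmor (fuse X Y \<boxtimes> fone [Z]) V = assoc X Y (Z \<otimes>\<^sub>o V)"
    using comp_ide_right[OF assoc_in_Hom] tensor_ide by simp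
  ultimately show "fmor ((fone [X] \<boxtimes> fuse Y Z) \<odot> fuse X (Y \<otimes>\<^sub>o Z) \<odot> emb ((X \<otimes>\<^sub>o Y) \<otimes>\<^sub>o Z) (X \<otimes>\<^sub>o Y \<otimes>\<^sub>o Z) (assoc X Y Z)) V =
      fmor ((fuse X Y \<boxtimes> fone [Z]) \<odot> fuse (X \<otimes>\<^sub>o Y) Z) V"
    using pentagon[of X Y Z V] assoc_in_Hom by (simp del: fmor_ftns)
qed (simp_all add: assoc_in_Hom)

lemma fuse_runit: "(fone [X] \<boxtimes> ucap) \<odot> fuse X \<one>\<^sub>o = emb (X \<otimes>\<^sub>o \<one>\<^sub>o) X (runit X)"
proof (rule family_eqI)
  fix V
  have "fmor (fone [X] \<boxtimes> ucap) V = ide X \<otimes>\<^sub>m lunit V"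
    using comp_ide_left[OF tensor_in_Hom[OF ide_in_Hom lunit_in_Hom]] by simp
  then show "fmor ((fone [X] \<boxtimes> ucap) \<odot> fuse X \<one>\<^sub>o) V = fmor (emb (X \<otimes>\<^sub>o \<one>\<^sub>o) X (runit X)) V"
    by (simp add: triangle del: fmor_ftns)
qed (simp_all add: runit_in_Hom)

lemma fuse_lunit: "(ucap \<boxtimes> fone [X]) \<odot> fuse \<one>\<^sub>o X = emb (\<one>\<^sub>o \<otimes>\<^sub>o X) X (lunit X)"
proof (rule family_eqI)
  fix V
  have "fmor (ucap \<boxtimes> fone [X]) V = lunit (X \<otimes>\<^sub>o V)"
    using comp_ide_right[OF lunit_in_Hom] tensor_ide by simp
  then show "fmor ((ucap \<boxtimes> fone [X]) \<odot> fuse \<one>\<^sub>o X) V = fmor (emb (\<one>\<^sub>o \<otimes>\<^sub>o X) X (lunit X)) V"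
    by (simp add: lunit_tensor del: fmor_ftns)
qed (simp_all add: lunit_in_Hom)

definition finv :: "('o, 'm) family \<Rightarrow> ('o, 'm) family" where
  "finv k = (SOME k'. E.hom k' (ftgt k) (fsrc k) \<and> k' \<odot> k = fone (fsrc k) \<and> k \<odot> k' = fone (ftgt k))"

lemma finv:
  assumes "E.iso k"
  shows "farr (finv k)" "fsrc (finv k) = ftgt k" "ftgt (finv k) = fsrc k"
    "finv k \<odot> k = fone (fsrc k)" "k \<odot> finv k = fone (ftgt k)"
proof -
  have "\<exists>k'. E.hom k' (ftgt k) (fsrc k) \<and> k' \<odot> k = fone (fsrc k) \<and> k \<odot> k' = fone (ftgt k)"
    using assms by (auto simp: E.iso_def)
  from someI_ex[OF this] show "farr (finv k)" "fsrc (finv k) = ftgt k" "ftgt (finv k) = fsrc k"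
    "finv k \<odot> k = fone (fsrc k)" "k \<odot> finv k = fone (ftgt k)"
    by (auto simp: finv_def)
qed

lemmas finv_fuse [simp] = finv[OF iso_fuse, unfolded fuse_simps]
lemmas finv_ucap [simp] = finv[OF iso_ucap, unfolded ucap_simps]

lemma assoc_inv_in_Hom: "assoc_inv X Y Z \<in> Hom (X \<otimes>\<^sub>o (Y \<otimes>\<^sub>o Z)) ((X \<otimes>\<^sub>o Y) \<otimes>\<^sub>o Z)"
  unfolding assoc_inv_def by (rule inv_mor_in_Hom[OF assoc_iso])

lemma fuse_assoc_inv:
  "(fuse X Y \<boxtimes> fone [Z]) \<odot> fuse (X \<otimes>\<^sub>o Y) Z \<odot> emb (X \<otimes>\<^sub>o Y \<otimes>\<^sub>o Z) ((X \<otimes>\<^sub>o Y) \<otimes>\<^sub>o Z) (assoc_inv X Y Z) =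
   (fone [X] \<boxtimes> fuse Y Z) \<odot> fuse X (Y \<otimes>\<^sub>o Z)"
proof -
  have "emb ((X \<otimes>\<^sub>o Y) \<otimes>\<^sub>o Z) (X \<otimes>\<^sub>o Y \<otimes>\<^sub>o Z) (assoc X Y Z) \<odot> emb (X \<otimes>\<^sub>o Y \<otimes>\<^sub>o Z) ((X \<otimes>\<^sub>o Y) \<otimes>\<^sub>o Z) (assoc_inv X Y Z) = fone [X \<otimes>\<^sub>o Y \<otimes>\<^sub>o Z]"
    using emb_comp[OF assoc_in_Hom assoc_inv_in_Hom, symmetric] comp_inv_mor[OF assoc_iso] emb_ide
    by (simp add: assoc_inv_def)
  then have "((fone [X] \<boxtimes> fuse Y Z) \<odot> fuse X (Y \<otimes>\<^sub>o Z) \<odot> emb ((X \<otimes>\<^sub>o Y) \<otimes>\<^sub>o Z) (X \<otimes>\<^sub>o Y \<otimes>\<^sub>o Z) (assoc X Y Z)) \<odot>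
      emb (X \<otimes>\<^sub>o Y \<otimes>\<^sub>o Z) ((X \<otimes>\<^sub>o Y) \<otimes>\<^sub>o Z) (assoc_inv X Y Z) = (fone [X] \<boxtimes> fuse Y Z) \<odot> fuse X (Y \<otimes>\<^sub>o Z)"
    by (simp add: E.cmp_assoc)
  then show ?thesis
    unfolding fuse_assoc by (simp add: E.cmp_assoc)
qed

definition eva :: "'o \<Rightarrow> 'o \<Rightarrow> 'm \<Rightarrow> ('o, 'm) family" where
  "eva X Y e = ucap \<odot> emb (Y \<otimes>\<^sub>o X) \<one>\<^sub>o e \<odot> finv (fuse Y X)"

definition coe :: "'o \<Rightarrow> 'o \<Rightarrow> 'm \<Rightarrow> ('o, 'm) family" where
  "coe X Y c = fuse X Y \<odot> emb \<one>\<^sub>o (X \<otimes>\<^sub>o Y) c \<odot> finv ucap"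

text \<open>Each zigzag is tested after precomposition with an isomorphism out of the single strand
  \<open>\<one>\<^sub>o \<otimes>\<^sub>o X\<close> or
  \<open>Y \<otimes>\<^sub>o \<one>\<^sub>o\<close>. Fusing all strands turns it into an embedded
  morphism, to which the identities of \<open>is_left_dual\<close> apply.\<close>

lemma dual_pair_left_dual:
  assumes "is_left_dual X Y e c"
  shows "E.dual_pair [X] [Y] (eva X Y e) (coe X Y c)"
proof -
  let ?c1 = "emb \<one>\<^sub>o (X \<otimes>\<^sub>o Y) c"
  let ?e1 = "emb (Y \<otimes>\<^sub>o X) \<one>\<^sub>o e"
  let ?aX = "emb ((X \<otimes>\<^sub>o Y) \<otimes>\<^sub>o X) (X \<otimes>\<^sub>o Y \<otimes>\<^sub>o X) (assoc X Y X)"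
  let ?cX = "emb (\<one>\<^sub>o \<otimes>\<^sub>o X) ((X \<otimes>\<^sub>o Y) \<otimes>\<^sub>o X) (c \<otimes>\<^sub>m ide X)"
  let ?Xe = "emb (X \<otimes>\<^sub>o Y \<otimes>\<^sub>o X) (X \<otimes>\<^sub>o \<one>\<^sub>o) (ide X \<otimes>\<^sub>m e)"
  let ?aY = "emb (Y \<otimes>\<^sub>o X \<otimes>\<^sub>o Y) ((Y \<otimes>\<^sub>o X) \<otimes>\<^sub>o Y) (assoc_inv Y X Y)"
  let ?Yc = "emb (Y \<otimes>\<^sub>o \<one>\<^sub>o) (Y \<otimes>\<^sub>o X \<otimes>\<^sub>o Y) (ide Y \<otimes>\<^sub>m c)"
  let ?eY = "emb ((Y \<otimes>\<^sub>o X) \<otimes>\<^sub>o Y) (\<one>\<^sub>o \<otimes>\<^sub>o Y) (e \<otimes>\<^sub>m ide Y)"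
  have e [simp]: "e \<in> Hom (Y \<otimes>\<^sub>o X) \<one>\<^sub>o" and c [simp]: "c \<in> Hom \<one>\<^sub>o (X \<otimes>\<^sub>o Y)"
    and z1: "runit X \<bullet> (ide X \<otimes>\<^sub>m e) \<bullet> assoc X Y X \<bullet> (c \<otimes>\<^sub>m ide X) = lunit X"
    and z2: "lunit Y \<bullet> (e \<otimes>\<^sub>m ide Y) \<bullet> assoc_inv Y X Y \<bullet> (ide Y \<otimes>\<^sub>m c) = runit Y"
    using assms by (auto simp: is_left_dual_def)
  let ?e = "eva X Y e" and ?c = "coe X Y c"
  have [simp]: "farr ?e" "fsrc ?e = [Y, X]" "ftgt ?e = []" "farr ?c" "fsrc ?c = []" "ftgt ?c = [X, Y]"
    by (simp_all add: eva_def coe_def)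
  have e_fuse: "?e \<odot> fuse Y X = ucap \<odot> ?e1"
    by (simp add: eva_def E.cmp_assoc)
  have c_ucap: "?c \<odot> ucap = fuse X Y \<odot> ?c1"
    by (simp add: coe_def E.cmp_assoc)
  have Xe [simp]: "ide X \<otimes>\<^sub>m e \<in> Hom (X \<otimes>\<^sub>o Y \<otimes>\<^sub>o X) (X \<otimes>\<^sub>o \<one>\<^sub>o)"
    and cX [simp]: "c \<otimes>\<^sub>m ide X \<in> Hom (\<one>\<^sub>o \<otimes>\<^sub>o X) ((X \<otimes>\<^sub>o Y) \<otimes>\<^sub>o X)"
    and eY [simp]: "e \<otimes>\<^sub>m ide Y \<in> Hom ((Y \<otimes>\<^sub>o X) \<otimes>\<^sub>o Y) (\<one>\<^sub>o \<otimes>\<^sub>o Y)"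
    and Yc [simp]: "ide Y \<otimes>\<^sub>m c \<in> Hom (Y \<otimes>\<^sub>o \<one>\<^sub>o) (Y \<otimes>\<^sub>o X \<otimes>\<^sub>o Y)"
    by (simp_all add: tensor_in_Hom ide_in_Hom)
  have "((fone [X] \<boxtimes> ?e) \<odot> (?c \<boxtimes> fone [X])) \<odot> (ucap \<boxtimes> fone [X]) \<odot> fuse \<one>\<^sub>o X =
      (fone [X] \<boxtimes> ?e) \<odot> (?c \<odot> ucap \<boxtimes> fone [X]) \<odot> fuse \<one>\<^sub>o X"
    by (simp add: E.cmp_assoc E.interchange_cmp)
  also have "(?c \<odot> ucap \<boxtimes> fone [X]) \<odot> fuse \<one>\<^sub>o X =
      (fuse X Y \<boxtimes> fone [X]) \<odot> (?c1 \<boxtimes> fone [X]) \<odot> fuse \<one>\<^sub>o X"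
    by (simp add: c_ucap E.interchange_cmp)
  also have "(?c1 \<boxtimes> fone [X]) \<odot> fuse \<one>\<^sub>o X =
      fuse (X \<otimes>\<^sub>o Y) X \<odot> ?cX"
    using fuse_natural[OF c ide_in_Hom[of X]] by (simp add: emb_ide)
  also have "(fuse X Y \<boxtimes> fone [X]) \<odot> fuse (X \<otimes>\<^sub>o Y) X \<odot> ?cX =
      (fone [X] \<boxtimes> fuse Y X) \<odot> fuse X (Y \<otimes>\<^sub>o X) \<odot> ?aX \<odot>
        ?cX"
    using E.cmp_reassoc[OF fuse_assoc[symmetric]] by (simp add: E.cmp_assoc)
  also have "(fone [X] \<boxtimes> ?e) \<odot> (fone [X] \<boxtimes> fuse Y X) \<odot> fuse X (Y \<otimes>\<^sub>o X) \<odot>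
        ?aX \<odot> ?cX =
      (fone [X] \<boxtimes> ucap) \<odot> ((fone [X] \<boxtimes> ?e1) \<odot> fuse X (Y \<otimes>\<^sub>o X)) \<odot>
        ?aX \<odot> ?cX"
    by (simp add: E.interchange_cmp e_fuse E.cmp_assoc)
  also have "(fone [X] \<boxtimes> ?e1) \<odot> fuse X (Y \<otimes>\<^sub>o X) =
      fuse X \<one>\<^sub>o \<odot> ?Xe"
    using fuse_natural[OF ide_in_Hom[of X] e] by (simp add: emb_ide)
  also have "(fone [X] \<boxtimes> ucap) \<odot> (fuse X \<one>\<^sub>o \<odot> ?Xe) \<odot>
        ?aX \<odot> ?cX =
      emb (\<one>\<^sub>o \<otimes>\<^sub>o X) X (lunit X)"
    unfolding z1[symmetric]
    using E.cmp_reassoc[OF fuse_runit[of X]]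
    by (simp add: E.cmp_assoc emb_comp4[OF cX assoc_in_Hom Xe runit_in_Hom])
  also have "\<dots> = fone [X] \<odot> (ucap \<boxtimes> fone [X]) \<odot> fuse \<one>\<^sub>o X"
    by (simp add: fuse_lunit lunit_in_Hom)
  finally have 1: "(fone [X] \<boxtimes> ?e) \<odot> (?c \<boxtimes> fone [X]) = fone [X]"
    by (rule E.iso_cancel[rotated -1]) (simp_all add: E.iso_cmp E.iso_tns iso_ucap E.iso_one iso_fuse)
  have "((?e \<boxtimes> fone [Y]) \<odot> (fone [Y] \<boxtimes> ?c)) \<odot> (fone [Y] \<boxtimes> ucap) \<odot> fuse Y \<one>\<^sub>o =
      (?e \<boxtimes> fone [Y]) \<odot> (fone [Y] \<boxtimes> ?c \<odot> ucap) \<odot> fuse Y \<one>\<^sub>o"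
    by (simp add: E.cmp_assoc E.interchange_cmp)
  also have "(fone [Y] \<boxtimes> ?c \<odot> ucap) \<odot> fuse Y \<one>\<^sub>o =
      (fone [Y] \<boxtimes> fuse X Y) \<odot> (fone [Y] \<boxtimes> ?c1) \<odot> fuse Y \<one>\<^sub>o"
    by (simp add: c_ucap E.interchange_cmp)
  also have "(fone [Y] \<boxtimes> ?c1) \<odot> fuse Y \<one>\<^sub>o =
      fuse Y (X \<otimes>\<^sub>o Y) \<odot> ?Yc"
    using fuse_natural[OF ide_in_Hom[of Y] c] by (simp add: emb_ide)
  also have "(fone [Y] \<boxtimes> fuse X Y) \<odot> fuse Y (X \<otimes>\<^sub>o Y) \<odot> ?Yc =
      (fuse Y X \<boxtimes> fone [Y]) \<odot> fuse (Y \<otimes>\<^sub>o X) Y \<odot> ?aY \<odot>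
        ?Yc"
    using E.cmp_reassoc[OF fuse_assoc_inv[symmetric]] by (simp add: E.cmp_assoc)
  also have "(?e \<boxtimes> fone [Y]) \<odot> (fuse Y X \<boxtimes> fone [Y]) \<odot> fuse (Y \<otimes>\<^sub>o X) Y \<odot>
        ?aY \<odot> ?Yc =
      (ucap \<boxtimes> fone [Y]) \<odot> ((?e1 \<boxtimes> fone [Y]) \<odot> fuse (Y \<otimes>\<^sub>o X) Y) \<odot>
        ?aY \<odot> ?Yc"
    by (simp add: E.interchange_cmp e_fuse E.cmp_assoc)
  also have "(?e1 \<boxtimes> fone [Y]) \<odot> fuse (Y \<otimes>\<^sub>o X) Y =
      fuse \<one>\<^sub>o Y \<odot> ?eY"
    using fuse_natural[OF e ide_in_Hom[of Y]] by (simp add: emb_ide)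
  also have "(ucap \<boxtimes> fone [Y]) \<odot> (fuse \<one>\<^sub>o Y \<odot> ?eY) \<odot>
        ?aY \<odot> ?Yc =
      emb (Y \<otimes>\<^sub>o \<one>\<^sub>o) Y (runit Y)"
    unfolding z2[symmetric]
    using E.cmp_reassoc[OF fuse_lunit[of Y]]
    by (simp add: E.cmp_assoc emb_comp4[OF Yc assoc_inv_in_Hom eY lunit_in_Hom])
  also have "\<dots> = fone [Y] \<odot> (fone [Y] \<boxtimes> ucap) \<odot> fuse Y \<one>\<^sub>o"
    by (simp add: fuse_runit runit_in_Hom)
  finally have 2: "(?e \<boxtimes> fone [Y]) \<odot> (fone [Y] \<boxtimes> ?c) = fone [Y]"
    by (rule E.iso_cancel[rotated -1]) (simp_all add: E.iso_cmp E.iso_tns iso_ucap E.iso_one iso_fuse)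
  show ?thesis
    unfolding E.dual_pair_def using 1 2 by simp
qed

end

section \<open>Braiding and twist of lists\<close>

context strict_ribbon
begin

text \<open>Frees a loop from the choice of its colour within an isomorphism class and from the
  choice of the dual. The isomorphism passes the double braiding by naturality and meets its inverse
  by cyclicity.\<close>

lemma encircle_iso:
  assumes d: "dual_pair x y e c" and d': "dual_pair x' y' e' c'"
    and k: "hom k x x'" and l: "hom l x' x" "l \<odot> k = one x" "k \<odot> l = one x'"
  shows "ptr v x y e c (B x v \<odot> B v x) = ptr v x' y' e' c' (B x' v \<odot> B v x')"
proof -
  let ?F = "B x' v \<odot> B v x' \<odot> (one v \<boxtimes> k)"
  have nat: "?F = (one v \<boxtimes> k) \<odot> B x v \<odot> B v x"
  proof -
    have "?F = B x' v \<odot> (k \<boxtimes> one v) \<odot> B v x"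
      using B_natural[of "one v" v v k x x'] k by simp
    then show ?thesis
      using cmp_reassoc[OF B_natural[of k x x' "one v" v v], of "B v x"] k by (simp add: cmp_assoc)
  qed
  have "ptr v x y e c ((one v \<boxtimes> l) \<odot> ?F) = ptr v x' y' e' c' (?F \<odot> (one v \<boxtimes> l))"
    using k l by (intro ptr_cyclic[OF d d']) auto
  moreover have "(one v \<boxtimes> l) \<odot> ?F = B x v \<odot> B v x"
    unfolding nat using k l by (simp add: interchange_cmp one_append[symmetric] cmp_assoc)
  moreover have "?F \<odot> (one v \<boxtimes> l) = B x' v \<odot> B v x'"
    using k l by (simp add: interchange one_append[symmetric] cmp_assoc)
  ultimately show ?thesis
    by simp
qed

end

context linear_monoidal_category
begin

text \<open>The isomorphism from the right-nested tensor product of \<open>Xs\<close>, closed with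
  the unit object, to the list \<open>Xs\<close>. It transports structure given on objects to
  lists.\<close>

primrec pack :: "'o list \<Rightarrow> ('o, 'm) family" where
  "pack [] = ucap"
| "pack (X # Xs) = (fone [X] \<boxtimes> pack Xs) \<odot> fuse X (tensor_list Xs \<one>\<^sub>o)"

lemma pack_hom [simp]: "farr (pack Xs)" "fsrc (pack Xs) = [tensor_list Xs \<one>\<^sub>o]" "ftgt (pack Xs) = Xs"
proof -
  have "farr (pack Xs) \<and> fsrc (pack Xs) = [tensor_list Xs \<one>\<^sub>o] \<and> ftgt (pack Xs) = Xs"
    by (induction Xs) auto
  then show "farr (pack Xs)" "fsrc (pack Xs) = [tensor_list Xs \<one>\<^sub>o]" "ftgt (pack Xs) = Xs"
    by auto
qed

lemma iso_pack: "E.iso (pack Xs)"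
  by (induction Xs) (auto intro!: iso_ucap E.iso_cmp E.iso_tns E.iso_one iso_fuse)

lemmas finv_pack [simp] = finv[OF iso_pack, unfolded pack_hom]

lemma iso_finv: "E.iso k \<Longrightarrow> E.iso (finv k)"
  using finv[of k] by (auto simp: E.iso_def[of "finv k"] intro!: exI[of _ k]) (simp add: E.iso_def)

end

section \<open>Transport of the braiding and the twist to the strictification\<close>

context ribbon_fusion_category
begin

lemma braid_in_Hom: "braid X Y \<in> Hom (X \<otimes>\<^sub>o Y) (Y \<otimes>\<^sub>o X)"
  by (rule is_iso_in_Hom[OF braid_iso])

lemma twist_in_Hom: "twist X \<in> Hom X X"
  by (rule is_iso_in_Hom[OF twist_iso])

definition fbraid :: "'o \<Rightarrow> 'o \<Rightarrow> ('o, 'm) family" where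
  "fbraid X Y = fuse Y X \<odot> emb (X \<otimes>\<^sub>o Y) (Y \<otimes>\<^sub>o X) (braid X Y) \<odot> finv (fuse X Y)"

lemma fbraid_hom [simp]: "farr (fbraid X Y)" "fsrc (fbraid X Y) = [X, Y]" "ftgt (fbraid X Y) = [Y, X]"
  by (simp_all add: fbraid_def braid_in_Hom)

lemma iso_fbraid: "E.iso (fbraid X Y)"
  unfolding fbraid_def
  by (auto intro!: E.iso_cmp iso_fuse iso_emb braid_iso iso_finv simp: braid_in_Hom)

lemma fbraid_fuse: "fbraid X Y \<odot> fuse X Y = fuse Y X \<odot> emb (X \<otimes>\<^sub>o Y) (Y \<otimes>\<^sub>o X) (braid X Y)"
  by (simp add: fbraid_def E.cmp_assoc braid_in_Hom)

lemma fbraid_natural: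
  assumes f [simp]: "f \<in> Hom X X'" and g [simp]: "g \<in> Hom Y Y'"
  shows "fbraid X' Y' \<odot> (emb X X' f \<boxtimes> emb Y Y' g) = (emb Y Y' g \<boxtimes> emb X X' f) \<odot> fbraid X Y"
proof (rule E.iso_cancel[OF iso_fuse[of X Y]])
  note [simp] = braid_in_Hom tensor_in_Hom
  have "(fbraid X' Y' \<odot> (emb X X' f \<boxtimes> emb Y Y' g)) \<odot> fuse X Y =
      fbraid X' Y' \<odot> fuse X' Y' \<odot> emb (X \<otimes>\<^sub>o Y) (X' \<otimes>\<^sub>o Y') (f \<otimes>\<^sub>m g)"
    by (simp add: E.cmp_assoc fuse_natural)
  also have "\<dots> = fuse Y' X' \<odot> emb (X \<otimes>\<^sub>o Y) (Y' \<otimes>\<^sub>o X') (braid X' Y' \<bullet> (f \<otimes>\<^sub>m g))"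
    using E.cmp_reassoc[OF fbraid_fuse] emb_comp[OF braid_in_Hom tensor_in_Hom[OF f g]] by (simp add: E.cmp_assoc)
  also have "\<dots> = (fuse Y' X' \<odot> emb (Y \<otimes>\<^sub>o X) (Y' \<otimes>\<^sub>o X') (g \<otimes>\<^sub>m f)) \<odot> emb (X \<otimes>\<^sub>o Y) (Y \<otimes>\<^sub>o X) (braid X Y)"
    using emb_comp[OF tensor_in_Hom[OF g f] braid_in_Hom] by (simp add: E.cmp_assoc braid_natural[OF f g])
  also have "\<dots> = ((emb Y Y' g \<boxtimes> emb X X' f) \<odot> fbraid X Y) \<odot> fuse X Y"
    by (simp add: fuse_natural[OF g f] E.cmp_assoc fbraid_fuse)
  finally show "(fbraid X' Y' \<odot> (emb X X' f \<boxtimes> emb Y Y' g)) \<odot> fuse X Y = ((emb Y Y' g \<boxtimes> emb X X' f) \<odot> fbraid X Y) \<odot> fuse X Y" .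
qed simp_all

lemma emb_comp3:
  assumes "f1 \<in> Hom X1 X2" "f2 \<in> Hom X2 X3" "f3 \<in> Hom X3 X4"
  shows "emb X1 X4 (f3 \<bullet> f2 \<bullet> f1) = emb X3 X4 f3 \<odot> emb X2 X3 f2 \<odot> emb X1 X2 f1"
  using emb_comp[OF assms(3) comp_in_Hom[OF assms(2,1)]] emb_comp[OF assms(2,1)] by simp

text \<open>Precomposition with an isomorphism out of the strand
  \<open>(X \<otimes> Y) \<otimes> Z\<close> makes the hexagon axiom applicable; its associators are
  absorbed by \<open>fuse_assoc\<close>.\<close>

lemma fbraid_hexagon1:
  "(fuse Y Z \<boxtimes> fone [X]) \<odot> fbraid X (Y \<otimes>\<^sub>o Z) =
   (fone [Y] \<boxtimes> fbraid X Z) \<odot> (fbraid X Y \<boxtimes> fone [Z]) \<odot> (fone [X] \<boxtimes> fuse Y Z)"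
proof (rule E.iso_cancel[where k = "fuse X (Y \<otimes>\<^sub>o Z) \<odot> emb ((X \<otimes>\<^sub>o Y) \<otimes>\<^sub>o Z) (X \<otimes>\<^sub>o Y \<otimes>\<^sub>o Z) (assoc X Y Z)"])
  let ?k = "fuse X (Y \<otimes>\<^sub>o Z) \<odot> emb ((X \<otimes>\<^sub>o Y) \<otimes>\<^sub>o Z) (X \<otimes>\<^sub>o Y \<otimes>\<^sub>o Z) (assoc X Y Z)"
  let ?a2 = "emb ((Y \<otimes>\<^sub>o X) \<otimes>\<^sub>o Z) (Y \<otimes>\<^sub>o X \<otimes>\<^sub>o Z) (assoc Y X Z)"
  let ?b = "emb ((X \<otimes>\<^sub>o Y) \<otimes>\<^sub>o Z) ((Y \<otimes>\<^sub>o X) \<otimes>\<^sub>o Z) (braid X Y \<otimes>\<^sub>m ide Z)"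
  let ?b2 = "emb (Y \<otimes>\<^sub>o X \<otimes>\<^sub>o Z) (Y \<otimes>\<^sub>o Z \<otimes>\<^sub>o X) (ide Y \<otimes>\<^sub>m braid X Z)"
  let ?b3 = "emb (X \<otimes>\<^sub>o Z) (Z \<otimes>\<^sub>o X) (braid X Z)"
  let ?L = "(fuse Y Z \<boxtimes> fone [X]) \<odot> fbraid X (Y \<otimes>\<^sub>o Z)"
  let ?R = "(fone [Y] \<boxtimes> fbraid X Z) \<odot> (fbraid X Y \<boxtimes> fone [Z]) \<odot> (fone [X] \<boxtimes> fuse Y Z)"
  note [simp] = braid_in_Hom tensor_in_Hom assoc_in_Hom ide_in_Hom
  have bZ: "braid X Y \<otimes>\<^sub>m ide Z \<in> Hom ((X \<otimes>\<^sub>o Y) \<otimes>\<^sub>o Z) ((Y \<otimes>\<^sub>o X) \<otimes>\<^sub>o Z)"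
    and Yb: "ide Y \<otimes>\<^sub>m braid X Z \<in> Hom (Y \<otimes>\<^sub>o X \<otimes>\<^sub>o Z) (Y \<otimes>\<^sub>o Z \<otimes>\<^sub>o X)"
    by (simp_all add: tensor_in_Hom ide_in_Hom)
  note [simp] = this
  show "E.iso (?k)"
    by (intro E.iso_cmp iso_emb assoc_iso iso_fuse) simp
  have "(?L) \<odot> ?k =
      (fuse Y Z \<boxtimes> fone [X]) \<odot> fuse (Y \<otimes>\<^sub>o Z) X \<odot> emb (X \<otimes>\<^sub>o Y \<otimes>\<^sub>o Z) ((Y \<otimes>\<^sub>o Z) \<otimes>\<^sub>o X) (braid X (Y \<otimes>\<^sub>o Z)) \<odot>
        emb ((X \<otimes>\<^sub>o Y) \<otimes>\<^sub>o Z) (X \<otimes>\<^sub>o Y \<otimes>\<^sub>o Z) (assoc X Y Z)"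
    using E.cmp_reassoc[OF fbraid_fuse] by (simp add: E.cmp_assoc)
  also have "\<dots> = (fone [Y] \<boxtimes> fuse Z X) \<odot> fuse Y (Z \<otimes>\<^sub>o X) \<odot>
      emb ((X \<otimes>\<^sub>o Y) \<otimes>\<^sub>o Z) (Y \<otimes>\<^sub>o Z \<otimes>\<^sub>o X) (assoc Y Z X \<bullet> braid X (Y \<otimes>\<^sub>o Z) \<bullet> assoc X Y Z)"
    using E.cmp_reassoc[OF fuse_assoc[of Y Z X, symmetric]]
    by (simp add: E.cmp_assoc emb_comp3[OF assoc_in_Hom braid_in_Hom assoc_in_Hom])
  also have "\<dots> = (fone [Y] \<boxtimes> fuse Z X) \<odot> (fuse Y (Z \<otimes>\<^sub>o X) \<odot> ?b2) \<odot>
      ?a2 \<odot> ?b"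
    unfolding hexagon1 by (simp add: E.cmp_assoc emb_comp3[OF bZ assoc_in_Hom Yb])
  also have "fuse Y (Z \<otimes>\<^sub>o X) \<odot> ?b2 =
      (fone [Y] \<boxtimes> ?b3) \<odot> fuse Y (X \<otimes>\<^sub>o Z)"
    using fuse_natural[OF ide_in_Hom[of Y] braid_in_Hom] by (simp add: emb_ide)
  also have "(fone [Y] \<boxtimes> fuse Z X) \<odot> ((fone [Y] \<boxtimes> ?b3) \<odot> fuse Y (X \<otimes>\<^sub>o Z)) \<odot>
      ?a2 \<odot> ?b =
      (fone [Y] \<boxtimes> fbraid X Z) \<odot> ((fone [Y] \<boxtimes> fuse X Z) \<odot> fuse Y (X \<otimes>\<^sub>o Z) \<odot>
      ?a2) \<odot> ?b"
    by (simp add: E.cmp_assoc E.interchange_cmp fbraid_fuse)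
  also have "(fone [Y] \<boxtimes> fuse X Z) \<odot> fuse Y (X \<otimes>\<^sub>o Z) \<odot> ?a2 =
      (fuse Y X \<boxtimes> fone [Z]) \<odot> fuse (Y \<otimes>\<^sub>o X) Z"
    by (rule fuse_assoc)
  also have "(fone [Y] \<boxtimes> fbraid X Z) \<odot> ((fuse Y X \<boxtimes> fone [Z]) \<odot> fuse (Y \<otimes>\<^sub>o X) Z) \<odot> ?b =
      (fone [Y] \<boxtimes> fbraid X Z) \<odot> (fuse Y X \<boxtimes> fone [Z]) \<odot> (emb (X \<otimes>\<^sub>o Y) (Y \<otimes>\<^sub>o X) (braid X Y) \<boxtimes> fone [Z]) \<odot> fuse (X \<otimes>\<^sub>o Y) Z"
    using fuse_natural[OF braid_in_Hom[of X Y] ide_in_Hom[of Z]] by (simp add: emb_ide E.cmp_assoc)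
  also have "\<dots> = (fone [Y] \<boxtimes> fbraid X Z) \<odot> (fbraid X Y \<boxtimes> fone [Z]) \<odot> (fuse X Y \<boxtimes> fone [Z]) \<odot> fuse (X \<otimes>\<^sub>o Y) Z"
    by (simp add: E.interchange_cmp fbraid_fuse)
  also have "\<dots> = (?R) \<odot>
      ?k"
    by (simp add: E.cmp_assoc fuse_assoc)
  finally show "(?L) \<odot> ?k =
      (?R) \<odot>
      ?k" .
qed (simp_all add: assoc_in_Hom)

text \<open>The same method with inverse associators, which \<open>fuse_assoc_inv\<close>
  absorbs.\<close>

lemma fbraid_hexagon2:
  "(fone [Z] \<boxtimes> fuse X Y) \<odot> fbraid (X \<otimes>\<^sub>o Y) Z =
   (fbraid X Z \<boxtimes> fone [Y]) \<odot> (fone [X] \<boxtimes> fbraid Y Z) \<odot> (fuse X Y \<boxtimes> fone [Z])"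
proof (rule E.iso_cancel[where k = "fuse (X \<otimes>\<^sub>o Y) Z \<odot> emb (X \<otimes>\<^sub>o Y \<otimes>\<^sub>o Z) ((X \<otimes>\<^sub>o Y) \<otimes>\<^sub>o Z) (assoc_inv X Y Z)"])
  let ?k = "fuse (X \<otimes>\<^sub>o Y) Z \<odot> emb (X \<otimes>\<^sub>o Y \<otimes>\<^sub>o Z) ((X \<otimes>\<^sub>o Y) \<otimes>\<^sub>o Z) (assoc_inv X Y Z)"
  let ?a2 = "emb (X \<otimes>\<^sub>o Z \<otimes>\<^sub>o Y) ((X \<otimes>\<^sub>o Z) \<otimes>\<^sub>o Y) (assoc_inv X Z Y)"
  let ?b = "emb (X \<otimes>\<^sub>o Y \<otimes>\<^sub>o Z) (X \<otimes>\<^sub>o Z \<otimes>\<^sub>o Y) (ide X \<otimes>\<^sub>m braid Y Z)"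
  let ?b2 = "emb ((X \<otimes>\<^sub>o Z) \<otimes>\<^sub>o Y) ((Z \<otimes>\<^sub>o X) \<otimes>\<^sub>o Y) (braid X Z \<otimes>\<^sub>m ide Y)"
  let ?b3 = "emb (X \<otimes>\<^sub>o Z) (Z \<otimes>\<^sub>o X) (braid X Z)"
  let ?L = "(fone [Z] \<boxtimes> fuse X Y) \<odot> fbraid (X \<otimes>\<^sub>o Y) Z"
  let ?R = "(fbraid X Z \<boxtimes> fone [Y]) \<odot> (fone [X] \<boxtimes> fbraid Y Z) \<odot> (fuse X Y \<boxtimes> fone [Z])"
  note [simp] = braid_in_Hom tensor_in_Hom assoc_inv_in_Hom ide_in_Hom
  have bY: "braid X Z \<otimes>\<^sub>m ide Y \<in> Hom ((X \<otimes>\<^sub>o Z) \<otimes>\<^sub>o Y) ((Z \<otimes>\<^sub>o X) \<otimes>\<^sub>o Y)"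
    and Xb: "ide X \<otimes>\<^sub>m braid Y Z \<in> Hom (X \<otimes>\<^sub>o Y \<otimes>\<^sub>o Z) (X \<otimes>\<^sub>o Z \<otimes>\<^sub>o Y)"
    by (simp_all add: tensor_in_Hom ide_in_Hom)
  note [simp] = this
  have "is_iso (X \<otimes>\<^sub>o Y \<otimes>\<^sub>o Z) ((X \<otimes>\<^sub>o Y) \<otimes>\<^sub>o Z) (assoc_inv X Y Z)"
    unfolding is_iso_def assoc_inv_def using inverses_sym[OF inv_mor_inverses[OF assoc_iso]] by blast
  then show "E.iso (?k)"
    by (intro E.iso_cmp iso_emb iso_fuse) simp_all
  have "(?L) \<odot> ?k =
      (fone [Z] \<boxtimes> fuse X Y) \<odot> fuse Z (X \<otimes>\<^sub>o Y) \<odot> emb ((X \<otimes>\<^sub>o Y) \<otimes>\<^sub>o Z) (Z \<otimes>\<^sub>o X \<otimes>\<^sub>o Y) (braid (X \<otimes>\<^sub>o Y) Z) \<odot>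
        emb (X \<otimes>\<^sub>o Y \<otimes>\<^sub>o Z) ((X \<otimes>\<^sub>o Y) \<otimes>\<^sub>o Z) (assoc_inv X Y Z)"
    using E.cmp_reassoc[OF fbraid_fuse] by (simp add: E.cmp_assoc)
  also have "\<dots> = (fuse Z X \<boxtimes> fone [Y]) \<odot> fuse (Z \<otimes>\<^sub>o X) Y \<odot>
      emb (X \<otimes>\<^sub>o Y \<otimes>\<^sub>o Z) ((Z \<otimes>\<^sub>o X) \<otimes>\<^sub>o Y) (assoc_inv Z X Y \<bullet> braid (X \<otimes>\<^sub>o Y) Z \<bullet> assoc_inv X Y Z)"
    using E.cmp_reassoc[OF fuse_assoc_inv[of Z X Y, symmetric]]
    by (simp add: E.cmp_assoc emb_comp3[OF assoc_inv_in_Hom braid_in_Hom assoc_inv_in_Hom])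
  also have "\<dots> = (fuse Z X \<boxtimes> fone [Y]) \<odot> (fuse (Z \<otimes>\<^sub>o X) Y \<odot> ?b2) \<odot>
      ?a2 \<odot> ?b"
    unfolding hexagon2 by (simp add: E.cmp_assoc emb_comp3[OF Xb assoc_inv_in_Hom bY])
  also have "fuse (Z \<otimes>\<^sub>o X) Y \<odot> ?b2 =
      (?b3 \<boxtimes> fone [Y]) \<odot> fuse (X \<otimes>\<^sub>o Z) Y"
    using fuse_natural[OF braid_in_Hom ide_in_Hom[of Y]] by (simp add: emb_ide)
  also have "(fuse Z X \<boxtimes> fone [Y]) \<odot> ((?b3 \<boxtimes> fone [Y]) \<odot> fuse (X \<otimes>\<^sub>o Z) Y) \<odot>
      ?a2 \<odot> ?b =
      (fbraid X Z \<boxtimes> fone [Y]) \<odot> ((fuse X Z \<boxtimes> fone [Y]) \<odot> fuse (X \<otimes>\<^sub>o Z) Y \<odot>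
      ?a2) \<odot> ?b"
    by (simp add: E.cmp_assoc E.interchange_cmp fbraid_fuse)
  also have "(fuse X Z \<boxtimes> fone [Y]) \<odot> fuse (X \<otimes>\<^sub>o Z) Y \<odot> ?a2 =
      (fone [X] \<boxtimes> fuse Z Y) \<odot> fuse X (Z \<otimes>\<^sub>o Y)"
    by (rule fuse_assoc_inv)
  also have "(fbraid X Z \<boxtimes> fone [Y]) \<odot> ((fone [X] \<boxtimes> fuse Z Y) \<odot> fuse X (Z \<otimes>\<^sub>o Y)) \<odot> ?b =
      (fbraid X Z \<boxtimes> fone [Y]) \<odot> (fone [X] \<boxtimes> fuse Z Y) \<odot> (fone [X] \<boxtimes> emb (Y \<otimes>\<^sub>o Z) (Z \<otimes>\<^sub>o Y) (braid Y Z)) \<odot> fuse X (Y \<otimes>\<^sub>o Z)"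
    using fuse_natural[OF ide_in_Hom[of X] braid_in_Hom[of Y Z]] by (simp add: emb_ide E.cmp_assoc)
  also have "\<dots> = (fbraid X Z \<boxtimes> fone [Y]) \<odot> (fone [X] \<boxtimes> fbraid Y Z) \<odot> (fone [X] \<boxtimes> fuse Y Z) \<odot> fuse X (Y \<otimes>\<^sub>o Z)"
    by (simp add: E.interchange_cmp fbraid_fuse)
  also have "\<dots> = (?R) \<odot>
      ?k"
    by (simp add: E.cmp_assoc fuse_assoc_inv)
  finally show "(?L) \<odot> ?k =
      (?R) \<odot>
      ?k" .
qed (simp_all add: assoc_inv_in_Hom)

definition FB :: "'o list \<Rightarrow> 'o list \<Rightarrow> ('o, 'm) family" where
  "FB Xs Ys = (pack Ys \<boxtimes> pack Xs) \<odot> fbraid (tensor_list Xs \<one>\<^sub>o) (tensor_list Ys \<one>\<^sub>o) \<odot> (finv (pack Xs) \<boxtimes> finv (pack Ys))"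

definition FT :: "'o list \<Rightarrow> ('o, 'm) family" where
  "FT Xs = pack Xs \<odot> emb (tensor_list Xs \<one>\<^sub>o) (tensor_list Xs \<one>\<^sub>o) (twist (tensor_list Xs \<one>\<^sub>o)) \<odot> finv (pack Xs)"

lemma FB_hom [simp]: "farr (FB Xs Ys)" "fsrc (FB Xs Ys) = Xs @ Ys" "ftgt (FB Xs Ys) = Ys @ Xs"
  by (simp_all add: FB_def)

lemma FT_hom [simp]: "farr (FT Xs)" "fsrc (FT Xs) = Xs" "ftgt (FT Xs) = Xs"
  by (simp_all add: FT_def twist_in_Hom)

text \<open>By fullness, any morphism from one strand to \<open>Xs\<close> factors through
  \<open>pack Xs\<close> by a morphism of the given category.\<close>

lemma through_pack:
  assumes "E.hom k [X] Xs"
  obtains f where "f \<in> Hom X (tensor_list Xs \<one>\<^sub>o)" "finv (pack Xs) \<odot> k = emb X (tensor_list Xs \<one>\<^sub>o) f"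
    "pack Xs \<odot> emb X (tensor_list Xs \<one>\<^sub>o) f = k"
proof -
  obtain f where f: "f \<in> Hom X (tensor_list Xs \<one>\<^sub>o)" "finv (pack Xs) \<odot> k = emb X (tensor_list Xs \<one>\<^sub>o) f"
    using emb_full[of "finv (pack Xs) \<odot> k" X "tensor_list Xs \<one>\<^sub>o"] assms by auto
  moreover have "pack Xs \<odot> finv (pack Xs) \<odot> k = k"
    using assms by (simp add: E.cmp_assoc[symmetric])
  ultimately show ?thesis
    using that by simp
qed

text \<open>The braiding and the twist of lists do not depend on the way the lists are packed into one
  object.\<close>

lemma FB_pack:
  assumes k: "E.hom k [X] Xs" and l: "E.hom l [Y] Ys"
  shows "FB Xs Ys \<odot> (k \<boxtimes> l) = (l \<boxtimes> k) \<odot> fbraid X Y"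
proof -
  obtain f where f: "f \<in> Hom X (tensor_list Xs \<one>\<^sub>o)" "finv (pack Xs) \<odot> k = emb X (tensor_list Xs \<one>\<^sub>o) f"
    "pack Xs \<odot> emb X (tensor_list Xs \<one>\<^sub>o) f = k"
    by (rule through_pack[OF k])
  obtain g where g: "g \<in> Hom Y (tensor_list Ys \<one>\<^sub>o)" "finv (pack Ys) \<odot> l = emb Y (tensor_list Ys \<one>\<^sub>o) g"
    "pack Ys \<odot> emb Y (tensor_list Ys \<one>\<^sub>o) g = l"
    by (rule through_pack[OF l])
  have "FB Xs Ys \<odot> (k \<boxtimes> l) = (pack Ys \<boxtimes> pack Xs) \<odot> fbraid (tensor_list Xs \<one>\<^sub>o) (tensor_list Ys \<one>\<^sub>o) \<odot>
      (emb X (tensor_list Xs \<one>\<^sub>o) f \<boxtimes> emb Y (tensor_list Ys \<one>\<^sub>o) g)"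
    using k l f g by (simp add: FB_def E.cmp_assoc E.interchange)
  also have "\<dots> = (l \<boxtimes> k) \<odot> fbraid X Y"
    using k l f g by (simp add: fbraid_natural E.interchange_cmp)
  finally show ?thesis .
qed

lemma FT_pack:
  assumes k: "E.hom k [X] Xs"
  shows "FT Xs \<odot> k = k \<odot> emb X X (twist X)"
proof -
  obtain f where f: "f \<in> Hom X (tensor_list Xs \<one>\<^sub>o)" "finv (pack Xs) \<odot> k = emb X (tensor_list Xs \<one>\<^sub>o) f"
    "pack Xs \<odot> emb X (tensor_list Xs \<one>\<^sub>o) f = k"
    by (rule through_pack[OF k])
  let ?T = "tensor_list Xs \<one>\<^sub>o"
  have "FT Xs \<odot> k = pack Xs \<odot> emb ?T ?T (twist ?T) \<odot> emb X ?T f"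
    using f by (simp add: FT_def E.cmp_assoc)
  also have "emb ?T ?T (twist ?T) \<odot> emb X ?T f = emb X ?T f \<odot> emb X X (twist X)"
    using emb_comp[OF twist_in_Hom f(1)] emb_comp[OF f(1) twist_in_Hom] twist_natural[OF f(1)] by simp
  finally show ?thesis
    using E.cmp_reassoc[OF f(3)] by simp
qed

lemma FB_single: "FB [X] [Y] = fbraid X Y"
  using FB_pack[of "fone [X]" X "[X]" "fone [Y]" Y "[Y]"] by (simp add: E.one_append[symmetric])

lemma FT_single: "FT [X] = emb X X (twist X)"
  using FT_pack[of "fone [X]" X "[X]"] by (simp add: twist_in_Hom)

lemma FB_natural:
  assumes f: "E.hom f Xs Xs'" and g: "E.hom g Ys Ys'"
  shows "FB Xs' Ys' \<odot> (f \<boxtimes> g) = (g \<boxtimes> f) \<odot> FB Xs Ys"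
proof (rule E.iso_cancel[OF E.iso_tns[OF iso_pack[of Xs] iso_pack[of Ys]]])
  have "(FB Xs' Ys' \<odot> (f \<boxtimes> g)) \<odot> (pack Xs \<boxtimes> pack Ys) = FB Xs' Ys' \<odot> (f \<odot> pack Xs \<boxtimes> g \<odot> pack Ys)"
    using f g by (simp add: E.cmp_assoc E.interchange)
  also have "\<dots> = (g \<odot> pack Ys \<boxtimes> f \<odot> pack Xs) \<odot> fbraid (tensor_list Xs \<one>\<^sub>o) (tensor_list Ys \<one>\<^sub>o)"
    using f g by (intro FB_pack) auto
  also have "\<dots> = (g \<boxtimes> f) \<odot> (pack Ys \<boxtimes> pack Xs) \<odot> fbraid (tensor_list Xs \<one>\<^sub>o) (tensor_list Ys \<one>\<^sub>o)"
    using f g by (simp add: E.interchange_cmp)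
  also have "(pack Ys \<boxtimes> pack Xs) \<odot> fbraid (tensor_list Xs \<one>\<^sub>o) (tensor_list Ys \<one>\<^sub>o) = FB Xs Ys \<odot> (pack Xs \<boxtimes> pack Ys)"
    by (rule FB_pack[symmetric]) auto
  finally show "(FB Xs' Ys' \<odot> (f \<boxtimes> g)) \<odot> (pack Xs \<boxtimes> pack Ys) = ((g \<boxtimes> f) \<odot> FB Xs Ys) \<odot> (pack Xs \<boxtimes> pack Ys)"
    by (simp add: E.cmp_assoc)
qed (use f g in auto)

lemma FT_natural:
  assumes f: "E.hom f Xs Ys"
  shows "FT Ys \<odot> f = f \<odot> FT Xs"
proof (rule E.iso_cancel[OF iso_pack[of Xs]])
  have "FT Ys \<odot> f \<odot> pack Xs = (f \<odot> pack Xs) \<odot> emb (tensor_list Xs \<one>\<^sub>o) (tensor_list Xs \<one>\<^sub>o) (twist (tensor_list Xs \<one>\<^sub>o))"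
    using f by (intro FT_pack) auto
  also have "\<dots> = f \<odot> FT Xs \<odot> pack Xs"
    using FT_pack[of "pack Xs" "tensor_list Xs \<one>\<^sub>o" Xs] by (simp add: E.cmp_assoc)
  finally show "(FT Ys \<odot> f) \<odot> pack Xs = (f \<odot> FT Xs) \<odot> pack Xs"
    by (simp add: E.cmp_assoc)
qed (use f in auto)

lemma iso_FB: "E.iso (FB Xs Ys)"
  unfolding FB_def
  by (auto intro!: E.iso_cmp E.iso_tns iso_pack iso_finv iso_fbraid)

text \<open>The packing of \<open>Ys @ Zs\<close> is not the tensor product of the two packed
  objects, but \<open>FB_pack\<close> allows the list to be presented by that tensor product. There
  \<open>fbraid_hexagon1\<close> splits the braiding.\<close>

lemma FB_append_right: "FB Xs (Ys @ Zs) = (fone Ys \<boxtimes> FB Xs Zs) \<odot> (FB Xs Ys \<boxtimes> fone Zs)"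
proof (rule E.iso_cancel[where k = "(pack Xs \<boxtimes> pack Ys \<boxtimes> pack Zs) \<odot> (fone [tensor_list Xs \<one>\<^sub>o] \<boxtimes> fuse (tensor_list Ys \<one>\<^sub>o) (tensor_list Zs \<one>\<^sub>o))"])
  let ?X = "tensor_list Xs \<one>\<^sub>o" and ?Y = "tensor_list Ys \<one>\<^sub>o" and ?Z = "tensor_list Zs \<one>\<^sub>o"
  let ?k = "pack Xs" and ?l = "pack Ys" and ?m = "pack Zs"
  let ?K = "(?k \<boxtimes> ?l \<boxtimes> ?m) \<odot> (fone [?X] \<boxtimes> fuse ?Y ?Z)"
  show "E.iso (?K)"
    by (intro E.iso_cmp E.iso_tns iso_pack iso_fuse E.iso_one) simp
  have "FB Xs (Ys @ Zs) \<odot> ?K =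
      FB Xs (Ys @ Zs) \<odot> (?k \<boxtimes> (?l \<boxtimes> ?m) \<odot> fuse ?Y ?Z)"
    by (simp add: E.interchange)
  also have "\<dots> = ((?l \<boxtimes> ?m) \<odot> fuse ?Y ?Z \<boxtimes> ?k) \<odot> fbraid ?X (?Y \<otimes>\<^sub>o ?Z)"
    by (rule FB_pack) auto
  also have "(?l \<boxtimes> ?m) \<odot> fuse ?Y ?Z \<boxtimes> ?k = ((?l \<boxtimes> ?m) \<boxtimes> ?k) \<odot> (fuse ?Y ?Z \<boxtimes> fone [?X])"
    by (subst E.interchange) auto
  also have "(((?l \<boxtimes> ?m) \<boxtimes> ?k) \<odot> (fuse ?Y ?Z \<boxtimes> fone [?X])) \<odot> fbraid ?X (?Y \<otimes>\<^sub>o ?Z) =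
      (?l \<boxtimes> ?m \<boxtimes> ?k) \<odot> (fone [?Y] \<boxtimes> fbraid ?X ?Z) \<odot> (fbraid ?X ?Y \<boxtimes> fone [?Z]) \<odot> (fone [?X] \<boxtimes> fuse ?Y ?Z)"
    by (simp add: E.cmp_assoc fbraid_hexagon1 E.tns_assoc)
  also have "\<dots> = ((?l \<boxtimes> FB Xs Zs \<odot> (?k \<boxtimes> ?m)) \<odot> (fbraid ?X ?Y \<boxtimes> fone [?Z])) \<odot> (fone [?X] \<boxtimes> fuse ?Y ?Z)"
    by (simp add: E.interchange_cmp FB_pack E.cmp_assoc)
  also have "(?l \<boxtimes> FB Xs Zs \<odot> (?k \<boxtimes> ?m)) \<odot> (fbraid ?X ?Y \<boxtimes> fone [?Z]) =
      (fone Ys \<boxtimes> FB Xs Zs) \<odot> ((?l \<boxtimes> ?k) \<boxtimes> ?m) \<odot> (fbraid ?X ?Y \<boxtimes> fone [?Z])"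
    by (simp add: E.interchange_cmp E.tns_assoc)
  also have "((?l \<boxtimes> ?k) \<boxtimes> ?m) \<odot> (fbraid ?X ?Y \<boxtimes> fone [?Z]) = (FB Xs Ys \<boxtimes> fone Zs) \<odot> ((?k \<boxtimes> ?l) \<boxtimes> ?m)"
    using E.interchange[of "?l \<boxtimes> ?k" "fbraid ?X ?Y" ?m "fone [?Z]"] E.interchange[of "FB Xs Ys" "?k \<boxtimes> ?l" "fone Zs" ?m]
    by (simp add: FB_pack)
  finally show "FB Xs (Ys @ Zs) \<odot> ?K =
      ((fone Ys \<boxtimes> FB Xs Zs) \<odot> (FB Xs Ys \<boxtimes> fone Zs)) \<odot> ?K"
    by (simp add: E.cmp_assoc E.tns_assoc)
qed simp_all

lemma FB_append_left: "FB (Xs @ Ys) Zs = (FB Xs Zs \<boxtimes> fone Ys) \<odot> (fone Xs \<boxtimes> FB Ys Zs)"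
proof (rule E.iso_cancel[where k = "(pack Xs \<boxtimes> pack Ys \<boxtimes> pack Zs) \<odot> (fuse (tensor_list Xs \<one>\<^sub>o) (tensor_list Ys \<one>\<^sub>o) \<boxtimes> fone [tensor_list Zs \<one>\<^sub>o])"])
  let ?X = "tensor_list Xs \<one>\<^sub>o" and ?Y = "tensor_list Ys \<one>\<^sub>o" and ?Z = "tensor_list Zs \<one>\<^sub>o"
  let ?k = "pack Xs" and ?l = "pack Ys" and ?m = "pack Zs"
  let ?K = "(?k \<boxtimes> ?l \<boxtimes> ?m) \<odot> (fuse ?X ?Y \<boxtimes> fone [?Z])"
  show "E.iso (?K)"
    by (intro E.iso_cmp E.iso_tns iso_pack iso_fuse E.iso_one) simp
  have "FB (Xs @ Ys) Zs \<odot> ?K =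
      FB (Xs @ Ys) Zs \<odot> ((?k \<boxtimes> ?l) \<odot> fuse ?X ?Y \<boxtimes> ?m)"
    using E.interchange[of "?k \<boxtimes> ?l" "fuse ?X ?Y" ?m "fone [?Z]"] by (simp add: E.tns_assoc)
  also have "\<dots> = (?m \<boxtimes> (?k \<boxtimes> ?l) \<odot> fuse ?X ?Y) \<odot> fbraid (?X \<otimes>\<^sub>o ?Y) ?Z"
    by (rule FB_pack) auto
  also have "?m \<boxtimes> (?k \<boxtimes> ?l) \<odot> fuse ?X ?Y = (?m \<boxtimes> ?k \<boxtimes> ?l) \<odot> (fone [?Z] \<boxtimes> fuse ?X ?Y)"
    by (subst E.interchange) auto
  also have "((?m \<boxtimes> ?k \<boxtimes> ?l) \<odot> (fone [?Z] \<boxtimes> fuse ?X ?Y)) \<odot> fbraid (?X \<otimes>\<^sub>o ?Y) ?Z =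
      (((?m \<boxtimes> ?k) \<boxtimes> ?l) \<odot> (fbraid ?X ?Z \<boxtimes> fone [?Y])) \<odot> (fone [?X] \<boxtimes> fbraid ?Y ?Z) \<odot> (fuse ?X ?Y \<boxtimes> fone [?Z])"
    by (simp add: E.cmp_assoc fbraid_hexagon2 E.tns_assoc)
  also have "((?m \<boxtimes> ?k) \<boxtimes> ?l) \<odot> (fbraid ?X ?Z \<boxtimes> fone [?Y]) = (FB Xs Zs \<boxtimes> fone Ys) \<odot> ((?k \<boxtimes> ?m) \<boxtimes> ?l)"
    using E.interchange[of "?m \<boxtimes> ?k" "fbraid ?X ?Z" ?l "fone [?Y]"] E.interchange[of "FB Xs Zs" "?k \<boxtimes> ?m" "fone Ys" ?l]
    by (simp add: FB_pack)
  also have "((FB Xs Zs \<boxtimes> fone Ys) \<odot> ((?k \<boxtimes> ?m) \<boxtimes> ?l)) \<odot> (fone [?X] \<boxtimes> fbraid ?Y ?Z) \<odot> (fuse ?X ?Y \<boxtimes> fone [?Z]) =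
      (FB Xs Zs \<boxtimes> fone Ys) \<odot> (?k \<boxtimes> (?m \<boxtimes> ?l) \<odot> fbraid ?Y ?Z) \<odot> (fuse ?X ?Y \<boxtimes> fone [?Z])"
    by (simp add: E.cmp_assoc E.interchange_cmp E.tns_assoc)
  also have "?k \<boxtimes> (?m \<boxtimes> ?l) \<odot> fbraid ?Y ?Z = (fone Xs \<boxtimes> FB Ys Zs) \<odot> (?k \<boxtimes> ?l \<boxtimes> ?m)"
    by (simp add: E.interchange FB_pack)
  finally show "FB (Xs @ Ys) Zs \<odot> ?K =
      ((FB Xs Zs \<boxtimes> fone Ys) \<odot> (fone Xs \<boxtimes> FB Ys Zs)) \<odot> ?K"
    by (simp add: E.cmp_assoc)
qed simp_all

text \<open>The same change of presentation as for the braiding reduces this to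
  \<open>twist_tensor\<close>.\<close>

lemma FT_append: "FT (Xs @ Ys) = FB Ys Xs \<odot> FB Xs Ys \<odot> (FT Xs \<boxtimes> FT Ys)"
proof (rule E.iso_cancel[where k = "(pack Xs \<boxtimes> pack Ys) \<odot> fuse (tensor_list Xs \<one>\<^sub>o) (tensor_list Ys \<one>\<^sub>o)"])
  let ?X = "tensor_list Xs \<one>\<^sub>o" and ?Y = "tensor_list Ys \<one>\<^sub>o"
  let ?k = "pack Xs" and ?l = "pack Ys"
  note [simp] = twist_in_Hom
  have tt: "twist ?X \<otimes>\<^sub>m twist ?Y \<in> Hom (?X \<otimes>\<^sub>o ?Y) (?X \<otimes>\<^sub>o ?Y)"
    by (simp add: tensor_in_Hom)
  show "E.iso ((?k \<boxtimes> ?l) \<odot> fuse ?X ?Y)"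
    by (intro E.iso_cmp E.iso_tns iso_pack iso_fuse) simp
  have "FT (Xs @ Ys) \<odot> (?k \<boxtimes> ?l) \<odot> fuse ?X ?Y = ((?k \<boxtimes> ?l) \<odot> fuse ?X ?Y) \<odot> emb (?X \<otimes>\<^sub>o ?Y) (?X \<otimes>\<^sub>o ?Y) (twist (?X \<otimes>\<^sub>o ?Y))"
    by (rule FT_pack) auto
  also have "\<dots> = (?k \<boxtimes> ?l) \<odot> (fuse ?X ?Y \<odot> emb (?Y \<otimes>\<^sub>o ?X) (?X \<otimes>\<^sub>o ?Y) (braid ?Y ?X)) \<odot> emb (?X \<otimes>\<^sub>o ?Y) (?Y \<otimes>\<^sub>o ?X) (braid ?X ?Y) \<odot>
      emb (?X \<otimes>\<^sub>o ?Y) (?X \<otimes>\<^sub>o ?Y) (twist ?X \<otimes>\<^sub>m twist ?Y)"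
    by (simp add: twist_tensor emb_comp3[OF tt braid_in_Hom braid_in_Hom] E.cmp_assoc)
  also have "\<dots> = (?k \<boxtimes> ?l) \<odot> fbraid ?Y ?X \<odot> (fuse ?Y ?X \<odot> emb (?X \<otimes>\<^sub>o ?Y) (?Y \<otimes>\<^sub>o ?X) (braid ?X ?Y)) \<odot>
      emb (?X \<otimes>\<^sub>o ?Y) (?X \<otimes>\<^sub>o ?Y) (twist ?X \<otimes>\<^sub>m twist ?Y)"
    by (simp add: fbraid_fuse[of ?Y ?X, symmetric] E.cmp_assoc)
  also have "\<dots> = (?k \<boxtimes> ?l) \<odot> fbraid ?Y ?X \<odot> fbraid ?X ?Y \<odot> (emb ?X ?X (twist ?X) \<boxtimes> emb ?Y ?Y (twist ?Y)) \<odot> fuse ?X ?Y"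
    using E.cmp_reassoc[OF fbraid_fuse] by (simp add: E.cmp_assoc fuse_natural[symmetric])
  also have "\<dots> = FB Ys Xs \<odot> FB Xs Ys \<odot> ((?k \<boxtimes> ?l) \<odot> (emb ?X ?X (twist ?X) \<boxtimes> emb ?Y ?Y (twist ?Y))) \<odot> fuse ?X ?Y"
    using E.cmp_reassoc[OF FB_pack[of ?l ?Y Ys ?k ?X Xs]] E.cmp_reassoc[OF FB_pack[of ?k ?X Xs ?l ?Y Ys]]
    by (simp add: E.cmp_assoc)
  also have "(?k \<boxtimes> ?l) \<odot> (emb ?X ?X (twist ?X) \<boxtimes> emb ?Y ?Y (twist ?Y)) = (FT Xs \<boxtimes> FT Ys) \<odot> (?k \<boxtimes> ?l)"
    by (simp add: E.interchange FT_pack)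
  finally show "FT (Xs @ Ys) \<odot> (?k \<boxtimes> ?l) \<odot> fuse ?X ?Y = (FB Ys Xs \<odot> FB Xs Ys \<odot> (FT Xs \<boxtimes> FT Ys)) \<odot> (?k \<boxtimes> ?l) \<odot> fuse ?X ?Y"
    by (simp add: E.cmp_assoc)
qed simp_all

sublocale E: strict_ribbon farr fsrc ftgt fcmp ftns fone FB FT
  by unfold_locales
     (simp_all add: iso_FB FB_natural FB_append_right FB_append_left FT_natural FT_append)

end

section \<open>Duals, traces and the S-matrix\<close>

context linear_monoidal_category
begin

text \<open>Straightening is done in the strict category, where \<open>emb_full\<close> yields the
  morphism and \<open>emb_inj\<close> carries the equation back.\<close>

lemma left_dual_coev_surj:
  assumes d: "is_left_dual X Y e c" and g: "g \<in> Hom \<one>\<^sub>o (X \<otimes>\<^sub>o Z)"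
  shows "\<exists>f\<in>Hom Y Z. g = (ide X \<otimes>\<^sub>m f) \<bullet> c"
proof -
  have c [simp]: "c \<in> Hom \<one>\<^sub>o (X \<otimes>\<^sub>o Y)"
    using d by (simp add: is_left_dual_def)
  note dp = dual_pair_left_dual[OF d]
  note [simp] = g E.dual_pairD(1-6)[OF dp]
  define m where "m = fuse X Z \<odot> emb \<one>\<^sub>o (X \<otimes>\<^sub>o Z) g \<odot> finv ucap"
  have m: "E.hom m [] ([X] @ [Z])"
    by (simp add: m_def)
  let ?f = "(eva X Y e \<boxtimes> fone [Z]) \<odot> (fone [Y] \<boxtimes> m)"
  obtain f where f: "f \<in> Hom Y Z" "?f = emb Y Z f"
    using emb_full[of ?f Y Z] m by auto
  note [simp] = tensor_in_Hom[OF ide_in_Hom f(1)]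
  have "fuse X Z \<odot> emb \<one>\<^sub>o (X \<otimes>\<^sub>o Z) g = m \<odot> ucap"
    by (simp add: m_def E.cmp_assoc)
  also have "m = (fone [X] \<boxtimes> emb Y Z f) \<odot> coe X Y c"
    using E.dual_pair_coev_surj[OF dp m] f(2) by simp
  also have "\<dots> \<odot> ucap = (fone [X] \<boxtimes> emb Y Z f) \<odot> fuse X Y \<odot> emb \<one>\<^sub>o (X \<otimes>\<^sub>o Y) c"
    by (simp add: coe_def E.cmp_assoc)
  also have "\<dots> = fuse X Z \<odot> emb \<one>\<^sub>o (X \<otimes>\<^sub>o Z) ((ide X \<otimes>\<^sub>m f) \<bullet> c)"
    using E.cmp_reassoc[OF fuse_natural[OF ide_in_Hom[of X] f(1), symmetric]]
      emb_comp[OF tensor_in_Hom[OF ide_in_Hom f(1)] c] by (simp add: emb_ide E.cmp_assoc)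
  finally have "finv (fuse X Z) \<odot> fuse X Z \<odot> emb \<one>\<^sub>o (X \<otimes>\<^sub>o Z) g =
      finv (fuse X Z) \<odot> fuse X Z \<odot> emb \<one>\<^sub>o (X \<otimes>\<^sub>o Z) ((ide X \<otimes>\<^sub>m f) \<bullet> c)"
    by simp
  moreover have gc: "(ide X \<otimes>\<^sub>m f) \<bullet> c \<in> Hom \<one>\<^sub>o (X \<otimes>\<^sub>o Z)"
    by (rule comp_in_Hom[OF tensor_in_Hom[OF ide_in_Hom f(1)] c])
  ultimately have "emb \<one>\<^sub>o (X \<otimes>\<^sub>o Z) g = emb \<one>\<^sub>o (X \<otimes>\<^sub>o Z) ((ide X \<otimes>\<^sub>m f) \<bullet> c)"
    by (simp add: E.cmp_assoc[symmetric])
  then show ?thesis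
    using emb_inj[OF g gc] f(1) by blast
qed

lemma left_dual_coev_surj':
  assumes d: "is_left_dual X Y e c" and g: "g \<in> Hom \<one>\<^sub>o (Z \<otimes>\<^sub>o Y)"
  shows "\<exists>f\<in>Hom X Z. g = (f \<otimes>\<^sub>m ide Y) \<bullet> c"
proof -
  have c [simp]: "c \<in> Hom \<one>\<^sub>o (X \<otimes>\<^sub>o Y)"
    using d by (simp add: is_left_dual_def)
  note dp = dual_pair_left_dual[OF d]
  note [simp] = g E.dual_pairD(1-6)[OF dp]
  define m where "m = fuse Z Y \<odot> emb \<one>\<^sub>o (Z \<otimes>\<^sub>o Y) g \<odot> finv ucap"
  have m: "E.hom m [] ([Z] @ [Y])"
    by (simp add: m_def)
  let ?f = "(fone [Z] \<boxtimes> eva X Y e) \<odot> (m \<boxtimes> fone [X])"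
  obtain f where f: "f \<in> Hom X Z" "?f = emb X Z f"
    using emb_full[of ?f X Z] m by auto
  note [simp] = tensor_in_Hom[OF f(1) ide_in_Hom]
  have "fuse Z Y \<odot> emb \<one>\<^sub>o (Z \<otimes>\<^sub>o Y) g = m \<odot> ucap"
    by (simp add: m_def E.cmp_assoc)
  also have "m = (emb X Z f \<boxtimes> fone [Y]) \<odot> coe X Y c"
    using E.dual_pair_coev_surj'[OF dp m] f(2) by simp
  also have "\<dots> \<odot> ucap = (emb X Z f \<boxtimes> fone [Y]) \<odot> fuse X Y \<odot> emb \<one>\<^sub>o (X \<otimes>\<^sub>o Y) c"
    by (simp add: coe_def E.cmp_assoc)
  also have "\<dots> = fuse Z Y \<odot> emb \<one>\<^sub>o (Z \<otimes>\<^sub>o Y) ((f \<otimes>\<^sub>m ide Y) \<bullet> c)"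
    using E.cmp_reassoc[OF fuse_natural[OF f(1) ide_in_Hom[of Y], symmetric]]
      emb_comp[OF tensor_in_Hom[OF f(1) ide_in_Hom] c] by (simp add: emb_ide E.cmp_assoc)
  finally have "finv (fuse Z Y) \<odot> fuse Z Y \<odot> emb \<one>\<^sub>o (Z \<otimes>\<^sub>o Y) g =
      finv (fuse Z Y) \<odot> fuse Z Y \<odot> emb \<one>\<^sub>o (Z \<otimes>\<^sub>o Y) ((f \<otimes>\<^sub>m ide Y) \<bullet> c)"
    by simp
  moreover have gc: "(f \<otimes>\<^sub>m ide Y) \<bullet> c \<in> Hom \<one>\<^sub>o (Z \<otimes>\<^sub>o Y)"
    by (rule comp_in_Hom[OF tensor_in_Hom[OF f(1) ide_in_Hom] c])
  ultimately have "emb \<one>\<^sub>o (Z \<otimes>\<^sub>o Y) g = emb \<one>\<^sub>o (Z \<otimes>\<^sub>o Y) ((f \<otimes>\<^sub>m ide Y) \<bullet> c)"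
    by (simp add: E.cmp_assoc[symmetric])
  then show ?thesis
    using emb_inj[OF g gc] f(1) by blast
qed

lemma left_dual_coev_inj:
  assumes d: "is_left_dual X Y e c" and f: "f \<in> Hom Y Z" "f' \<in> Hom Y Z"
    and eq: "(ide X \<otimes>\<^sub>m f) \<bullet> c = (ide X \<otimes>\<^sub>m f') \<bullet> c"
  shows "f = f'"
proof -
  have c [simp]: "c \<in> Hom \<one>\<^sub>o (X \<otimes>\<^sub>o Y)"
    using d by (simp add: is_left_dual_def)
  note dp = dual_pair_left_dual[OF d]
  have *: "(fone [X] \<boxtimes> emb Y Z h) \<odot> coe X Y c = fuse X Z \<odot> emb \<one>\<^sub>o (X \<otimes>\<^sub>o Z) ((ide X \<otimes>\<^sub>m h) \<bullet> c) \<odot> finv ucap"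
    if h: "h \<in> Hom Y Z" for h
    using E.cmp_reassoc[OF fuse_natural[OF ide_in_Hom[of X] h, symmetric]]
      emb_comp[OF tensor_in_Hom[OF ide_in_Hom h] c] by (simp add: coe_def emb_ide E.cmp_assoc)
  have "emb Y Z f = emb Y Z f'"
    using E.dual_pair_coev_inj[OF dp, of "emb Y Z f" "[Z]"] E.dual_pair_coev_inj[OF dp, of "emb Y Z f'" "[Z]"]
      *[OF f(1)] *[OF f(2)] eq f by simp
  then show ?thesis
    by (rule emb_inj[OF f])
qed

end

section \<open>Duals of simple objects and the multiplicity of the unit\<close>

context fusion_category
begin

lemma coev_in_Hom: "coev X \<in> Hom \<one>\<^sub>o (X \<otimes>\<^sub>o dual X)"
  using left_dual[of X] by (simp add: is_left_dual_def)

lemma ev_in_Hom: "ev X \<in> Hom (dual X \<otimes>\<^sub>o X) \<one>\<^sub>o"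
  using left_dual[of X] by (simp add: is_left_dual_def)

text \<open>By the zigzag identity, a vanishing coevaluation would make the isomorphism
  \<open>lunit X\<close> vanish.\<close>

lemma coev_nonzero:
  assumes "simple X"
  shows "coev X \<noteq> 0"
proof
  assume 0: "coev X = 0"
  have "runit X \<bullet> (ide X \<otimes>\<^sub>m ev X) \<bullet> assoc X (dual X) X \<bullet> 0 = lunit X"
    using left_dual[of X] 0 tensor_zero_left[OF ide_in_Hom[of X]] by (simp add: is_left_dual_def)
  then have "lunit X = 0"
    using comp_zero_right[OF assoc_in_Hom] comp_zero_right[OF tensor_in_Hom[OF ide_in_Hom ev_in_Hom]]
      comp_zero_right[OF runit_in_Hom] by simp
  then have "ide X = 0"
    using comp_inv_mor[OF lunit_iso[of X]] comp_zero_left[OF inv_mor_in_Hom[OF lunit_iso[of X]]] by simp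
  then show False
    using simple_ide_nonzero[OF assms] by simp
qed

text \<open>Bending identifies these morphisms with the endomorphisms of \<open>X\<close>, which are
  scalars.\<close>

lemma Hom_unit_tensor_dual:
  assumes X: "simple X" and g: "g \<in> Hom \<one>\<^sub>o (X \<otimes>\<^sub>o dual X)"
  shows "\<exists>a. g = a \<cdot>\<^sub>s coev X"
proof -
  obtain f where f: "f \<in> Hom X X" "g = (f \<otimes>\<^sub>m ide (dual X)) \<bullet> coev X"
    using left_dual_coev_surj'[OF left_dual g] by blast
  obtain a where "f = a \<cdot>\<^sub>s ide X"
    using Schur_scalar[OF X f(1)] by blast
  then show ?thesis
    using f(2) tensor_smult_left[OF ide_in_Hom ide_in_Hom] tensor_ide
      comp_smult_left[OF ide_in_Hom coev_in_Hom] comp_ide_left[OF coev_in_Hom] by metis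
qed

text \<open>A converse of Schur's lemma, available by semisimplicity: the idempotent
  \<open>i a \<bullet> p a\<close> onto a simple summand is a scalar, necessarily 1, so that summand
  is all of \<open>X\<close>.\<close>

lemma scalar_End_simple:
  assumes nz: "ide X \<noteq> 0" and sc: "\<And>f. f \<in> Hom X X \<Longrightarrow> \<exists>a. f = a \<cdot>\<^sub>s ide X"
  shows "simple X"
proof -
  obtain A F i p where b: "biproduct X (A::nat set) F i p" "\<And>a. a \<in> A \<Longrightarrow> simple (F a)"
    using semisimple_biproduct by blast
  note bD = biproductD[OF b(1)]
  have "A \<noteq> {}"
    using bD(6) nz by auto
  then obtain a where a: "a \<in> A"
    by blast
  have ip: "i a \<bullet> p a \<in> Hom X X"
    by (rule comp_in_Hom[OF bD(2)[OF a] bD(3)[OF a]])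
  obtain t where t: "i a \<bullet> p a = t \<cdot>\<^sub>s ide X"
    using sc[OF ip] by blast
  have ia0: "i a \<noteq> 0"
    using bD(4)[OF a] comp_zero_right[OF bD(3)[OF a]] simple_ide_nonzero[OF b(2)[OF a]] by auto
  have "i a = (i a \<bullet> p a) \<bullet> i a"
    using comp_assoc[OF bD(2)[OF a] bD(3)[OF a] bD(2)[OF a]] bD(4)[OF a] comp_ide_right[OF bD(2)[OF a]] by simp
  also have "\<dots> = t \<cdot>\<^sub>s i a"
    using t comp_smult_left[OF ide_in_Hom bD(2)[OF a]] comp_ide_left[OF bD(2)[OF a]] by simp
  finally have "(t - 1) \<cdot>\<^sub>s i a = 0"
    by (simp add: scale_left_diff_distrib)
  then have "t = 1"
    using ia0 by simp
  then have "inverses (F a) X (i a) (p a)"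
    unfolding inverses_def using bD(2,3,4)[OF a] t by simp
  then have "isomorphic (F a) X"
    by (auto simp: isomorphic_def is_iso_def)
  then show ?thesis
    using simple_iso[OF b(2)[OF a]] by blast
qed

text \<open>An endomorphism of \<open>dual X\<close> bends to a multiple of \<open>coev X\<close>;
  since bending is injective, the endomorphism itself is that multiple of the identity.\<close>

lemma simple_dual:
  assumes X: "simple X"
  shows "simple (dual X)"
proof (rule scalar_End_simple)
  show "ide (dual X) \<noteq> 0"
    using comp_ide_left[OF coev_in_Hom[of X]] coev_nonzero[OF X] comp_zero_left[OF coev_in_Hom[of X]]
      tensor_zero_right[OF ide_in_Hom[of X]] tensor_ide by metis
  fix f assume f: "f \<in> Hom (dual X) (dual X)"
  obtain a where a: "(ide X \<otimes>\<^sub>m f) \<bullet> coev X = a \<cdot>\<^sub>s coev X"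
    using Hom_unit_tensor_dual[OF X comp_in_Hom[OF tensor_in_Hom[OF ide_in_Hom f] coev_in_Hom]] by blast
  have "f = a \<cdot>\<^sub>s ide (dual X)"
  proof (rule left_dual_coev_inj[OF left_dual f smult_in_Hom[OF ide_in_Hom]])
    show "(ide X \<otimes>\<^sub>m f) \<bullet> coev X = (ide X \<otimes>\<^sub>m a \<cdot>\<^sub>s ide (dual X)) \<bullet> coev X"
      using a tensor_smult_right[OF ide_in_Hom ide_in_Hom] tensor_ide
        comp_smult_left[OF ide_in_Hom coev_in_Hom] comp_ide_left[OF coev_in_Hom] by metis
  qed
  then show "\<exists>a. f = a \<cdot>\<^sub>s ide (dual X)" ..
qed

text \<open>The unit object need not belong to \<open>Irr\<close>, so its multiplicity has to be
  read off at its representative.\<close>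

lemma obj_class_unit_rep: "obj_class X (rep \<one>\<^sub>o) = int (dim (Hom \<one>\<^sub>o X))"
proof -
  note u = rep[OF unit_simple]
  obtain A F i p where b: "biproduct X (A::nat set) F i p" "\<And>a. a \<in> A \<Longrightarrow> simple (F a)"
    using semisimple_biproduct by blast
  have "isomorphic (F a) \<one>\<^sub>o \<longleftrightarrow> isomorphic (F a) (rep \<one>\<^sub>o)" for a
    using u(2) isomorphic_trans isomorphic_sym by blast
  then show ?thesis
    using obj_class_biproduct_simple[OF b u(1)] dim_Hom_biproduct[OF unit_simple b] by simp
qed

text \<open>Bending turns morphisms from the unit to \<open>X \<otimes> Y\<close> into morphisms
  from \<open>dual X\<close> to \<open>Y\<close>, between simple objects.\<close>

lemma obj_class_tensor_unit:
  assumes X: "simple X" and Y: "simple Y"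
  shows "obj_class (X \<otimes>\<^sub>o Y) (rep \<one>\<^sub>o) = (if isomorphic (dual X) Y then 1 else 0)"
proof (cases "isomorphic (dual X) Y")
  case True
  have "Hom \<one>\<^sub>o (X \<otimes>\<^sub>o dual X) = span {coev X}"
    using Hom_unit_tensor_dual[OF X] smult_in_Hom[OF coev_in_Hom] by (auto simp: span_singleton)
  moreover have "independent {coev X}"
    using coev_nonzero[OF X] by simp
  ultimately have "dim (Hom \<one>\<^sub>o (X \<otimes>\<^sub>o dual X)) = 1"
    using dim_eq_card[of "{coev X}" "Hom \<one>\<^sub>o (X \<otimes>\<^sub>o dual X)"] span_span by simp
  moreover have "obj_class (X \<otimes>\<^sub>o Y) = obj_class (X \<otimes>\<^sub>o dual X)"
    using obj_class_iso[OF isomorphic_tensor[OF isomorphic_refl True]] by simp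
  ultimately show ?thesis
    using True obj_class_unit_rep by simp
next
  case False
  have "Hom \<one>\<^sub>o (X \<otimes>\<^sub>o Y) \<subseteq> {0}"
  proof
    fix g assume g: "g \<in> Hom \<one>\<^sub>o (X \<otimes>\<^sub>o Y)"
    obtain f where f: "f \<in> Hom (dual X) Y" "g = (ide X \<otimes>\<^sub>m f) \<bullet> coev X"
      using left_dual_coev_surj[OF left_dual g] by blast
    have "f = 0"
      using simple_hom_isomorphic[OF simple_dual[OF X] Y f(1)] False by blast
    then show "g \<in> {0}"
      using f(2) tensor_zero_right[OF ide_in_Hom[of X]] comp_zero_left[OF coev_in_Hom[of X]] by simp
  qed
  then have "Hom \<one>\<^sub>o (X \<otimes>\<^sub>o Y) = {0}"
    by auto
  moreover have "dim {0} = 0"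
    using dim_eq_card[of "{}" "{0}"] by (auto simp: span_empty span_insert_0 independent_empty)
  ultimately show ?thesis
    using False obj_class_unit_rep by simp
qed

end

section \<open>Quantum traces and multiplicativity of the S-matrix\<close>

context ribbon_fusion_category
begin

lemma isomorphic_tensor_commute: "isomorphic (X \<otimes>\<^sub>o Y) (Y \<otimes>\<^sub>o X)"
  using braid_iso by (auto simp: isomorphic_def)

definition loop :: "'o \<Rightarrow> 'm \<Rightarrow> 'm" where
  "loop X f = ev X \<bullet> braid X (dual X) \<bullet> ((twist X \<bullet> f) \<otimes>\<^sub>m ide (dual X)) \<bullet> coev X"

lemma closing_in_Hom:
  "f \<in> Hom X X \<Longrightarrow> (twist X \<bullet> f) \<otimes>\<^sub>m ide (dual X) \<in> Hom (X \<otimes>\<^sub>o dual X) (X \<otimes>\<^sub>o dual X)"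
  by (intro tensor_in_Hom comp_in_Hom[OF twist_in_Hom] ide_in_Hom)

lemma loop_in_Hom:
  assumes f: "f \<in> Hom X X"
  shows "loop X f \<in> Hom \<one>\<^sub>o \<one>\<^sub>o"
  unfolding loop_def
  by (rule comp_in_Hom[OF ev_in_Hom comp_in_Hom[OF braid_in_Hom comp_in_Hom[OF closing_in_Hom[OF f] coev_in_Hom]]])

lemma qtrace_unique: "loop X f = a \<cdot>\<^sub>s ide \<one>\<^sub>o \<Longrightarrow> qtrace X f = a"
  unfolding qtrace_def loop_def[symmetric]
  using simple_ide_nonzero[OF unit_simple] by (auto intro!: the_equality)

lemma loop_qtrace:
  assumes "f \<in> Hom X X"
  shows "loop X f = qtrace X f \<cdot>\<^sub>s ide \<one>\<^sub>o"
  using Schur_scalar[OF unit_simple loop_in_Hom[OF assms]] qtrace_unique by metis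

lemma loop_add:
  assumes f: "f \<in> Hom X X" and g: "g \<in> Hom X X"
  shows "loop X (f + g) = loop X f + loop X g"
  unfolding loop_def
  using comp_add_right[OF twist_in_Hom f g] tensor_add_left[OF comp_in_Hom[OF twist_in_Hom f] comp_in_Hom[OF twist_in_Hom g] ide_in_Hom]
    comp_add_left[OF closing_in_Hom[OF f] closing_in_Hom[OF g] coev_in_Hom]
    comp_add_right[OF braid_in_Hom comp_in_Hom[OF closing_in_Hom[OF f] coev_in_Hom] comp_in_Hom[OF closing_in_Hom[OF g] coev_in_Hom]]
    comp_add_right[OF ev_in_Hom comp_in_Hom[OF braid_in_Hom comp_in_Hom[OF closing_in_Hom[OF f] coev_in_Hom]]
      comp_in_Hom[OF braid_in_Hom comp_in_Hom[OF closing_in_Hom[OF g] coev_in_Hom]]]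
  by simp

lemma loop_smult:
  assumes f: "f \<in> Hom X X"
  shows "loop X (a \<cdot>\<^sub>s f) = a \<cdot>\<^sub>s loop X f"
  unfolding loop_def
  using comp_smult_right[OF twist_in_Hom f] tensor_smult_left[OF comp_in_Hom[OF twist_in_Hom f] ide_in_Hom]
    comp_smult_left[OF closing_in_Hom[OF f] coev_in_Hom]
    comp_smult_right[OF braid_in_Hom comp_in_Hom[OF closing_in_Hom[OF f] coev_in_Hom]]
    comp_smult_right[OF ev_in_Hom comp_in_Hom[OF braid_in_Hom comp_in_Hom[OF closing_in_Hom[OF f] coev_in_Hom]]]
  by simp

lemma qtrace_add: "\<lbrakk>f \<in> Hom X X; g \<in> Hom X X\<rbrakk> \<Longrightarrow> qtrace X (f + g) = qtrace X f + qtrace X g"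
  by (rule qtrace_unique) (simp add: loop_add loop_qtrace scale_left_distrib)

lemma qtrace_smult: "f \<in> Hom X X \<Longrightarrow> qtrace X (a \<cdot>\<^sub>s f) = a * qtrace X f"
  by (rule qtrace_unique) (simp add: loop_smult loop_qtrace)

lemma qtrace_zero: "qtrace X 0 = 0"
  using qtrace_smult[OF zero_in_Hom[of X X], of 0] by simp

lemma qtrace_sum: "(\<And>a. a \<in> A \<Longrightarrow> f a \<in> Hom X X) \<Longrightarrow> qtrace X (\<Sum>a\<in>A. f a) = (\<Sum>a\<in>A. qtrace X (f a))"
proof (induction A rule: infinite_finite_induct)
  case (insert a A)
  then show ?case
    using qtrace_add[of "f a" X "sum f A"] sum_in_Hom[of A f X X] by simp
qed (simp_all add: qtrace_zero)

abbreviation eva' :: "'o \<Rightarrow> ('o, 'm) family" where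
  "eva' X \<equiv> eva X (dual X) (ev X)"

abbreviation coe' :: "'o \<Rightarrow> ('o, 'm) family" where
  "coe' X \<equiv> coe X (dual X) (coev X)"

lemmas dual_pair_dual = dual_pair_left_dual[OF left_dual]

text \<open>The bridge between the trace of the definition and closed diagrams: the partial trace
  with nothing left over is the quantum trace, conjugated by the removal of the unit strand.\<close>

lemma ptr_loop:
  assumes f: "f \<in> Hom X X"
  shows "E.ptr [] [X] [dual X] (eva' X) (coe' X) (emb X X f) = ucap \<odot> emb \<one>\<^sub>o \<one>\<^sub>o (loop X f) \<odot> finv ucap"
proof -
  note tf = comp_in_Hom[OF twist_in_Hom f]
  note [simp] = f twist_in_Hom tf ev_in_Hom coev_in_Hom braid_in_Hom closing_in_Hom[OF f] E.hom_cap[OF dual_pair_dual]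
  have "E.ptr [] [X] [dual X] (eva' X) (coe' X) (emb X X f) =
      eva' X \<odot> fbraid X (dual X) \<odot> ((emb X X (twist X \<bullet> f) \<boxtimes> fone [dual X]) \<odot> fuse X (dual X)) \<odot> emb \<one>\<^sub>o (X \<otimes>\<^sub>o dual X) (coev X) \<odot> finv ucap"
    using E.dual_pairD[OF dual_pair_dual[of X]]
    by (simp add: E.ptr_def E.cap_def FB_single FT_single E.cmp_assoc E.interchange_cmp emb_comp[OF twist_in_Hom f] coe_def)
  also have "(emb X X (twist X \<bullet> f) \<boxtimes> fone [dual X]) \<odot> fuse X (dual X) =
      fuse X (dual X) \<odot> emb (X \<otimes>\<^sub>o dual X) (X \<otimes>\<^sub>o dual X) ((twist X \<bullet> f) \<otimes>\<^sub>m ide (dual X))"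
    using fuse_natural[OF tf ide_in_Hom[of "dual X"]] by (simp add: emb_ide)
  also have "eva' X \<odot> fbraid X (dual X) \<odot> (fuse X (dual X) \<odot> emb (X \<otimes>\<^sub>o dual X) (X \<otimes>\<^sub>o dual X) ((twist X \<bullet> f) \<otimes>\<^sub>m ide (dual X))) \<odot>
      emb \<one>\<^sub>o (X \<otimes>\<^sub>o dual X) (coev X) \<odot> finv ucap =
      (eva' X \<odot> fuse (dual X) X) \<odot> emb (X \<otimes>\<^sub>o dual X) (dual X \<otimes>\<^sub>o X) (braid X (dual X)) \<odot>
      emb (X \<otimes>\<^sub>o dual X) (X \<otimes>\<^sub>o dual X) ((twist X \<bullet> f) \<otimes>\<^sub>m ide (dual X)) \<odot> emb \<one>\<^sub>o (X \<otimes>\<^sub>o dual X) (coev X) \<odot> finv ucap"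
    using E.cmp_reassoc[OF fbraid_fuse] by (simp add: E.cmp_assoc)
  also have "eva' X \<odot> fuse (dual X) X = ucap \<odot> emb (dual X \<otimes>\<^sub>o X) \<one>\<^sub>o (ev X)"
    by (simp add: eva_def E.cmp_assoc)
  finally show ?thesis
    unfolding loop_def by (simp add: E.cmp_assoc emb_comp4[OF coev_in_Hom closing_in_Hom[OF f] braid_in_Hom ev_in_Hom])
qed

text \<open>Carries equations between closed diagrams back to scalars of the ground field.\<close>

lemma qtrace_eqI:
  assumes "f \<in> Hom X X" "g \<in> Hom Y Y"
    and "E.ptr [] [X] [dual X] (eva' X) (coe' X) (emb X X f) = E.ptr [] [Y] [dual Y] (eva' Y) (coe' Y) (emb Y Y g)"
  shows "qtrace X f = qtrace Y g"
proof -
  note l = loop_in_Hom[OF assms(1)] loop_in_Hom[OF assms(2)]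
  note [simp] = l
  have "ucap \<odot> emb \<one>\<^sub>o \<one>\<^sub>o (loop X f) \<odot> finv ucap = ucap \<odot> emb \<one>\<^sub>o \<one>\<^sub>o (loop Y g) \<odot> finv ucap"
    using assms by (simp add: ptr_loop)
  then have "finv ucap \<odot> (ucap \<odot> emb \<one>\<^sub>o \<one>\<^sub>o (loop X f) \<odot> finv ucap) \<odot> ucap =
      finv ucap \<odot> (ucap \<odot> emb \<one>\<^sub>o \<one>\<^sub>o (loop Y g) \<odot> finv ucap) \<odot> ucap"
    by simp
  moreover have "finv ucap \<odot> (ucap \<odot> emb \<one>\<^sub>o \<one>\<^sub>o h \<odot> finv ucap) \<odot> ucap = emb \<one>\<^sub>o \<one>\<^sub>o h"
    if "h \<in> Hom \<one>\<^sub>o \<one>\<^sub>o" for h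
  proof -
    have "finv ucap \<odot> (ucap \<odot> emb \<one>\<^sub>o \<one>\<^sub>o h \<odot> finv ucap) \<odot> ucap = (finv ucap \<odot> ucap) \<odot> emb \<one>\<^sub>o \<one>\<^sub>o h \<odot> (finv ucap \<odot> ucap)"
      by (simp only: E.cmp_assoc)
    then show ?thesis
      using that by simp
  qed
  ultimately have "loop X f = loop Y g"
    using emb_inj[OF l] l by simp
  then show ?thesis
    using loop_qtrace[OF assms(2)] by (intro qtrace_unique) simp
qed

lemma qtrace_cyclic:
  assumes f: "f \<in> Hom X Y" and g: "g \<in> Hom Y X"
  shows "qtrace X (g \<bullet> f) = qtrace Y (f \<bullet> g)"
proof (rule qtrace_eqI)
  show "g \<bullet> f \<in> Hom X X" "f \<bullet> g \<in> Hom Y Y"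
    using comp_in_Hom f g by blast+
  have "E.ptr [] [X] [dual X] (eva' X) (coe' X) ((fone [] \<boxtimes> emb Y X g) \<odot> emb X Y f) =
      E.ptr [] [Y] [dual Y] (eva' Y) (coe' Y) (emb X Y f \<odot> (fone [] \<boxtimes> emb Y X g))"
    using f g by (intro E.ptr_cyclic[OF dual_pair_dual dual_pair_dual]) auto
  then show "E.ptr [] [X] [dual X] (eva' X) (coe' X) (emb X X (g \<bullet> f)) = E.ptr [] [Y] [dual Y] (eva' Y) (coe' Y) (emb Y Y (f \<bullet> g))"
    using f g by (simp add: emb_comp[OF g f] emb_comp[OF f g])
qed

lemma smatrix_sym: "smatrix X Y = smatrix Y X"
  unfolding smatrix_def by (rule qtrace_cyclic[OF braid_in_Hom braid_in_Hom])

text \<open>Naturality pulls the inclusion of a summand out of the double braiding, and cyclicity of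
  the trace brings it next to the projection, where the two cancel.\<close>

lemma smatrix_biproduct:
  assumes b: "biproduct X A F i p"
  shows "smatrix X Y = (\<Sum>a\<in>A. smatrix (F a) Y)"
proof -
  note bD = biproductD[OF b]
  let ?M = "braid X Y \<bullet> braid Y X"
  let ?I = "\<lambda>a. ide Y \<otimes>\<^sub>m i a" and ?P = "\<lambda>a. ide Y \<otimes>\<^sub>m p a"
  have M: "braid V Y \<bullet> braid Y V \<in> Hom (Y \<otimes>\<^sub>o V) (Y \<otimes>\<^sub>o V)" for V
    by (rule comp_in_Hom[OF braid_in_Hom braid_in_Hom])
  have I: "ide Y \<otimes>\<^sub>m i a \<in> Hom (Y \<otimes>\<^sub>o F a) (Y \<otimes>\<^sub>o X)" and P: "ide Y \<otimes>\<^sub>m p a \<in> Hom (Y \<otimes>\<^sub>o X) (Y \<otimes>\<^sub>o F a)"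
    if "a \<in> A" for a
    using tensor_in_Hom[OF ide_in_Hom bD(2)[OF that]] tensor_in_Hom[OF ide_in_Hom bD(3)[OF that]] by auto
  have IP: "(\<Sum>a\<in>A. ?I a \<bullet> ?P a) = ide (Y \<otimes>\<^sub>o X)"
  proof -
    have "(\<Sum>a\<in>A. ?I a \<bullet> ?P a) = (\<Sum>a\<in>A. ide Y \<otimes>\<^sub>m (i a \<bullet> p a))"
      using tensor_comp_right[OF bD(2,3)] by simp
    also have "\<dots> = ide Y \<otimes>\<^sub>m (\<Sum>a\<in>A. i a \<bullet> p a)"
      using comp_in_Hom[OF bD(2) bD(3)] by (intro tensor_sum_right[symmetric, where Y = X and Y' = X, OF ide_in_Hom])
    finally show ?thesis
      using bD(6) tensor_ide by simp
  qed
  have nat: "?M \<bullet> ?I a = ?I a \<bullet> (braid (F a) Y \<bullet> braid Y (F a))" if a: "a \<in> A" for a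
  proof -
    have iY: "i a \<otimes>\<^sub>m ide Y \<in> Hom (F a \<otimes>\<^sub>o Y) (X \<otimes>\<^sub>o Y)"
      by (rule tensor_in_Hom[OF bD(2)[OF a] ide_in_Hom])
    have "?M \<bullet> ?I a = braid X Y \<bullet> ((i a \<otimes>\<^sub>m ide Y) \<bullet> braid Y (F a))"
      using comp_assoc[OF braid_in_Hom braid_in_Hom I[OF a]] braid_natural[OF ide_in_Hom bD(2)[OF a]] by simp
    then show ?thesis
      using comp_eq_right[OF braid_natural[OF bD(2)[OF a] ide_in_Hom] braid_in_Hom iY I[OF a] braid_in_Hom braid_in_Hom] by simp
  qed
  have "smatrix X Y = qtrace (Y \<otimes>\<^sub>o X) (?M \<bullet> (\<Sum>a\<in>A. ?I a \<bullet> ?P a))"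
    unfolding smatrix_def IP using comp_ide_right[OF M] by simp
  also have "?M \<bullet> (\<Sum>a\<in>A. ?I a \<bullet> ?P a) =
      (\<Sum>a\<in>A. ?M \<bullet> (?I a \<bullet> ?P a))"
    using comp_in_Hom[OF I P] by (intro comp_sum_right[where X = "Y \<otimes>\<^sub>o X", OF M])
  also have "qtrace (Y \<otimes>\<^sub>o X) \<dots> = (\<Sum>a\<in>A. qtrace (Y \<otimes>\<^sub>o X) (?M \<bullet> (?I a \<bullet> ?P a)))"
    using comp_in_Hom[OF M comp_in_Hom[OF I P]] by (intro qtrace_sum)
  also have "\<dots> = (\<Sum>a\<in>A. smatrix (F a) Y)"
  proof (rule sum.cong[OF refl])
    fix a assume a: "a \<in> A"
    let ?M' = "braid (F a) Y \<bullet> braid Y (F a)"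
    have "?M \<bullet> (?I a \<bullet> ?P a) = ?I a \<bullet> (?M' \<bullet> ?P a)"
      by (rule comp_eq_right[OF nat[OF a] M I[OF a] I[OF a] M P[OF a]])
    then have "qtrace (Y \<otimes>\<^sub>o X) (?M \<bullet> (?I a \<bullet> ?P a)) =
        qtrace (Y \<otimes>\<^sub>o F a) ((?M' \<bullet> ?P a) \<bullet> ?I a)"
      using qtrace_cyclic[OF comp_in_Hom[OF M P[OF a]] I[OF a]] by simp
    also have "(?M' \<bullet> ?P a) \<bullet> ?I a = ?M'"
      using comp_assoc[OF M P[OF a] I[OF a]] tensor_comp_right[OF bD(3)[OF a] bD(2)[OF a], symmetric] bD(4)[OF a]
        tensor_ide comp_ide_right[OF M] by simp
    finally show "qtrace (Y \<otimes>\<^sub>o X) (?M \<bullet> (?I a \<bullet> ?P a)) = smatrix (F a) Y"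
      by (simp add: smatrix_def)
  qed
  finally show ?thesis .
qed

lemma smatrix_iso:
  assumes "isomorphic X X'"
  shows "smatrix X Y = smatrix X' Y"
proof -
  obtain f g where "inverses X X' f g"
    using assms by (auto simp: isomorphic_def is_iso_def)
  from biproduct_iso[OF biproduct_self this] show ?thesis
    using smatrix_biproduct[of X' "{()}" "\<lambda>_. X"] by simp
qed

lemma qdim_iso:
  assumes "isomorphic X X'"
  shows "qdim X = qdim X'"
proof -
  obtain f g where "inverses X X' f g"
    using assms by (auto simp: isomorphic_def is_iso_def)
  then show ?thesis
    using qtrace_cyclic[of f X X' g] by (simp add: qdim_def inverses_def)
qed

text \<open>For simple \<open>Y\<close> this is a scalar endomorphism of the strand
  \<open>Y\<close>; by \<open>smatrix_encircle\<close> that scalar times \<open>qdim Y\<close> is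
  the S-matrix entry.\<close>

definition encircle :: "'o \<Rightarrow> 'o \<Rightarrow> ('o, 'm) family" where
  "encircle Y X = E.ptr [Y] [X] [dual X] (eva' X) (coe' X) (FB [X] [Y] \<odot> FB [Y] [X])"

lemma encircle_hom: "E.hom (encircle Y X) [Y] [Y]"
  unfolding encircle_def by (rule E.hom_ptr[OF dual_pair_dual]) auto

lemma encircle_scalar:
  assumes "simple Y"
  shows "\<exists>a. encircle Y X = emb Y Y (a \<cdot>\<^sub>s ide Y)"
  using emb_full[of "encircle Y X" Y Y] encircle_hom[of Y X] Schur_scalar[OF assms] by auto

text \<open>By \<open>encircle_iso\<close> the colour \<open>X \<otimes> X'\<close> with its own
  dual may be replaced by two strands with nested duals, to which the strict statement on nested
  loops applies.\<close>

lemma encircle_tensor_obj: "encircle Y (X \<otimes>\<^sub>o X') = encircle Y X' \<odot> encircle Y X"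
proof -
  note dt = E.dual_pair_tensor[OF dual_pair_dual[of X] dual_pair_dual[of X'], simplified]
  have "encircle Y (X \<otimes>\<^sub>o X') = E.ptr [Y] [X, X'] [dual X', dual X] (eva' X' \<odot> (fone [dual X'] \<boxtimes> eva' X \<boxtimes> fone [X']))
      ((fone [X] \<boxtimes> coe' X' \<boxtimes> fone [dual X]) \<odot> coe' X) (FB [X, X'] [Y] \<odot> FB [Y] [X, X'])"
    unfolding encircle_def by (rule E.encircle_iso[OF dual_pair_dual dt, where k = "fuse X X'" and l = "finv (fuse X X')"]) auto
  then show ?thesis
    using E.encircle_tensor[OF dual_pair_dual[of X] dual_pair_dual[of X'], of "[Y]"] by (simp add: encircle_def)
qed

text \<open>Closing the encircled strand gives the Hopf link. By cyclicity the trace over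
  \<open>Y \<otimes> X\<close> becomes one over two strands, and closing \<open>X\<close> first
  produces the loop around \<open>Y\<close>.\<close>

lemma smatrix_encircle:
  assumes enc: "encircle Y X = emb Y Y (a \<cdot>\<^sub>s ide Y)"
  shows "smatrix X Y = a * qdim Y"
proof -
  let ?M = "braid X Y \<bullet> braid Y X" and ?G = "FB [X] [Y] \<odot> FB [Y] [X]"
  let ?e = "eva' X \<odot> (fone [dual X] \<boxtimes> eva' Y \<boxtimes> fone [X])" and ?c = "(fone [Y] \<boxtimes> coe' X \<boxtimes> fone [dual Y]) \<odot> coe' Y"
  have M: "?M \<in> Hom (Y \<otimes>\<^sub>o X) (Y \<otimes>\<^sub>o X)"
    by (rule comp_in_Hom[OF braid_in_Hom braid_in_Hom])
  note aH = smult_in_Hom[OF ide_in_Hom[of Y], of a]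
  note [simp] = M aH braid_in_Hom
  note dt = E.dual_pair_tensor[OF dual_pair_dual[of Y] dual_pair_dual[of X], simplified]
  have "emb (Y \<otimes>\<^sub>o X) (Y \<otimes>\<^sub>o X) ?M = finv (fuse Y X) \<odot> fuse Y X \<odot> emb (X \<otimes>\<^sub>o Y) (Y \<otimes>\<^sub>o X) (braid X Y) \<odot> emb (Y \<otimes>\<^sub>o X) (X \<otimes>\<^sub>o Y) (braid Y X)"
    by (simp add: emb_comp[OF braid_in_Hom braid_in_Hom] E.cmp_assoc[symmetric])
  also have "\<dots> = finv (fuse Y X) \<odot> ?G \<odot> fuse Y X"
    using E.cmp_reassoc[OF fbraid_fuse] by (simp add: FB_single E.cmp_assoc fbraid_fuse)
  finally have eM: "emb (Y \<otimes>\<^sub>o X) (Y \<otimes>\<^sub>o X) ?M = (fone [] \<boxtimes> finv (fuse Y X)) \<odot> ?G \<odot> fuse Y X"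
    by simp
  have "E.ptr [] [Y \<otimes>\<^sub>o X] [dual (Y \<otimes>\<^sub>o X)] (eva' (Y \<otimes>\<^sub>o X)) (coe' (Y \<otimes>\<^sub>o X)) (emb (Y \<otimes>\<^sub>o X) (Y \<otimes>\<^sub>o X) ?M) =
      E.ptr [] [Y, X] [dual X, dual Y] ?e ?c
        ((?G \<odot> fuse Y X) \<odot> (fone [] \<boxtimes> finv (fuse Y X)))"
    unfolding eM by (rule E.ptr_cyclic[OF dual_pair_dual dt]) auto
  also have "(?G \<odot> fuse Y X) \<odot> (fone [] \<boxtimes> finv (fuse Y X)) = ?G"
    by (simp add: E.cmp_assoc)
  also have "E.ptr [] [Y, X] [dual X, dual Y] ?e ?c ?G =
      E.ptr [] [Y] [dual Y] (eva' Y) (coe' Y) (encircle Y X)"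
    using E.ptr_tensor[OF dual_pair_dual[of Y] dual_pair_dual[of X], of ?G "[]"] by (simp add: encircle_def)
  finally have "smatrix X Y = qtrace Y (a \<cdot>\<^sub>s ide Y)"
    unfolding smatrix_def enc by (intro qtrace_eqI M aH)
  then show ?thesis
    using qtrace_smult[OF ide_in_Hom] by (simp add: qdim_def)
qed

text \<open>Both loops act on the simple strand \<open>Y\<close> by scalars, and the scalars of
  nested loops multiply. Division is avoided because \<open>qdim Y\<close> is not yet known to be
  non-zero.\<close>

theorem smatrix_tensor:
  assumes Y: "simple Y"
  shows "smatrix (X \<otimes>\<^sub>o X') Y * qdim Y = smatrix X Y * smatrix X' Y"
proof -
  obtain a where a: "encircle Y X = emb Y Y (a \<cdot>\<^sub>s ide Y)"
    using encircle_scalar[OF Y] by blast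
  obtain b where b: "encircle Y X' = emb Y Y (b \<cdot>\<^sub>s ide Y)"
    using encircle_scalar[OF Y] by blast
  note sH = smult_in_Hom[OF ide_in_Hom[of Y]]
  have "encircle Y (X \<otimes>\<^sub>o X') = emb Y Y ((b \<cdot>\<^sub>s ide Y) \<bullet> (a \<cdot>\<^sub>s ide Y))"
    unfolding encircle_tensor_obj a b by (rule emb_comp[OF sH sH, symmetric])
  also have "(b \<cdot>\<^sub>s ide Y) \<bullet> (a \<cdot>\<^sub>s ide Y) = (a * b) \<cdot>\<^sub>s ide Y"
    using comp_smult_left[OF ide_in_Hom sH] comp_ide_left[OF sH] by (simp add: mult.commute)
  finally show ?thesis
    using smatrix_encircle[OF a] smatrix_encircle[OF b] smatrix_encircle[of Y "X \<otimes>\<^sub>o X'" "a * b"] by simp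
qed

end

section \<open>Duality as a contravariant functor\<close>

context strict_monoidal
begin

text \<open>Transposition reverses composites. The equation is checked after bending along
  \<open>c\<close>, which is injective by \<open>dual_pair_coev_inj\<close>.\<close>

lemma dual_pair_iso:
  assumes d: "dual_pair x y e c" and d': "dual_pair x' y' e' c'"
    and k: "hom k x x'" and l: "hom l x' x" and lk: "l \<odot> k = one x"
  shows "transpose y c y' e' k \<odot> transpose y' c' y e l = one y"
proof -
  note dD [simp] = dual_pairD(1-6)[OF d] dual_pairD(1-6)[OF d']
  note tk = transpose[OF d d' k] and tl = transpose[OF d' d l]
  let ?k = "transpose y c y' e' k" and ?l = "transpose y' c' y e l"
  note [simp] = tk(1) tl(1)
  have "(one x \<boxtimes> ?k \<odot> ?l) \<odot> c = (one x \<boxtimes> ?k) \<odot> (l \<boxtimes> one y') \<odot> c'"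
    by (simp add: whisker_left cmp_assoc tl(2))
  also have "\<dots> = (l \<boxtimes> one y) \<odot> (one x' \<boxtimes> ?k) \<odot> c'"
    using slide_left[of l x' x ?k y' y] slide_right[of l x' x ?k y' y] l by (simp add: cmp_assoc[symmetric])
  also have "\<dots> = (l \<odot> k \<boxtimes> one y) \<odot> c"
    using k l by (simp add: tk(2) interchange_cmp)
  also have "\<dots> = (one x \<boxtimes> one y) \<odot> c"
    by (simp add: lk)
  finally have *: "(one x \<boxtimes> ?k \<odot> ?l) \<odot> c = (one x \<boxtimes> one y) \<odot> c" .
  have h: "hom (?k \<odot> ?l) y y" "hom (one y) y y"
    by simp_all
  show ?thesis
    using dual_pair_coev_inj[OF d h(1)] dual_pair_coev_inj[OF d h(2)] unfolding * by (rule trans[OF sym])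
qed

end

context fusion_category
begin

text \<open>Both objects are duals of \<open>X \<otimes> Y\<close>, the first by nesting;
  transposing \<open>fuse X Y\<close> and its inverse compares them.\<close>

lemma isomorphic_dual_tensor: "isomorphic (dual Y \<otimes>\<^sub>o dual X) (dual (X \<otimes>\<^sub>o Y))"
proof -
  note dX = dual_pair_left_dual[OF left_dual[of X]] and dY = dual_pair_left_dual[OF left_dual[of Y]]
  note dXY = dual_pair_left_dual[OF left_dual[of "X \<otimes>\<^sub>o Y"]]
  note dt = E.dual_pair_tensor[OF dX dY, simplified]
  let ?k = "fuse X Y" and ?l = "finv (fuse X Y)"
  have k: "E.hom ?k [X \<otimes>\<^sub>o Y] [X, Y]" and l: "E.hom ?l [X, Y] [X \<otimes>\<^sub>o Y]"
    and lk: "?l \<odot> ?k = fone [X \<otimes>\<^sub>o Y]" and kl: "?k \<odot> ?l = fone [X, Y]"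
    by simp_all
  obtain t r where tr: "E.hom t [dual Y, dual X] [dual (X \<otimes>\<^sub>o Y)]" "E.hom r [dual (X \<otimes>\<^sub>o Y)] [dual Y, dual X]"
    "t \<odot> r = fone [dual (X \<otimes>\<^sub>o Y)]" "r \<odot> t = fone [dual Y, dual X]"
    using E.transpose(1)[OF dXY dt k] E.transpose(1)[OF dt dXY l] E.dual_pair_iso[OF dXY dt k l lk]
      E.dual_pair_iso[OF dt dXY l k kl] by blast
  let ?f = "fuse (dual Y) (dual X)"
  obtain f where f: "f \<in> Hom (dual Y \<otimes>\<^sub>o dual X) (dual (X \<otimes>\<^sub>o Y))" "t \<odot> ?f = emb (dual Y \<otimes>\<^sub>o dual X) (dual (X \<otimes>\<^sub>o Y)) f"
    using emb_full[of "t \<odot> ?f"] tr by auto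
  obtain g where g: "g \<in> Hom (dual (X \<otimes>\<^sub>o Y)) (dual Y \<otimes>\<^sub>o dual X)" "finv ?f \<odot> r = emb (dual (X \<otimes>\<^sub>o Y)) (dual Y \<otimes>\<^sub>o dual X) g"
    using emb_full[of "finv ?f \<odot> r"] tr by auto
  have "emb (dual Y \<otimes>\<^sub>o dual X) (dual Y \<otimes>\<^sub>o dual X) (g \<bullet> f) = finv ?f \<odot> (r \<odot> t) \<odot> ?f"
    by (simp add: emb_comp[OF g(1) f(1)] f(2)[symmetric] g(2)[symmetric] E.cmp_assoc)
  then have "g \<bullet> f = ide (dual Y \<otimes>\<^sub>o dual X)"
    using emb_inj[OF comp_in_Hom[OF g(1) f(1)] ide_in_Hom] tr(4) by (simp add: emb_ide)
  moreover have "emb (dual (X \<otimes>\<^sub>o Y)) (dual (X \<otimes>\<^sub>o Y)) (f \<bullet> g) = t \<odot> (?f \<odot> finv ?f) \<odot> r"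
    by (simp only: emb_comp[OF f(1) g(1)] f(2)[symmetric] g(2)[symmetric] E.cmp_assoc)
  then have "f \<bullet> g = ide (dual (X \<otimes>\<^sub>o Y))"
    using emb_inj[OF comp_in_Hom[OF f(1) g(1)] ide_in_Hom] tr by (simp add: emb_ide)
  ultimately show ?thesis
    using f(1) g(1) by (auto simp: isomorphic_def is_iso_def inverses_def)
qed

text \<open>The dual morphism, selected by its effect on coevaluations, which determines it by the
  bijectivity of bending. The associators in the formula of \<open>dual_mor\<close> are thereby
  avoided.\<close>

definition transp :: "'o \<Rightarrow> 'o \<Rightarrow> 'm \<Rightarrow> 'm" where
  "transp X Y f = (SOME g. g \<in> Hom (dual Y) (dual X) \<and> (ide Y \<otimes>\<^sub>m g) \<bullet> coev Y = (f \<otimes>\<^sub>m ide (dual X)) \<bullet> coev X)"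

lemma transp:
  assumes f: "f \<in> Hom X Y"
  shows "transp X Y f \<in> Hom (dual Y) (dual X)"
    and "(ide Y \<otimes>\<^sub>m transp X Y f) \<bullet> coev Y = (f \<otimes>\<^sub>m ide (dual X)) \<bullet> coev X"
proof -
  have "(f \<otimes>\<^sub>m ide (dual X)) \<bullet> coev X \<in> Hom \<one>\<^sub>o (Y \<otimes>\<^sub>o dual X)"
    by (rule comp_in_Hom[OF tensor_in_Hom[OF f ide_in_Hom] coev_in_Hom])
  then have "\<exists>g. g \<in> Hom (dual Y) (dual X) \<and> (ide Y \<otimes>\<^sub>m g) \<bullet> coev Y = (f \<otimes>\<^sub>m ide (dual X)) \<bullet> coev X"
    using left_dual_coev_surj[OF left_dual] by metis
  from someI_ex[OF this] show "transp X Y f \<in> Hom (dual Y) (dual X)"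
    "(ide Y \<otimes>\<^sub>m transp X Y f) \<bullet> coev Y = (f \<otimes>\<^sub>m ide (dual X)) \<bullet> coev X"
    by (auto simp: transp_def)
qed

lemma transp_eqI:
  assumes f: "f \<in> Hom X Y" and g: "g \<in> Hom (dual Y) (dual X)"
    and eq: "(ide Y \<otimes>\<^sub>m g) \<bullet> coev Y = (f \<otimes>\<^sub>m ide (dual X)) \<bullet> coev X"
  shows "transp X Y f = g"
  using left_dual_coev_inj[OF left_dual transp(1)[OF f] g] transp(2)[OF f] eq by simp

lemma transp_ide: "transp X X (ide X) = ide (dual X)"
  by (rule transp_eqI) (simp_all add: ide_in_Hom)

lemma transp_zero: "transp X Y 0 = 0"
  using tensor_zero_right[OF ide_in_Hom[of Y]] tensor_zero_left[OF ide_in_Hom[of "dual X"]]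
    comp_zero_left[OF coev_in_Hom] by (intro transp_eqI) simp_all

lemma transp_comp:
  assumes f: "f \<in> Hom X Y" and g: "g \<in> Hom Y Z"
  shows "transp X Z (g \<bullet> f) = transp X Y f \<bullet> transp Y Z g"
proof (rule transp_eqI[OF comp_in_Hom[OF g f] comp_in_Hom[OF transp(1)[OF f] transp(1)[OF g]]])
  note F = transp[OF f] and G = transp[OF g]
  note ZF = tensor_in_Hom[OF ide_in_Hom[of Z] F(1)] and ZG = tensor_in_Hom[OF ide_in_Hom[of Z] G(1)]
    and gY = tensor_in_Hom[OF g ide_in_Hom[of "dual Y"]] and gX = tensor_in_Hom[OF g ide_in_Hom[of "dual X"]]
    and YF = tensor_in_Hom[OF ide_in_Hom[of Y] F(1)] and fX = tensor_in_Hom[OF f ide_in_Hom[of "dual X"]]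
  have "(ide Z \<otimes>\<^sub>m (transp X Y f \<bullet> transp Y Z g)) \<bullet> coev Z = (ide Z \<otimes>\<^sub>m transp X Y f) \<bullet> ((ide Z \<otimes>\<^sub>m transp Y Z g) \<bullet> coev Z)"
    using tensor_comp_right[OF F(1) G(1)] comp_assoc[OF ZF ZG coev_in_Hom] by simp
  also have "\<dots> = (ide Z \<otimes>\<^sub>m transp X Y f) \<bullet> ((g \<otimes>\<^sub>m ide (dual Y)) \<bullet> coev Y)"
    by (simp add: G(2))
  also have "\<dots> = (g \<otimes>\<^sub>m ide (dual X)) \<bullet> ((ide Y \<otimes>\<^sub>m transp X Y f) \<bullet> coev Y)"
    using tensor_slide[OF g F(1)] by (intro comp_eq_right[OF _ ZF gY gX YF coev_in_Hom]) simp
  also have "\<dots> = ((g \<bullet> f) \<otimes>\<^sub>m ide (dual X)) \<bullet> coev X"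
    using F(2) comp_assoc[OF gX fX coev_in_Hom] tensor_comp_left[OF g f] by simp
  finally show "(ide Z \<otimes>\<^sub>m (transp X Y f \<bullet> transp Y Z g)) \<bullet> coev Z = ((g \<bullet> f) \<otimes>\<^sub>m ide (dual X)) \<bullet> coev X" .
qed

lemma transp_sum:
  assumes "\<And>a. a \<in> A \<Longrightarrow> f a \<in> Hom X Y"
  shows "transp X Y (\<Sum>a\<in>A. f a) = (\<Sum>a\<in>A. transp X Y (f a))"
proof (rule transp_eqI[OF sum_in_Hom sum_in_Hom])
  note t = transp[OF assms]
  have "(ide Y \<otimes>\<^sub>m (\<Sum>a\<in>A. transp X Y (f a))) \<bullet> coev Y = (\<Sum>a\<in>A. (ide Y \<otimes>\<^sub>m transp X Y (f a)) \<bullet> coev Y)"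
    using t(1) tensor_in_Hom[OF ide_in_Hom[of Y] t(1)]
    by (subst tensor_sum_right[OF ide_in_Hom t(1)]) (auto intro: comp_sum_left[OF coev_in_Hom])
  also have "\<dots> = (\<Sum>a\<in>A. (f a \<otimes>\<^sub>m ide (dual X)) \<bullet> coev X)"
    using t(2) by simp
  also have "\<dots> = ((\<Sum>a\<in>A. f a) \<otimes>\<^sub>m ide (dual X)) \<bullet> coev X"
  proof -
    have "(\<Sum>a\<in>A. f a) \<otimes>\<^sub>m ide (dual X) = (\<Sum>a\<in>A. f a \<otimes>\<^sub>m ide (dual X))"
      by (rule tensor_sum_left[OF ide_in_Hom assms])
    moreover have "(\<Sum>a\<in>A. f a \<otimes>\<^sub>m ide (dual X)) \<bullet> coev X = (\<Sum>a\<in>A. (f a \<otimes>\<^sub>m ide (dual X)) \<bullet> coev X)"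
      by (rule comp_sum_left[OF coev_in_Hom tensor_in_Hom[OF assms ide_in_Hom]])
    ultimately show ?thesis
      by simp
  qed
  finally show "(ide Y \<otimes>\<^sub>m (\<Sum>a\<in>A. transp X Y (f a))) \<bullet> coev Y = ((\<Sum>a\<in>A. f a) \<otimes>\<^sub>m ide (dual X)) \<bullet> coev X" .
qed (use assms transp in auto)

text \<open>Transposition is additive and contravariant, so inclusions and projections exchange
  their roles.\<close>

lemma biproduct_dual:
  assumes b: "biproduct X A F i p"
  shows "biproduct (dual X) A (\<lambda>a. dual (F a)) (\<lambda>a. transp X (F a) (p a)) (\<lambda>a. transp (F a) X (i a))"
proof -
  note bD = biproductD[OF b]
  have "transp (F a) X (i a) \<bullet> transp X (F c) (p c) = (if a = c then ide (dual (F a)) else 0)" if "a \<in> A" "c \<in> A" for a c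
    using transp_comp[OF bD(2)[OF that(1)] bD(3)[OF that(2)]] bD(4,5) that transp_ide transp_zero by (cases "a = c") auto
  moreover have "(\<Sum>a\<in>A. transp X (F a) (p a) \<bullet> transp (F a) X (i a)) = transp X X (\<Sum>a\<in>A. i a \<bullet> p a)"
    using transp_sum[of A "\<lambda>a. i a \<bullet> p a" X X] comp_in_Hom[OF bD(2) bD(3)] transp_comp[OF bD(3) bD(2)] by simp
  ultimately show ?thesis
    unfolding biproduct_def using bD(1,6) transp(1)[OF bD(2)] transp(1)[OF bD(3)] transp_ide by simp
qed

definition star :: "'o \<Rightarrow> 'o" where
  "star X = rep (dual X)"

lemma star_in_Irr: "X \<in> Irr \<Longrightarrow> star X \<in> Irr"
  unfolding star_def by (rule rep(1)[OF simple_dual[OF Irr_simple]])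

lemma isomorphic_star: "simple X \<Longrightarrow> isomorphic (dual X) (star X)"
  unfolding star_def by (rule rep(2)[OF simple_dual])

lemma obj_class_tensor_unit_Irr:
  assumes "X \<in> Irr" "Y \<in> Irr"
  shows "obj_class (X \<otimes>\<^sub>o Y) (rep \<one>\<^sub>o) = (if Y = star X then 1 else 0)"
proof -
  have "isomorphic (dual X) Y \<longleftrightarrow> Y = star X"
    using isomorphic_star[OF Irr_simple[OF assms(1)]] Irr_isomorphic_iff[OF star_in_Irr[OF assms(1)] assms(2)]
      isomorphic_trans isomorphic_sym by metis
  then show ?thesis
    using obj_class_tensor_unit[OF Irr_simple Irr_simple] assms by simp
qed

text \<open>Read off from multiplicities: the unit occurs in \<open>Y \<otimes> dual Y\<close>,
  hence in the isomorphic \<open>X \<otimes> dual Y\<close>, and this identifies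
  \<open>dual Y\<close> as a dual of \<open>X\<close>.\<close>

lemma isomorphic_dual:
  assumes X: "simple X" and iso: "isomorphic X Y"
  shows "isomorphic (dual X) (dual Y)"
proof -
  have Y: "simple Y"
    using simple_iso[OF X iso] .
  have "obj_class (X \<otimes>\<^sub>o dual Y) = obj_class (Y \<otimes>\<^sub>o dual Y)"
    using obj_class_iso[OF isomorphic_tensor[OF iso isomorphic_refl]] .
  then show ?thesis
    using obj_class_tensor_unit[OF X simple_dual[OF Y]] obj_class_tensor_unit[OF Y simple_dual[OF Y]] isomorphic_refl
    by (auto split: if_splits)
qed

end

section \<open>Symmetries of the fusion coefficients\<close>

context ribbon_fusion_category
begin

text \<open>The partner of \<open>X\<close> is detected by the unit in \<open>X \<otimes> Y\<close>,
  and the braiding makes this relation symmetric.\<close>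

lemma star_star: "X \<in> Irr \<Longrightarrow> star (star X) = X"
  using obj_class_tensor_unit_Irr[of X "star X"] obj_class_tensor_unit_Irr[of "star X" X] star_in_Irr[of X]
    obj_class_iso[OF isomorphic_tensor_commute[of X "star X"]] by (auto split: if_splits)

lemma obj_class_dual:
  assumes Z: "Z \<in> Irr"
  shows "obj_class (dual X) (star Z) = obj_class X Z"
proof -
  obtain A F i p where b: "biproduct X (A::nat set) F i p" "\<And>a. a \<in> A \<Longrightarrow> simple (F a)"
    using semisimple_biproduct by blast
  have "isomorphic (dual (F a)) (star Z) \<longleftrightarrow> isomorphic (F a) Z" if a: "a \<in> A" for a
  proof -
    note F = b(2)[OF a]
    have "isomorphic (dual (F a)) (star (rep (F a)))"
      using isomorphic_dual[OF F rep(2)[OF F]] isomorphic_star[OF Irr_simple[OF rep(1)[OF F]]] isomorphic_trans by blast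
    then have "isomorphic (dual (F a)) (star Z) \<longleftrightarrow> star (rep (F a)) = star Z"
      using Irr_isomorphic_iff[OF star_in_Irr[OF rep(1)[OF F]] star_in_Irr[OF Z]] isomorphic_trans isomorphic_sym by blast
    also have "\<dots> \<longleftrightarrow> rep (F a) = Z"
      using star_star[OF rep(1)[OF F]] star_star[OF Z] by metis
    also have "\<dots> \<longleftrightarrow> isomorphic (F a) Z"
      using Irr_isomorphic_iff[OF rep(1)[OF F] Z] rep(2)[OF F] isomorphic_trans isomorphic_sym by blast
    finally show ?thesis .
  qed
  then have "{a \<in> A. isomorphic (dual (F a)) (star Z)} = {a \<in> A. isomorphic (F a) Z}"
    by auto
  then show ?thesis
    using obj_class_biproduct_simple[OF biproduct_dual[OF b(1)] simple_dual[OF b(2)] star_in_Irr[OF Z]]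
      obj_class_biproduct_simple[OF b Z] by simp
qed

text \<open>Duality reverses the tensor product, and the braiding restores the order.\<close>

lemma obj_class_tensor_star:
  assumes "X \<in> Irr" "Y \<in> Irr" "Z \<in> Irr"
  shows "obj_class (star X \<otimes>\<^sub>o star Y) (star Z) = obj_class (X \<otimes>\<^sub>o Y) Z"
proof -
  have "isomorphic (star X \<otimes>\<^sub>o star Y) (dual X \<otimes>\<^sub>o dual Y)"
    using isomorphic_tensor[OF isomorphic_star isomorphic_star] Irr_simple assms isomorphic_sym by blast
  also have "isomorphic (dual X \<otimes>\<^sub>o dual Y) (dual (Y \<otimes>\<^sub>o X))"
    by (rule isomorphic_dual_tensor)
  finally (isomorphic_trans) have "obj_class (star X \<otimes>\<^sub>o star Y) = obj_class (dual (Y \<otimes>\<^sub>o X))"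
    by (rule obj_class_iso)
  then show ?thesis
    using obj_class_dual[OF assms(3)] obj_class_iso[OF isomorphic_tensor_commute[of X Y]] by simp
qed

text \<open>Both sides are the multiplicity of the unit in the triple product of \<open>X\<close>,
  \<open>Y\<close> and \<open>Z\<close>, computed with the two bracketings.\<close>

lemma obj_class_tensor_rotate:
  assumes "X \<in> Irr" "Y \<in> Irr" "Z \<in> Irr"
  shows "obj_class (X \<otimes>\<^sub>o Y) (star Z) = obj_class (Y \<otimes>\<^sub>o Z) (star X)"
proof -
  let ?u = "rep \<one>\<^sub>o"
  note sI = star_in_Irr[OF assms(1)] star_in_Irr[OF assms(3)]
  have L: "obj_class ((X \<otimes>\<^sub>o Y) \<otimes>\<^sub>o Z) ?u = obj_class (X \<otimes>\<^sub>o Y) (star Z)"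
  proof -
    have "obj_class ((X \<otimes>\<^sub>o Y) \<otimes>\<^sub>o Z) ?u =
        (\<Sum>V\<in>Irr. \<Sum>W\<in>Irr. obj_class (X \<otimes>\<^sub>o Y) V * obj_class Z W * obj_class (V \<otimes>\<^sub>o W) ?u)"
      by (rule obj_class_tensor)
    also have "\<dots> = (\<Sum>V\<in>Irr. \<Sum>W\<in>Irr. if W = Z then obj_class (X \<otimes>\<^sub>o Y) V * obj_class (V \<otimes>\<^sub>o Z) ?u else 0)"
      using obj_class_Irr[OF assms(3)] by (intro sum.cong refl) auto
    also have "\<dots> = (\<Sum>V\<in>Irr. obj_class (X \<otimes>\<^sub>o Y) V * obj_class (V \<otimes>\<^sub>o Z) ?u)"
      using finite_Irr assms(3) by simp
    also have "\<dots> = (\<Sum>V\<in>Irr. if V = star Z then obj_class (X \<otimes>\<^sub>o Y) V else 0)"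
      using obj_class_tensor_unit_Irr[OF _ assms(3)] star_star[OF assms(3)] star_star
      by (intro sum.cong refl) auto
    finally show ?thesis
      using finite_Irr sI by simp
  qed
  have R: "obj_class (X \<otimes>\<^sub>o (Y \<otimes>\<^sub>o Z)) ?u = obj_class (Y \<otimes>\<^sub>o Z) (star X)"
  proof -
    have "obj_class (X \<otimes>\<^sub>o (Y \<otimes>\<^sub>o Z)) ?u =
        (\<Sum>V\<in>Irr. \<Sum>W\<in>Irr. obj_class X V * obj_class (Y \<otimes>\<^sub>o Z) W * obj_class (V \<otimes>\<^sub>o W) ?u)"
      by (rule obj_class_tensor)
    also have "\<dots> = (\<Sum>V\<in>Irr. if V = X then \<Sum>W\<in>Irr. obj_class (Y \<otimes>\<^sub>o Z) W * obj_class (X \<otimes>\<^sub>o W) ?u else 0)"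
      using obj_class_Irr[OF assms(1)] by (intro sum.cong refl) auto
    also have "\<dots> = (\<Sum>W\<in>Irr. obj_class (Y \<otimes>\<^sub>o Z) W * obj_class (X \<otimes>\<^sub>o W) ?u)"
      using finite_Irr assms(1) by simp
    also have "\<dots> = (\<Sum>W\<in>Irr. if W = star X then obj_class (Y \<otimes>\<^sub>o Z) W else 0)"
      using obj_class_tensor_unit_Irr[OF assms(1)] by (intro sum.cong refl) auto
    finally show ?thesis
      using finite_Irr sI by simp
  qed
  have "isomorphic ((X \<otimes>\<^sub>o Y) \<otimes>\<^sub>o Z) (X \<otimes>\<^sub>o (Y \<otimes>\<^sub>o Z))"
    using assoc_iso by (auto simp: isomorphic_def)
  from obj_class_iso[OF this] show ?thesis
    using L R by simp
qed

lemma smatrix_obj_class: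
  "smatrix X Y = (\<Sum>Z\<in>Irr. of_int (obj_class X Z) * smatrix Z Y)"
proof -
  obtain A F i p where b: "biproduct X (A::nat set) F i p" "\<And>a. a \<in> A \<Longrightarrow> simple (F a)"
    using semisimple_biproduct by blast
  have "smatrix X Y = (\<Sum>a\<in>A. smatrix (rep (F a)) Y)"
    using smatrix_biproduct[OF b(1)] smatrix_iso[OF rep(2)[OF b(2)]] by simp
  then show ?thesis
    using obj_class_simple_summands[OF b, of "\<lambda>Z. smatrix Z Y"] by simp
qed

lemma smatrix_mult:
  assumes "simple X"
  shows "smatrix X Y * smatrix X Z = qdim X * (\<Sum>V\<in>Irr. of_int (obj_class (Y \<otimes>\<^sub>o Z) V) * smatrix X V)"
  using smatrix_tensor[OF assms, of Y Z] smatrix_obj_class[of "Y \<otimes>\<^sub>o Z" X]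
  by (simp add: smatrix_sym[of X] mult.commute)

text \<open>Multiplicativity for the product of the unit with \<open>Z\<close> gives the claim
  multiplied by \<open>smatrix Z X\<close>; non-degeneracy provides a \<open>Z\<close> for which
  this factor is non-zero.\<close>

lemma smatrix_unit_left:
  assumes nd: smatrix_nondegenerate and X: "X \<in> Irr"
  shows "smatrix (rep \<one>\<^sub>o) X = qdim X"
proof -
  obtain t where "\<forall>X\<in>Irr. \<forall>Y\<in>Irr.
      (\<Sum>Z\<in>Irr. smatrix X Z * t Z Y) = (if X = Y then 1 else 0) \<and>
      (\<Sum>Z\<in>Irr. t X Z * smatrix Z Y) = (if X = Y then 1 else 0)"
    using nd unfolding smatrix_nondegenerate_def by blast
  then have t: "(\<Sum>Z\<in>Irr. t X Z * smatrix Z X) = 1"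
    using X by auto
  have "\<exists>Z\<in>Irr. smatrix Z X \<noteq> 0"
  proof (rule ccontr)
    assume "\<not> ?thesis"
    then show False
      using t by simp
  qed
  then obtain Z where Z: "smatrix Z X \<noteq> 0"
    by blast
  have "isomorphic (\<one>\<^sub>o \<otimes>\<^sub>o Z) Z"
    using lunit_iso by (auto simp: isomorphic_def)
  then have "smatrix Z X * qdim X = smatrix \<one>\<^sub>o X * smatrix Z X"
    using smatrix_tensor[OF Irr_simple[OF X], of "\<one>\<^sub>o" Z] smatrix_iso[of "\<one>\<^sub>o \<otimes>\<^sub>o Z" Z X] by simp
  then show ?thesis
    using Z smatrix_iso[OF rep(2)[OF unit_simple]] by simp
qed

end

section \<open>Characters of the Grothendieck ring\<close>

text \<open>The numerical shadow of the category on which the remaining argument runs.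
  \<open>N\<close> is real-valued so that it combines with dimensions without casts. The last axiom
  is the form in which non-degeneracy survives: the characters given by the normalised rows of
  \<open>s\<close> are distinct, expressed without division.\<close>

locale fusion_datum =
  fixes I :: "'i set" and N :: "'i \<Rightarrow> 'i \<Rightarrow> 'i \<Rightarrow> real" and u :: 'i and st :: "'i \<Rightarrow> 'i"
    and d :: "'i \<Rightarrow> real" and s :: "'i \<Rightarrow> 'i \<Rightarrow> complex"
  assumes finite_I: "finite I"
    and u_in: "u \<in> I"
    and st_in: "i \<in> I \<Longrightarrow> st i \<in> I"
    and st_st: "i \<in> I \<Longrightarrow> st (st i) = i"
    and N_nonneg: "N i j k \<ge> 0"
    and N_unit: "\<lbrakk>i \<in> I; j \<in> I\<rbrakk> \<Longrightarrow> N i j u = (if j = st i then 1 else 0)"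
    and N_rotate: "\<lbrakk>i \<in> I; j \<in> I; k \<in> I\<rbrakk> \<Longrightarrow> N i j (st k) = N j k (st i)"
    and N_star: "\<lbrakk>i \<in> I; j \<in> I; k \<in> I\<rbrakk> \<Longrightarrow> N (st i) (st j) (st k) = N i j k"
    and d_pos: "i \<in> I \<Longrightarrow> d i > 0"
    and d_unit: "d u = 1"
    and d_mult: "\<lbrakk>i \<in> I; j \<in> I\<rbrakk> \<Longrightarrow> d i * d j = (\<Sum>k\<in>I. N i j k * d k)"
    and s_sym: "s i j = s j i"
    and s_unit: "i \<in> I \<Longrightarrow> s u i = d i"
    and s_mult: "\<lbrakk>i \<in> I; j \<in> I; k \<in> I\<rbrakk> \<Longrightarrow> s i j * s i k = d i * (\<Sum>l\<in>I. N j k l * s i l)"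
    and s_distinct: "\<lbrakk>i \<in> I; j \<in> I; i \<noteq> j\<rbrakk> \<Longrightarrow> \<exists>k\<in>I. d j * s i k \<noteq> d i * s j k"
begin

text \<open>The numerical counterpart of a fusion subcategory.\<close>

definition closed_set :: "'i set \<Rightarrow> bool" where
  "closed_set J \<longleftrightarrow> J \<subseteq> I \<and> u \<in> J \<and> (\<forall>i\<in>J. st i \<in> J) \<and> (\<forall>i\<in>J. \<forall>j\<in>J. \<forall>k\<in>I. N i j k \<noteq> 0 \<longrightarrow> k \<in> J)"

text \<open>A multiplicative functional on the subring spanned by \<open>J\<close>. No value at
  \<open>u\<close> is prescribed, so the zero function is included.\<close>

definition character :: "'i set \<Rightarrow> ('i \<Rightarrow> complex) \<Rightarrow> bool" where
  "character J f \<longleftrightarrow> (\<forall>i\<in>J. \<forall>j\<in>J. f i * f j = (\<Sum>k\<in>J. of_real (N i j k) * f k))"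

lemma closed_setD:
  assumes "closed_set J"
  shows "J \<subseteq> I" "u \<in> J" "i \<in> J \<Longrightarrow> i \<in> I" "i \<in> J \<Longrightarrow> st i \<in> J"
    "\<lbrakk>i \<in> J; j \<in> J; k \<in> I; N i j k \<noteq> 0\<rbrakk> \<Longrightarrow> k \<in> J"
  using assms unfolding closed_set_def by blast+

lemma closed_set_I: "closed_set I"
  using u_in st_in by (auto simp: closed_set_def)

lemma sum_closed_set:
  assumes "closed_set J" "i \<in> J" "j \<in> J"
  shows "(\<Sum>k\<in>I. of_real (N i j k) * f k) = (\<Sum>k\<in>J. of_real (N i j k) * (f k :: 'a::real_normed_field))"
proof (rule sum.mono_neutral_right[OF finite_I])
  show "J \<subseteq> I"
    by (rule closed_setD(1)[OF assms(1)])
  have "N i j k = 0" if "k \<in> I - J" for k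
    using closed_setD(5)[OF assms] that by blast
  then show "\<forall>k\<in>I - J. of_real (N i j k) * f k = 0"
    by simp
qed

lemma character_subset:
  assumes "closed_set J" "character I f"
  shows "character J f"
  unfolding character_def
proof (intro ballI)
  fix i j assume ij: "i \<in> J" "j \<in> J"
  then have "i \<in> I" "j \<in> I"
    using closed_setD(3)[OF assms(1)] by blast+
  then show "f i * f j = (\<Sum>k\<in>J. of_real (N i j k) * f k)"
    using assms(2) sum_closed_set[OF assms(1) ij, of f] by (simp add: character_def)
qed

lemma sum_star:
  assumes "closed_set J"
  shows "(\<Sum>k\<in>J. f (st k)) = (\<Sum>k\<in>J. f k :: 'a::comm_monoid_add)"
  using closed_setD(4)[OF assms] st_st[OF closed_setD(3)[OF assms]]
  by (intro sum.reindex_bij_witness[where i = st and j = st]) simp_all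

text \<open>The Casimir element \<open>\<Sum>\<^sub>k k \<otimes> k\<^sup>*\<close> is central, hence distinct characters are orthogonal.\<close>

lemma characters_orthogonal:
  assumes J: "closed_set J" and f: "character J f" and g: "character J g" and l: "l \<in> J" "f l \<noteq> g l"
  shows "(\<Sum>k\<in>J. f k * g (st k)) = 0"
proof -
  have JI: "k \<in> I" and Jst: "st k \<in> J" if "k \<in> J" for k
    using closed_setD(3,4)[OF J that] by auto
  have "f l * (\<Sum>k\<in>J. f k * g (st k)) = (\<Sum>k\<in>J. (f l * f k) * g (st k))"
    by (simp add: sum_distrib_left mult.assoc)
  also have "\<dots> = (\<Sum>k\<in>J. \<Sum>m\<in>J. of_real (N l k m) * f m * g (st k))"
    using f l by (simp add: character_def sum_distrib_right)
  also have "\<dots> = (\<Sum>m\<in>J. \<Sum>k\<in>J. of_real (N l k m) * f m * g (st k))"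
    by (rule sum.swap)
  \<comment> \<open>Centrality of the Casimir element: by rotation, multiplying its first leg by
    \<open>l\<close> on the left equals multiplying its second leg by \<open>l\<close> on the
    right.\<close>
  also have "\<dots> = (\<Sum>m\<in>J. \<Sum>k\<in>J. of_real (N (st m) l (st k)) * f m * g (st k))"
    using N_rotate[OF st_in[OF JI] JI[OF l(1)] JI] st_st[OF JI] by simp
  also have "\<dots> = (\<Sum>m\<in>J. \<Sum>k\<in>J. of_real (N (st m) l k) * f m * g k)"
    by (intro sum.cong refl sum_star[OF J])
  also have "\<dots> = (\<Sum>m\<in>J. f m * (g (st m) * g l))"
  proof (rule sum.cong[OF refl])
    fix m assume "m \<in> J"
    then have "g (st m) * g l = (\<Sum>k\<in>J. of_real (N (st m) l k) * g k)"
      using g l(1) Jst unfolding character_def by blast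
    then show "(\<Sum>k\<in>J. of_real (N (st m) l k) * f m * g k) = f m * (g (st m) * g l)"
      by (simp add: sum_distrib_left mult_ac)
  qed
  also have "\<dots> = g l * (\<Sum>k\<in>J. f k * g (st k))"
    by (simp add: sum_distrib_left mult_ac)
  finally show ?thesis
    using l(2) by simp
qed

lemma character_star:
  assumes "character I f"
  shows "character I (\<lambda>k. f (st k))"
  unfolding character_def
proof (intro ballI)
  fix i j assume ij: "i \<in> I" "j \<in> I"
  have "f (st i) * f (st j) = (\<Sum>k\<in>I. of_real (N (st i) (st j) k) * f k)"
    using assms ij st_in by (simp add: character_def)
  also have "\<dots> = (\<Sum>k\<in>I. of_real (N (st i) (st j) (st k)) * f (st k))"
    by (rule sum_star[OF closed_set_I, symmetric])
  finally show "f (st i) * f (st j) = (\<Sum>k\<in>I. of_real (N i j k) * f (st k))"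
    using N_star ij by simp
qed

lemma character_d: "character I (\<lambda>k. of_real (d k))"
  unfolding character_def by (simp add: of_real_mult[symmetric] of_real_sum[symmetric] d_mult del: of_real_mult of_real_sum)

definition chi :: "'i \<Rightarrow> 'i \<Rightarrow> complex" where
  "chi i k = s i k / of_real (d i)"

lemma character_chi:
  assumes "i \<in> I"
  shows "character I (chi i)"
  unfolding character_def
proof (intro ballI)
  fix j k assume jk: "j \<in> I" "k \<in> I"
  have "chi i j * chi i k = (\<Sum>l\<in>I. of_real (N j k l) * s i l) / of_real (d i)"
    using s_mult[OF assms jk] d_pos[OF assms] by (simp add: chi_def)
  then show "chi i j * chi i k = (\<Sum>l\<in>I. of_real (N j k l) * chi i l)"
    by (simp add: chi_def sum_divide_distrib)
qed

lemma chi_unit: "k \<in> I \<Longrightarrow> chi u k = of_real (d k)"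
  by (simp add: chi_def d_unit s_unit)

lemma chi_distinct:
  assumes "i \<in> I" "j \<in> I" "i \<noteq> j"
  shows "\<exists>k\<in>I. chi i k \<noteq> chi j k"
  using s_distinct[OF assms] d_pos[OF assms(1)] d_pos[OF assms(2)]
  by (auto simp: chi_def field_simps)

text \<open>The contrapositive of orthogonality, applied below to pairs whose pairing is a sum of
  squares.\<close>

lemma characters_equal:
  assumes "character I f" "character I g" "(\<Sum>k\<in>I. f k * g (st k)) \<noteq> 0" "k \<in> I"
  shows "f k = g k"
  using characters_orthogonal[OF closed_set_I assms(1,2)] assms(3,4) by blast

text \<open>Composing \<open>d\<close> with \<open>st\<close> gives again a character, and its
  pairing with \<open>d\<close> is the positive sum of the squares of \<open>d\<close>.\<close>

lemma d_star:
  assumes "i \<in> I"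
  shows "d (st i) = d i"
proof -
  have "(\<Sum>k\<in>I. complex_of_real (d k) * of_real (d (st (st k)))) = of_real (\<Sum>k\<in>I. d k * d k)"
    using st_st by simp
  moreover have "(\<Sum>k\<in>I. d k * d k) > 0"
    using finite_I u_in d_pos by (intro sum_pos) auto
  ultimately have "(\<Sum>k\<in>I. complex_of_real (d k) * of_real (d (st (st k)))) \<noteq> 0"
    by (simp only: of_real_eq_0_iff)
  then have "complex_of_real (d i) = of_real (d (st i))"
    by (rule characters_equal[OF character_d character_star[OF character_d] _ assms])
  then show ?thesis
    by simp
qed

text \<open>The character is compared with the conjugate of its composite with \<open>st\<close>.
  Their pairing is the sum of the squared moduli, which is positive because the value at
  \<open>u\<close> does not vanish.\<close>

lemma chi_star:
  assumes "i \<in> I" "k \<in> I"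
  shows "chi i (st k) = cnj (chi i k)"
proof -
  have c: "character I (\<lambda>k. cnj (chi i (st k)))"
    using character_star[OF character_chi[OF assms(1)]] unfolding character_def
    by (metis (mono_tags, lifting) complex_cnj_complex_of_real complex_cnj_mult cnj_sum sum.cong)
  have "(\<Sum>k\<in>I. chi i k * cnj (chi i (st (st k)))) = of_real (\<Sum>k\<in>I. (cmod (chi i k))\<^sup>2)"
    using st_st by (simp add: complex_norm_square del: of_real_power)
  moreover have "(\<Sum>k\<in>I. (cmod (chi i k))\<^sup>2) > 0"
  proof -
    have "chi i u \<noteq> 0"
      using s_sym[of i u] s_unit[OF assms(1)] d_pos[OF assms(1)] by (simp add: chi_def)
    then show ?thesis
      using finite_I u_in by (intro sum_pos2[of _ u]) auto
  qed
  ultimately have "(\<Sum>k\<in>I. chi i k * cnj (chi i (st (st k)))) \<noteq> 0"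
    by (simp only: of_real_eq_0_iff)
  then have "chi i k = cnj (chi i (st k))"
    by (rule characters_equal[OF character_chi[OF assms(1)] c _ assms(2)])
  then show ?thesis
    by simp
qed

lemma s_star: "\<lbrakk>i \<in> I; k \<in> I\<rbrakk> \<Longrightarrow> s i (st k) = cnj (s i k)"
  using chi_star[of i k] d_pos[of i] by (simp add: chi_def)

lemma s_star_left: "\<lbrakk>i \<in> I; k \<in> I\<rbrakk> \<Longrightarrow> s (st i) k = cnj (s i k)"
  using s_star[of k i] by (simp add: s_sym)

definition D :: real where
  "D = (\<Sum>k\<in>I. (d k)\<^sup>2)"

lemma D_pos: "D > 0"
  unfolding D_def using finite_I u_in by (intro sum_pos zero_less_power d_pos) auto

text \<open>The dimension function is the character attached to \<open>u\<close>, hence orthogonal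
  to the one attached to any other \<open>k\<close>.\<close>

lemma sum_d_s:
  assumes "k \<in> I"
  shows "(\<Sum>i\<in>I. d i * s i k) = (if k = u then of_real D else 0)"
proof (cases "k = u")
  case True
  then show ?thesis
    using s_sym s_unit by (simp add: D_def power2_eq_square)
next
  case False
  then obtain l where l: "l \<in> I" "chi u l \<noteq> chi k l"
    using chi_distinct[OF u_in assms] by auto
  have "(\<Sum>i\<in>I. chi k i * of_real (d (st i))) = 0"
    using characters_orthogonal[OF closed_set_I character_chi[OF assms] character_d l(1)] l chi_unit by auto
  then have "(\<Sum>i\<in>I. s i k * of_real (d i)) / of_real (d k) = 0"
    using d_star by (simp add: chi_def sum_divide_distrib s_sym[of k])
  then show ?thesis
    using False d_pos[OF assms] by (simp add: mult.commute)
qed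

text \<open>By multiplicativity \<open>s i k * s k j\<close> is a combination of entries
  \<open>d k * s k l\<close> with coefficients \<open>N i j l\<close>. Summing over \<open>k\<close>
  leaves only \<open>l = u\<close>, and the unit occurs in the product of \<open>i\<close> and
  \<open>j\<close> only for \<open>j = st i\<close>.\<close>

lemma s_square:
  assumes "i \<in> I" "j \<in> I"
  shows "(\<Sum>k\<in>I. s i k * s k j) = (if j = st i then of_real D else 0)"
proof -
  have "(\<Sum>k\<in>I. s i k * s k j) = (\<Sum>k\<in>I. \<Sum>l\<in>I. of_real (N i j l) * (d k * s k l))"
    using s_mult[OF _ assms] by (simp add: s_sym[of i] sum_distrib_left mult_ac)
  also have "\<dots> = (\<Sum>l\<in>I. \<Sum>k\<in>I. of_real (N i j l) * (d k * s k l))"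
    by (rule sum.swap)
  also have "\<dots> = (\<Sum>l\<in>I. of_real (N i j l) * (if l = u then of_real D else 0))"
    using sum_d_s by (simp add: sum_distrib_left[symmetric])
  also have "\<dots> = of_real (N i j u) * of_real D"
    using finite_I u_in by (simp add: if_distrib[of "\<lambda>x. _ * x"] cong: if_cong)
  finally show ?thesis
    using N_unit[OF assms] by simp
qed

lemma d_square_ge_1:
  assumes "i \<in> I"
  shows "d i * d (st i) = 1 + (\<Sum>l\<in>I - {u}. N i (st i) l * d l)"
proof -
  have "d i * d (st i) = (\<Sum>l\<in>I. N i (st i) l * d l)"
    by (rule d_mult[OF assms st_in[OF assms]])
  also have "\<dots> = N i (st i) u * d u + (\<Sum>l\<in>I - {u}. N i (st i) l * d l)"
    by (rule sum.remove[OF finite_I u_in])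
  finally show ?thesis
    using N_unit[OF assms st_in[OF assms]] d_unit by simp
qed

lemma d_ge_1:
  assumes "i \<in> I"
  shows "d i \<ge> 1"
proof -
  have "(\<Sum>l\<in>I - {u}. N i (st i) l * d l) \<ge> 0"
    using N_nonneg d_pos by (intro sum_nonneg) (auto simp: less_imp_le)
  then have "(d i)\<^sup>2 \<ge> 1\<^sup>2"
    using d_square_ge_1[OF assms] d_star[OF assms] by (simp add: power2_eq_square)
  then show ?thesis
    by (rule power2_le_imp_le[OF _ less_imp_le[OF d_pos[OF assms]]])
qed

text \<open>When \<open>d g = 1\<close> the unit already accounts for the whole dimension of the
  product of \<open>g\<close> and \<open>st g\<close>, and the remaining terms are
  non-negative.\<close>

lemma N_invertible:
  assumes g: "g \<in> I" "d g = 1" and l: "l \<in> I" "l \<noteq> u"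
  shows "N g (st g) l = 0"
proof -
  have "(\<Sum>l\<in>I - {u}. N g (st g) l * d l) = 0"
    using d_square_ge_1[OF g(1)] d_star[OF g(1)] g(2) by simp
  then have "\<forall>l\<in>I - {u}. N g (st g) l * d l = 0"
    using finite_I N_nonneg d_pos by (subst (asm) sum_nonneg_eq_0_iff) (auto simp: less_imp_le)
  then show ?thesis
    using l d_pos[OF l(1)] by auto
qed

theorem invertible_centralizes_adjoint:
  assumes g: "g \<in> I" "d g = 1" and k: "k \<in> I" and l: "l \<in> I" "N k (st k) l \<noteq> 0"
  shows "s g l = d g * d l"
proof -
  \<comment> \<open>The product of \<open>g\<close> and \<open>st g\<close> is the unit, and
    characters turn \<open>st\<close> into conjugation; so every normalised row has modulus 1 at
    \<open>g\<close>.\<close>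
  have norm_s: "cmod (s g m) = d m" if m: "m \<in> I" for m
  proof -
    have "chi m g * chi m (st g) = (\<Sum>l\<in>I. of_real (N g (st g) l) * chi m l)"
      using character_chi[OF m] g(1) st_in[OF g(1)] by (simp add: character_def)
    also have "\<dots> = (\<Sum>l\<in>I. if l = u then chi m u else 0)"
      using N_invertible[OF g] N_unit[OF g(1) st_in[OF g(1)]] by (intro sum.cong) auto
    also have "\<dots> = 1"
      using finite_I u_in s_sym[of m u] s_unit[OF m] d_pos[OF m] by (simp add: chi_def)
    finally have "complex_of_real ((cmod (chi m g))\<^sup>2) = 1"
      using chi_star[OF m g(1)] by (simp add: complex_norm_square del: of_real_power)
    then have "(cmod (chi m g))\<^sup>2 = 1\<^sup>2"
      by (simp only: of_real_eq_1_iff) simp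
    then have "cmod (chi m g) = 1"
      by (metis norm_ge_zero power2_eq_iff_nonneg zero_le_one)
    then show ?thesis
      using d_pos[OF m] by (simp add: chi_def norm_divide s_sym[of g] field_simps)
  qed
  have "(\<Sum>l\<in>I. of_real (N k (st k) l) * s g l) = s g k * s g (st k)"
    using s_mult[OF g(1) k st_in[OF k]] g(2) by simp
  also have "\<dots> = of_real ((cmod (s g k))\<^sup>2)"
    using s_star[OF g(1) k] by (simp add: complex_norm_square del: of_real_power)
  also have "(cmod (s g k))\<^sup>2 = (\<Sum>l\<in>I. N k (st k) l * d l)"
    using norm_s[OF k] d_mult[OF k st_in[OF k]] d_star[OF k] by (simp add: power2_eq_square)
  \<comment> \<open>On both sides the weights are the same and non-negative, while
    \<open>Re (s g l)\<close> is at most \<open>cmod (s g l) = d l\<close>. Equality of the sums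
    therefore forces equality wherever the weight is positive.\<close>
  finally have "Re (\<Sum>l\<in>I. of_real (N k (st k) l) * s g l) = (\<Sum>l\<in>I. N k (st k) l * d l)"
    by simp
  then have "(\<Sum>l\<in>I. N k (st k) l * (d l - Re (s g l))) = 0"
    by (simp add: right_diff_distrib sum_subtractf)
  moreover have nn: "N k (st k) l * (d l - Re (s g l)) \<ge> 0" if "l \<in> I" for l
    using N_nonneg norm_s[OF that] complex_Re_le_cmod[of "s g l"] by (intro mult_nonneg_nonneg) auto
  ultimately have "\<forall>l\<in>I. N k (st k) l * (d l - Re (s g l)) = 0"
    using sum_nonneg_eq_0_iff[OF finite_I nn, simplified] by simp
  then have "N k (st k) l * (d l - Re (s g l)) = 0"
    using l(1) by (rule bspec)
  then have re: "Re (s g l) = d l"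
    using l(2) by simp
  then have "Im (s g l) = 0"
    using cmod_power2[of "s g l"] norm_s[OF l(1)] by simp
  then show ?thesis
    using re g(2) by (simp add: complex_eq_iff)
qed

lemma centralizer_adjoint_invertible:
  assumes J: "\<And>k l. \<lbrakk>k \<in> I; l \<in> I; N k (st k) l \<noteq> 0\<rbrakk> \<Longrightarrow> l \<in> J"
    and i: "i \<in> I" and c: "\<And>j. \<lbrakk>j \<in> I; j \<in> J\<rbrakk> \<Longrightarrow> s i j = d i * d j"
  shows "d i = 1"
proof -
  \<comment> \<open>The product expands over the constituents of \<open>k\<close> and
    \<open>st k\<close>. All of them lie in \<open>J\<close>, where \<open>s i l\<close> may be
    replaced by \<open>d i * d l\<close>.\<close>
  have sq: "s i k * s k (st i) = of_real ((d i)\<^sup>2 * (d k)\<^sup>2)" if k: "k \<in> I" for k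
  proof -
    have "s i k * s k (st i) = s i k * s i (st k)"
      using s_star_left[OF i k] s_star[OF i k] s_sym[of k "st i"] by simp
    also have "\<dots> = d i * (\<Sum>l\<in>I. of_real (N k (st k) l) * s i l)"
      by (rule s_mult[OF i k st_in[OF k]])
    also have "(\<Sum>l\<in>I. of_real (N k (st k) l) * s i l) = (\<Sum>l\<in>I. of_real (N k (st k) l) * of_real (d i * d l))"
    proof (rule sum.cong[OF refl])
      fix l assume l: "l \<in> I"
      show "complex_of_real (N k (st k) l) * s i l = of_real (N k (st k) l) * of_real (d i * d l)"
        using c[OF l J[OF k l]] by (cases "N k (st k) l = 0") auto
    qed
    also have "\<dots> = of_real (d i * (\<Sum>l\<in>I. N k (st k) l * d l))"
      by (simp add: sum_distrib_left mult_ac)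
    also have "(\<Sum>l\<in>I. N k (st k) l * d l) = (d k)\<^sup>2"
      using d_mult[OF k st_in[OF k]] d_star[OF k] by (simp add: power2_eq_square)
    finally show ?thesis
      by (simp add: power2_eq_square mult_ac)
  qed
  have "complex_of_real D = (\<Sum>k\<in>I. s i k * s k (st i))"
    using s_square[OF i st_in[OF i]] by simp
  also have "\<dots> = of_real ((d i)\<^sup>2 * D)"
    using sq by (simp add: D_def sum_distrib_left)
  finally have "D = (d i)\<^sup>2 * D"
    using of_real_eq_iff by blast
  then have "(d i)\<^sup>2 = 1"
    using D_pos by simp
  then show ?thesis
    using d_pos[OF i] by (simp add: power2_eq_1_iff)
qed

text \<open>The element \<open>\<Sum>\<^sub>j\<^sub>\<in>\<^sub>J d\<^sub>j j\<close> is killed by all characters that differ from \<open>d\<close> on \<open>J\<close>. Applying the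
  S-matrix to the vector of its values recovers the indicator function of \<open>J\<close>.\<close>

theorem double_centralizer:
  assumes J: "closed_set J" and w: "w \<in> I"
    and c: "\<And>i. \<lbrakk>i \<in> I; \<And>j. j \<in> J \<Longrightarrow> s i j = d i * d j\<rbrakk> \<Longrightarrow> s w i = d w * d i"
  shows "w \<in> J"
proof (rule ccontr)
  assume nw: "w \<notin> J"
  have JI: "k \<in> I" and Jst: "st k \<in> J" if "k \<in> J" for k
    using closed_setD(3,4)[OF J that] by auto
  have finJ: "finite J" and uJ: "u \<in> J"
    using closed_setD(1,2)[OF J] finite_subset[OF _ finite_I] by auto
  define J' where "J' = {i \<in> I. \<forall>j\<in>J. s i j = d i * d j}"
  define DJ where "DJ = (\<Sum>j\<in>J. (d j)\<^sup>2)"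
  have DJ_pos: "DJ > 0"
    unfolding DJ_def using finJ uJ by (intro sum_pos zero_less_power d_pos JI) auto
  \<comment> \<open>Inside \<open>J'\<close> the characters \<open>chi i\<close> and
    \<open>d\<close> agree on \<open>J\<close>, so their pairing is \<open>DJ\<close>; outside
    \<open>J'\<close> they differ somewhere on \<open>J\<close> and are orthogonal there.\<close>
  have Q: "(\<Sum>j\<in>J. s i j * of_real (d j)) = (if i \<in> J' then of_real (d i * DJ) else 0)" if i: "i \<in> I" for i
  proof (cases "i \<in> J'")
    case True
    then have "(\<Sum>j\<in>J. s i j * of_real (d j)) = (\<Sum>j\<in>J. of_real (d i * (d j)\<^sup>2))"
      by (intro sum.cong) (auto simp: J'_def power2_eq_square)
    then show ?thesis
      using True by (simp add: DJ_def sum_distrib_left)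
  next
    case False
    then obtain l where l: "l \<in> J" "s i l \<noteq> d i * d l"
      using i by (auto simp: J'_def)
    then have "chi i l \<noteq> of_real (d l)"
      using d_pos[OF i] by (auto simp: chi_def field_simps)
    then have "(\<Sum>j\<in>J. chi i j * of_real (d (st j))) = 0"
      using characters_orthogonal[OF J character_subset[OF J character_chi[OF i]] character_subset[OF J character_d] l(1)]
      by simp
    then have "(\<Sum>j\<in>J. s i j * of_real (d j)) / of_real (d i) = 0"
      using d_star[OF JI] by (simp add: chi_def sum_divide_distrib)
    then show ?thesis
      using False d_pos[OF i] by simp
  qed
  \<comment> \<open>The double sum is evaluated in two ways. Summing over \<open>i\<close> first
    gives zero, since \<open>st w\<close> does not lie in \<open>J\<close>; summing over
    \<open>j\<close> first leaves the positive contributions of \<open>J'\<close>, by the hypothesis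
    on \<open>w\<close>.\<close>
  have "(\<Sum>i\<in>I. s w i * (\<Sum>j\<in>J. s i j * of_real (d j))) = (\<Sum>i\<in>I. \<Sum>j\<in>J. (s w i * s i j) * of_real (d j))"
    by (simp add: sum_distrib_left mult_ac)
  also have "\<dots> = (\<Sum>j\<in>J. (\<Sum>i\<in>I. s w i * s i j) * of_real (d j))"
    by (subst sum.swap) (simp add: sum_distrib_right)
  also have "\<dots> = 0"
  proof (rule sum.neutral, rule ballI)
    fix j assume j: "j \<in> J"
    have "j \<noteq> st w"
      using Jst[OF j] nw st_st[OF w] by auto
    then show "(\<Sum>i\<in>I. s w i * s i j) * complex_of_real (d j) = 0"
      using s_square[OF w JI[OF j]] by simp
  qed
  also have "(\<Sum>i\<in>I. s w i * (\<Sum>j\<in>J. s i j * of_real (d j))) = (\<Sum>i\<in>I. if i \<in> J' then of_real (d w * (d i)\<^sup>2 * DJ) else 0)"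
  proof (rule sum.cong[OF refl])
    fix i assume i: "i \<in> I"
    show "s w i * (\<Sum>j\<in>J. s i j * of_real (d j)) = (if i \<in> J' then of_real (d w * (d i)\<^sup>2 * DJ) else 0)"
      using Q[OF i] c[OF i] by (auto simp: J'_def power2_eq_square)
  qed
  also have "\<dots> = of_real (\<Sum>i\<in>I. if i \<in> J' then d w * (d i)\<^sup>2 * DJ else 0)"
    by (simp add: if_distrib[of complex_of_real] cong: if_cong)
  finally have "(\<Sum>i\<in>I. if i \<in> J' then d w * (d i)\<^sup>2 * DJ else 0) = 0"
    using of_real_eq_0_iff by blast
  moreover have "u \<in> J'"
    using u_in s_unit JI d_unit by (auto simp: J'_def)
  then have "(\<Sum>i\<in>I. if i \<in> J' then d w * (d i)\<^sup>2 * DJ else 0) > 0"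
    using finite_I u_in d_pos[OF w] d_unit DJ_pos by (intro sum_pos2[of _ u]) auto
  ultimately show False
    by simp
qed

end

section \<open>Fusion subcategories and centralizers\<close>

context linear_category
begin

lemma biproduct_singleton_isomorphic:
  assumes b: "biproduct X A F i p" and A: "A = {a}"
  shows "isomorphic (F a) X"
proof -
  note bD = biproductD[OF b, unfolded A]
  have "inverses (F a) X (i a) (p a)"
    unfolding inverses_def using bD(2,3,4)[of a] bD(6) by simp
  then show ?thesis
    by (auto simp: isomorphic_def is_iso_def)
qed

end

context fusion_category
begin

lemma generated_subcategory_superset: "S \<subseteq> generated_subcategory S"
  by (auto simp: generated_subcategory_def)

lemma generated_subcategory_least: "\<lbrakk>fusion_subcategory D; S \<subseteq> D\<rbrakk> \<Longrightarrow> generated_subcategory S \<subseteq> D"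
  by (auto simp: generated_subcategory_def)

lemma fusion_subcategoryD:
  assumes "fusion_subcategory D"
  shows "\<one>\<^sub>o \<in> D" "\<lbrakk>X \<in> D; Y \<in> D\<rbrakk> \<Longrightarrow> X \<otimes>\<^sub>o Y \<in> D" "X \<in> D \<Longrightarrow> dual X \<in> D"
    "\<lbrakk>set Xs \<subseteq> D; is_direct_sum X Xs\<rbrakk> \<Longrightarrow> X \<in> D" "\<lbrakk>Y \<in> D; is_mono X Y f\<rbrakk> \<Longrightarrow> X \<in> D"
  using assms unfolding fusion_subcategory_def by blast+

lemma fusion_subcategory_iso:
  assumes "fusion_subcategory D" "X \<in> D" "isomorphic X Y"
  shows "Y \<in> D"
  using isomorphic_sym[OF assms(3)] fusion_subcategoryD(5)[OF assms(1,2)] iso_is_mono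
  unfolding isomorphic_def by blast

lemma constituent_mono:
  assumes "Z \<in> Irr" "obj_class X Z \<noteq> 0"
  shows "\<exists>f. is_mono Z X f"
  using assms obj_class_nonzero_iff nonzero_from_simple_is_mono[OF Irr_simple] by metis

lemma obj_class_mono:
  assumes Z: "Z \<in> Irr" "obj_class X Z \<noteq> 0" and f: "is_mono X Y f"
  shows "obj_class Y Z \<noteq> 0"
proof -
  obtain g where g: "g \<in> Hom Z X" "g \<noteq> 0"
    using Z obj_class_nonzero_iff by blast
  have fH: "f \<in> Hom X Y"
    using f by (simp add: is_mono_def)
  have "f \<bullet> g \<noteq> 0"
    using f g comp_zero_right[OF fH] zero_in_Hom[of Z X] unfolding is_mono_def by metis
  then show ?thesis
    using obj_class_nonzero_iff[OF Z(1)] comp_in_Hom[OF fH g(1)] by blast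
qed

text \<open>Every simple summand of \<open>X\<close> must be isomorphic to \<open>Z\<close>, and the
  multiplicity 1 leaves room for a single summand.\<close>

lemma isomorphic_of_obj_class:
  assumes Z: "Z \<in> Irr" and X: "obj_class X = obj_class Z"
  shows "isomorphic X Z"
proof -
  obtain A F i p where b: "biproduct X (A::nat set) F i p" "\<And>a. a \<in> A \<Longrightarrow> simple (F a)"
    using semisimple_biproduct by blast
  have fin: "finite A"
    using biproductD(1)[OF b(1)] .
  have all: "isomorphic (F a) Z" if a: "a \<in> A" for a
  proof -
    note r = rep[OF b(2)[OF a]]
    have "a \<in> {a' \<in> A. isomorphic (F a') (rep (F a))}"
      using a r by simp
    then have "card {a' \<in> A. isomorphic (F a') (rep (F a))} \<noteq> 0"
      using fin by auto
    then have "obj_class X (rep (F a)) \<noteq> 0"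
      using obj_class_biproduct_simple[OF b r(1)] by simp
    then have "Z = rep (F a)"
      using X obj_class_Irr[OF Z r(1)] by (auto split: if_splits)
    then show ?thesis
      using r(2) by simp
  qed
  have "int (card {a \<in> A. isomorphic (F a) Z}) = 1"
    using obj_class_biproduct_simple[OF b Z] X obj_class_Irr[OF Z Z] by simp
  moreover have "{a \<in> A. isomorphic (F a) Z} = A"
    using all by auto
  ultimately obtain a where "A = {a}"
    by (metis card_1_singletonE of_nat_eq_1_iff)
  then show ?thesis
    using biproduct_singleton_isomorphic[OF b(1)] all isomorphic_sym isomorphic_trans by blast
qed

text \<open>The objects all of whose simple constituents lie in \<open>J\<close>. Membership depends
  on the class only, so invariance under isomorphism is built in.\<close>

definition isotypic :: "'o set \<Rightarrow> 'o set" where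
  "isotypic J = {X. \<forall>Z\<in>Irr. obj_class X Z \<noteq> 0 \<longrightarrow> Z \<in> J}"

end

context ribbon_fusion_category
begin

text \<open>Yields upper bounds for generated subcategories from closure conditions on
  representatives of simple objects alone.\<close>

lemma fusion_subcategory_isotypic:
  assumes u: "rep \<one>\<^sub>o \<in> J" and st: "\<And>i. i \<in> J \<Longrightarrow> star i \<in> J"
    and N: "\<And>i j k. \<lbrakk>i \<in> J; j \<in> J; k \<in> Irr; obj_class (i \<otimes>\<^sub>o j) k \<noteq> 0\<rbrakk> \<Longrightarrow> k \<in> J"
  shows "fusion_subcategory (isotypic J)"
  unfolding fusion_subcategory_def
proof (intro conjI allI ballI impI)
  have "Z \<in> J" if "Z \<in> Irr" "obj_class \<one>\<^sub>o Z \<noteq> 0" for Z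
  proof -
    have "obj_class (rep \<one>\<^sub>o) Z \<noteq> 0"
      using that obj_class_iso[OF rep(2)[OF unit_simple]] by simp
    then have "rep \<one>\<^sub>o = Z"
      using obj_class_Irr[OF rep(1)[OF unit_simple] that(1)] by (auto split: if_splits)
    then show ?thesis
      using u by simp
  qed
  then show "\<one>\<^sub>o \<in> isotypic J"
    by (simp add: isotypic_def)
  show "X \<otimes>\<^sub>o Y \<in> isotypic J" if XY: "X \<in> isotypic J" "Y \<in> isotypic J" for X Y
    unfolding isotypic_def
  proof (intro CollectI ballI impI)
    fix Z assume Z: "Z \<in> Irr" "obj_class (X \<otimes>\<^sub>o Y) Z \<noteq> 0"
    then have "(\<Sum>V\<in>Irr. \<Sum>W\<in>Irr. obj_class X V * obj_class Y W * obj_class (V \<otimes>\<^sub>o W) Z) \<noteq> 0"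
      by (subst (asm) obj_class_tensor)
    then obtain V where V: "V \<in> Irr" "(\<Sum>W\<in>Irr. obj_class X V * obj_class Y W * obj_class (V \<otimes>\<^sub>o W) Z) \<noteq> 0"
      using sum.not_neutral_contains_not_neutral by blast
    then obtain W where W: "W \<in> Irr" "obj_class X V * obj_class Y W * obj_class (V \<otimes>\<^sub>o W) Z \<noteq> 0"
      using sum.not_neutral_contains_not_neutral by blast
    then have "V \<in> J" "W \<in> J"
      using XY V(1) by (auto simp: isotypic_def)
    then show "Z \<in> J"
      using N[OF _ _ Z(1)] W(2) by auto
  qed
  show "dual X \<in> isotypic J" if X: "X \<in> isotypic J" for X
    unfolding isotypic_def
  proof (intro CollectI ballI impI)
    fix Z assume Z: "Z \<in> Irr" "obj_class (dual X) Z \<noteq> 0"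
    then have "obj_class X (star Z) \<noteq> 0"
      using obj_class_dual[OF star_in_Irr[OF Z(1)], of X] star_star[OF Z(1)] by simp
    then have "star Z \<in> J"
      using X star_in_Irr[OF Z(1)] by (simp add: isotypic_def)
    then show "Z \<in> J"
      using st star_star[OF Z(1)] by metis
  qed
  show "X \<in> isotypic J" if X: "set Xs \<subseteq> isotypic J \<and> is_direct_sum X Xs" for X Xs
    unfolding isotypic_def
  proof (intro CollectI ballI impI)
    fix Z assume Z: "Z \<in> Irr" "obj_class X Z \<noteq> 0"
    obtain i p where "biproduct X {..<length Xs} (nth Xs) i p"
      using X by (auto simp: is_direct_sum_iff)
    then have "(\<Sum>j<length Xs. obj_class (Xs ! j) Z) \<noteq> 0"
      using Z(2) obj_class_biproduct by metis
    then obtain j where "j < length Xs" "obj_class (Xs ! j) Z \<noteq> 0"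
      using sum.not_neutral_contains_not_neutral by blast
    then show "Z \<in> J"
      using X Z(1) nth_mem unfolding isotypic_def by blast
  qed
  show "X \<in> isotypic J" if X: "Y \<in> isotypic J \<and> is_mono X Y f" for X Y f
    using X obj_class_mono unfolding isotypic_def by blast
qed

lemma fusion_subcategory_star:
  assumes D: "fusion_subcategory D" and i: "i \<in> Irr" "i \<in> D"
  shows "star i \<in> D"
  using fusion_subcategory_iso[OF D fusion_subcategoryD(3)[OF D i(2)] isomorphic_star[OF Irr_simple[OF i(1)]]] .

lemma fusion_subcategory_constituent:
  assumes D: "fusion_subcategory D" and X: "X \<in> D" and k: "k \<in> Irr" "obj_class X k \<noteq> 0"
  shows "k \<in> D"
  using constituent_mono[OF k] fusion_subcategoryD(5)[OF D X] by blast

end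

section \<open>Arithmetic in the field generated by the S-matrix\<close>

context ribbon_fusion_category
begin

context
  fixes \<iota> :: "'k \<Rightarrow> complex"
  assumes emb: "is_complex_embedding \<iota>"
begin

lemma smatrix_in_field: "\<lbrakk>X \<in> Irr; Y \<in> Irr\<rbrakk> \<Longrightarrow> smatrix X Y \<in> smatrix_field"
  unfolding smatrix_field_def by (rule generate_field.incl) blast

lemma field_add: "\<lbrakk>a \<in> smatrix_field; b \<in> smatrix_field\<rbrakk> \<Longrightarrow> a + b \<in> smatrix_field"
  unfolding smatrix_field_def
  using generate_field.eng_add[of a ring_of_type_algebra _ b] by (simp add: ring_of_type_algebra_def)

lemma field_mult: "\<lbrakk>a \<in> smatrix_field; b \<in> smatrix_field\<rbrakk> \<Longrightarrow> a * b \<in> smatrix_field"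
  unfolding smatrix_field_def
  using generate_field.eng_mult[of a ring_of_type_algebra _ b] by (simp add: ring_of_type_algebra_def)

lemma field_one: "1 \<in> smatrix_field"
  unfolding smatrix_field_def
  using generate_field.one[of ring_of_type_algebra] by (simp add: ring_of_type_algebra_def)

lemma field_uminus: "a \<in> smatrix_field \<Longrightarrow> - a \<in> smatrix_field"
proof -
  assume a: "a \<in> smatrix_field"
  interpret R: Ring.field "ring_of_type_algebra :: 'k ring"
    by (rule field_from_type_algebra)
  have "\<ominus>\<^bsub>ring_of_type_algebra\<^esub> a = - a"
    by (rule R.minus_equality) (auto simp: ring_of_type_algebra_def)
  then show ?thesis
    using generate_field.a_inv[OF a[unfolded smatrix_field_def]] by (simp add: smatrix_field_def)
qed

lemma field_inverse: "\<lbrakk>a \<in> smatrix_field; a \<noteq> 0\<rbrakk> \<Longrightarrow> inverse a \<in> smatrix_field"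
proof -
  assume a: "a \<in> smatrix_field" "a \<noteq> 0"
  interpret R: Ring.field "ring_of_type_algebra :: 'k ring"
    by (rule field_from_type_algebra)
  have "inv\<^bsub>ring_of_type_algebra\<^esub> a = inverse a"
    using a(2) by (intro R.comm_inv_char) (auto simp: ring_of_type_algebra_def)
  moreover have "\<zero>\<^bsub>(ring_of_type_algebra :: 'k ring)\<^esub> = 0"
    by (simp add: ring_of_type_algebra_def)
  ultimately show ?thesis
    using generate_field.m_inv[OF a(1)[unfolded smatrix_field_def]] a(2) by (simp add: smatrix_field_def)
qed

lemma field_zero: "0 \<in> smatrix_field"
  using field_add[OF field_one field_uminus[OF field_one]] by simp

text \<open>The map is a homomorphism on \<open>smatrix_field\<close> only, which is why membership
  is tracked throughout.\<close>

lemma iota_add: "\<lbrakk>a \<in> smatrix_field; b \<in> smatrix_field\<rbrakk> \<Longrightarrow> \<iota> (a + b) = \<iota> a + \<iota> b"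
  and iota_mult: "\<lbrakk>a \<in> smatrix_field; b \<in> smatrix_field\<rbrakk> \<Longrightarrow> \<iota> (a * b) = \<iota> a * \<iota> b"
  and iota_one: "\<iota> 1 = 1"
  using emb unfolding is_complex_embedding_def ring_hom_def ring_of_type_algebra_def by auto

lemma iota_zero: "\<iota> 0 = 0"
  using iota_add[OF field_zero field_zero] by simp

lemma iota_uminus: "a \<in> smatrix_field \<Longrightarrow> \<iota> (- a) = - \<iota> a"
  using iota_add[of a "- a"] field_uminus[of a] iota_zero by (simp add: eq_neg_iff_add_eq_0 add.commute)

text \<open>A non-zero difference would have an inverse within \<open>smatrix_field\<close>, and its
  image could not vanish.\<close>

lemma iota_inj:
  assumes "a \<in> smatrix_field" "b \<in> smatrix_field" "\<iota> a = \<iota> b"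
  shows "a = b"
proof (rule ccontr)
  assume "a \<noteq> b"
  then have ab: "a + - b \<noteq> 0" "a + - b \<in> smatrix_field"
    using field_add[OF assms(1) field_uminus[OF assms(2)]] by auto
  have "\<iota> (a + - b) = 0"
    using iota_add[OF assms(1) field_uminus[OF assms(2)]] iota_uminus[OF assms(2)] assms(3) by simp
  moreover have "\<iota> ((a + - b) * inverse (a + - b)) = \<iota> (a + - b) * \<iota> (inverse (a + - b))"
    by (rule iota_mult[OF ab(2) field_inverse[OF ab(2,1)]])
  ultimately show False
    using iota_one ab(1) by simp
qed

lemma of_nat_in_field: "of_nat n \<in> smatrix_field" and iota_of_nat: "\<iota> (of_nat n) = of_nat n"
proof -
  have "of_nat n \<in> smatrix_field \<and> \<iota> (of_nat n) = of_nat n"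
    by (induction n) (auto simp: field_zero iota_zero iota_one iota_add[OF field_one] field_add[OF field_one])
  then show "of_nat n \<in> smatrix_field" "\<iota> (of_nat n) = of_nat n"
    by auto
qed

lemma iota_sum:
  assumes "\<And>a. a \<in> A \<Longrightarrow> f a \<in> smatrix_field"
  shows "\<iota> (\<Sum>a\<in>A. f a) = (\<Sum>a\<in>A. \<iota> (f a))" and sum_in_field: "(\<Sum>a\<in>A. f a) \<in> smatrix_field"
proof -
  have "\<iota> (\<Sum>a\<in>A. f a) = (\<Sum>a\<in>A. \<iota> (f a)) \<and> (\<Sum>a\<in>A. f a) \<in> smatrix_field"
    using assms by (induction A rule: infinite_finite_induct) (auto simp: iota_zero field_zero iota_add field_add)
  then show "\<iota> (\<Sum>a\<in>A. f a) = (\<Sum>a\<in>A. \<iota> (f a))" "(\<Sum>a\<in>A. f a) \<in> smatrix_field"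
    by auto
qed

end

end

section \<open>Frobenius-Perron dimensions of arbitrary objects\<close>

context fusion_category
begin

context
  fixes \<phi> :: "('o \<Rightarrow> int) \<Rightarrow> real"
  assumes FP: "is_FPdim_hom \<phi>"
begin

lemma phi_hom: "\<phi> \<in> ring_hom K0 ring_of_type_algebra"
  using FP by (simp add: is_FPdim_hom_def)

lemma phi_pos: "simple X \<Longrightarrow> \<phi> (obj_class X) > 0"
  using FP by (simp add: is_FPdim_hom_def)

lemma phi_tensor: "\<phi> (obj_class (X \<otimes>\<^sub>o Y)) = \<phi> (obj_class X) * \<phi> (obj_class Y)"
  using ring_hom_mult[OF phi_hom obj_class_in_carrier obj_class_in_carrier] obj_class_tensor_K0
  by (simp add: ring_of_type_algebra_def)

lemma phi_unit: "\<phi> (obj_class \<one>\<^sub>o) = 1"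
  using ring_hom_one[OF phi_hom] by (simp add: ring_of_type_algebra_def K0_def)

lemma phi_add:
  assumes "\<And>Z. Z \<notin> Irr \<Longrightarrow> a Z = 0" "\<And>Z. Z \<notin> Irr \<Longrightarrow> b Z = 0"
  shows "\<phi> (\<lambda>Z. a Z + b Z) = \<phi> a + \<phi> b"
  using ring_hom_add[OF phi_hom, of a b] assms by (simp add: ring_of_type_algebra_def K0_def)

lemma phi_zero: "\<phi> (\<lambda>Z. 0) = 0"
  using phi_add[of "\<lambda>Z. 0" "\<lambda>Z. 0"] by simp

lemma phi_of_nat_mult: "\<phi> (\<lambda>Z. int n * obj_class X Z) = real n * \<phi> (obj_class X)"
proof (induction n)
  case (Suc n)
  then show ?case
    using phi_add[of "obj_class X" "\<lambda>Z. int n * obj_class X Z"] by (simp add: distrib_right)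
qed (simp add: phi_zero)

text \<open>The class is assembled from one simple object at a time, over growing subsets of
  \<open>Irr\<close>; additivity of \<open>\<phi>\<close> is available at each stage because all
  functions involved vanish outside \<open>Irr\<close>.\<close>

lemma phi_obj_class:
  "\<phi> (obj_class X) = (\<Sum>Z\<in>Irr. real_of_int (obj_class X Z) * \<phi> (obj_class Z))"
proof -
  have "\<phi> (\<lambda>Z. if Z \<in> A then obj_class X Z else 0) = (\<Sum>Z\<in>A. real_of_int (obj_class X Z) * \<phi> (obj_class Z))"
    if "finite A" "A \<subseteq> Irr" for A
    using that
  proof (induction A rule: finite_induct)
    case (insert V A)
    let ?n = "nat (obj_class X V)"
    have n: "int ?n = obj_class X V"
      using obj_class_nonneg by simp
    have "(\<lambda>Z. if Z \<in> insert V A then obj_class X Z else 0) =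
        (\<lambda>Z. int ?n * obj_class V Z + (if Z \<in> A then obj_class X Z else 0))"
    proof
      fix Z
      show "(if Z \<in> insert V A then obj_class X Z else 0) = int ?n * obj_class V Z + (if Z \<in> A then obj_class X Z else 0)"
        unfolding n using insert.hyps(2) insert.prems obj_class_Irr[of V Z] by (cases "Z \<in> Irr") auto
    qed
    moreover have "\<phi> (\<lambda>Z. int ?n * obj_class V Z + (if Z \<in> A then obj_class X Z else 0)) =
        \<phi> (\<lambda>Z. int ?n * obj_class V Z) + \<phi> (\<lambda>Z. if Z \<in> A then obj_class X Z else 0)"
      by (rule phi_add) auto
    ultimately have "\<phi> (\<lambda>Z. if Z \<in> insert V A then obj_class X Z else 0) =
        real ?n * \<phi> (obj_class V) + (\<Sum>Z\<in>A. real_of_int (obj_class X Z) * \<phi> (obj_class Z))"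
      using insert phi_of_nat_mult[of ?n V] by (simp del: int_nat_eq)
    moreover have "real ?n = real_of_int (obj_class X V)"
      using n by (metis of_int_of_nat_eq)
    ultimately show ?case
      using insert.hyps by simp
  qed (simp add: phi_zero)
  from this[OF finite_Irr subset_refl] show ?thesis
    by (simp add: obj_class_def if_distrib cong: if_cong)
qed

end

end

section \<open>Comparison of the adjoint subcategory with the centralizer\<close>

context modular_category
begin

context
  fixes \<iota> :: "'k \<Rightarrow> complex" and \<phi> :: "('o \<Rightarrow> int) \<Rightarrow> real"
  assumes FP: "is_FPdim_hom \<phi>" and emb: "is_complex_embedding \<iota>" and can: "canonical_spherical \<iota> \<phi>"
begin

lemma iota_qdim: "X \<in> Irr \<Longrightarrow> \<iota> (qdim X) = of_real (\<phi> (obj_class X))"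
  using can by (simp add: canonical_spherical_def)

text \<open>The dimensions are the S-matrix entries of the unit row, by non-degeneracy.\<close>

lemma qdim_in_field: "X \<in> Irr \<Longrightarrow> qdim X \<in> smatrix_field"
  using smatrix_unit_left[OF nondegenerate] smatrix_in_field[OF emb rep(1)[OF unit_simple]] by metis

lemma modular_fusion_datum:
  "fusion_datum Irr (\<lambda>X Y Z. real_of_int (obj_class (X \<otimes>\<^sub>o Y) Z)) (rep \<one>\<^sub>o) star
     (\<lambda>X. \<phi> (obj_class X)) (\<lambda>X Y. \<iota> (smatrix X Y))"
proof
  fix X Y Z :: 'o
  show "finite Irr" "rep \<one>\<^sub>o \<in> Irr"
    using finite_Irr rep(1)[OF unit_simple] by auto
  show "star X \<in> Irr" "star (star X) = X" "\<phi> (obj_class X) > 0" if "X \<in> Irr"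
    using that star_in_Irr star_star phi_pos[OF FP Irr_simple] by auto
  show "real_of_int (obj_class (X \<otimes>\<^sub>o Y) Z) \<ge> 0"
    using obj_class_nonneg by simp
  show "real_of_int (obj_class (X \<otimes>\<^sub>o Y) (rep \<one>\<^sub>o)) = (if Y = star X then 1 else 0)" if "X \<in> Irr" "Y \<in> Irr"
    using obj_class_tensor_unit_Irr[OF that] by simp
  show "real_of_int (obj_class (X \<otimes>\<^sub>o Y) (star Z)) = real_of_int (obj_class (Y \<otimes>\<^sub>o Z) (star X))"
    and "real_of_int (obj_class (star X \<otimes>\<^sub>o star Y) (star Z)) = real_of_int (obj_class (X \<otimes>\<^sub>o Y) Z)"
    if "X \<in> Irr" "Y \<in> Irr" "Z \<in> Irr"
    using obj_class_tensor_rotate[OF that] obj_class_tensor_star[OF that] by auto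
  show "\<phi> (obj_class (rep \<one>\<^sub>o)) = 1"
    using phi_unit[OF FP] obj_class_iso[OF rep(2)[OF unit_simple]] by simp
  show "\<phi> (obj_class X) * \<phi> (obj_class Y) = (\<Sum>Z\<in>Irr. real_of_int (obj_class (X \<otimes>\<^sub>o Y) Z) * \<phi> (obj_class Z))"
    using phi_tensor[OF FP, of X Y] phi_obj_class[OF FP, of "X \<otimes>\<^sub>o Y"] by simp
  show "\<iota> (smatrix X Y) = \<iota> (smatrix Y X)"
    by (simp add: smatrix_sym)
  show "\<iota> (smatrix (rep \<one>\<^sub>o) X) = complex_of_real (\<phi> (obj_class X))" if "X \<in> Irr"
    using smatrix_unit_left[OF nondegenerate that] iota_qdim[OF that] by simp
  show "\<iota> (smatrix X Y) * \<iota> (smatrix X Z) = complex_of_real (\<phi> (obj_class X)) *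
      (\<Sum>V\<in>Irr. complex_of_real (real_of_int (obj_class (Y \<otimes>\<^sub>o Z) V)) * \<iota> (smatrix X V))"
    if X: "X \<in> Irr" and Y: "Y \<in> Irr" and Z: "Z \<in> Irr"
  proof -
    \<comment> \<open>The embedding is known to fix natural numbers; multiplicities are
      non-negative, so they may be rewritten as such.\<close>
    let ?n = "\<lambda>V. nat (obj_class (Y \<otimes>\<^sub>o Z) V)"
    have n: "of_int (obj_class (Y \<otimes>\<^sub>o Z) V) = (of_nat (?n V) :: 'k)"
      "complex_of_real (real_of_int (obj_class (Y \<otimes>\<^sub>o Z) V)) = of_nat (?n V)" for V
      using obj_class_nonneg[of "Y \<otimes>\<^sub>o Z" V] by simp_all
    have f: "of_nat (?n V) * smatrix X V \<in> smatrix_field" if "V \<in> Irr" for V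
      by (rule field_mult[OF emb of_nat_in_field[OF emb] smatrix_in_field[OF emb X that]])
    have sumF: "(\<Sum>V\<in>Irr. of_nat (?n V) * smatrix X V) \<in> smatrix_field"
      "\<iota> (\<Sum>V\<in>Irr. of_nat (?n V) * smatrix X V) = (\<Sum>V\<in>Irr. \<iota> (of_nat (?n V) * smatrix X V))"
      by (rule sum_in_field[OF emb f], assumption) (rule iota_sum[OF emb f])
    have "\<iota> (smatrix X Y) * \<iota> (smatrix X Z) = \<iota> (smatrix X Y * smatrix X Z)"
      using iota_mult[OF emb smatrix_in_field[OF emb X Y] smatrix_in_field[OF emb X Z]] by simp
    also have "\<dots> = \<iota> (qdim X * (\<Sum>V\<in>Irr. of_nat (?n V) * smatrix X V))"
      using smatrix_mult[OF Irr_simple[OF X], of Y Z] by (simp add: n)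
    also have "\<dots> = \<iota> (qdim X) * (\<Sum>V\<in>Irr. \<iota> (of_nat (?n V) * smatrix X V))"
      using iota_mult[OF emb qdim_in_field[OF X] sumF(1)] sumF(2) by simp
    also have "(\<Sum>V\<in>Irr. \<iota> (of_nat (?n V) * smatrix X V)) = (\<Sum>V\<in>Irr. of_nat (?n V) * \<iota> (smatrix X V))"
      using iota_mult[OF emb of_nat_in_field[OF emb] smatrix_in_field[OF emb X]] iota_of_nat[OF emb] by simp
    finally show ?thesis
      by (simp only: n iota_qdim[OF X])
  qed
  show "\<exists>Z\<in>Irr. complex_of_real (\<phi> (obj_class Y)) * \<iota> (smatrix X Z) \<noteq> complex_of_real (\<phi> (obj_class X)) * \<iota> (smatrix Y Z)"
    if X: "X \<in> Irr" and Y: "Y \<in> Irr" and XY: "X \<noteq> Y"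
  proof (rule ccontr)
    assume "\<not> ?thesis"
    then have eq: "\<iota> (qdim Y) * \<iota> (smatrix X Z) = \<iota> (qdim X) * \<iota> (smatrix Y Z)" if "Z \<in> Irr" for Z
      using that iota_qdim[OF X] iota_qdim[OF Y] by auto
    have "qdim Y * smatrix X Z = qdim X * smatrix Y Z" if Z: "Z \<in> Irr" for Z
      using eq[OF Z] iota_mult[OF emb qdim_in_field smatrix_in_field[OF emb]] X Y Z
      by (intro iota_inj[OF emb] field_mult[OF emb] qdim_in_field smatrix_in_field[OF emb]) simp_all
    \<comment> \<open>Pairing the proportional rows with the column \<open>X\<close> of the inverse
      matrix \<open>t\<close> gives 1 on one side and 0 on the other, hence
      \<open>qdim Y = 0\<close>.\<close>
    moreover obtain t where "\<forall>X\<in>Irr. \<forall>Y\<in>Irr.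
        (\<Sum>Z\<in>Irr. smatrix X Z * t Z Y) = (if X = Y then 1 else 0) \<and>
        (\<Sum>Z\<in>Irr. t X Z * smatrix Z Y) = (if X = Y then 1 else 0)"
      using nondegenerate unfolding smatrix_nondegenerate_def by blast
    then have t: "(\<Sum>Z\<in>Irr. smatrix X Z * t Z X) = 1" "(\<Sum>Z\<in>Irr. smatrix Y Z * t Z X) = 0"
      using X Y XY by auto
    ultimately have "(\<Sum>Z\<in>Irr. qdim Y * smatrix X Z * t Z X) = (\<Sum>Z\<in>Irr. qdim X * smatrix Y Z * t Z X)"
      by (intro sum.cong) auto
    then have "qdim Y = 0"
      using t by (simp add: sum_distrib_left[symmetric] mult.assoc)
    then show False
      using iota_qdim[OF Y] iota_zero[OF emb] phi_pos[OF FP Irr_simple[OF Y]] by simp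
  qed
qed

interpretation M: fusion_datum Irr "\<lambda>X Y Z. real_of_int (obj_class (X \<otimes>\<^sub>o Y) Z)" "rep \<one>\<^sub>o" star
  "\<lambda>X. \<phi> (obj_class X)" "\<lambda>X Y. \<iota> (smatrix X Y)"
  by (rule modular_fusion_datum)

lemma phi_ge_1: "X \<in> Irr \<Longrightarrow> \<phi> (obj_class X) \<ge> 1"
  by (rule M.d_ge_1)

lemma phi_constituent:
  assumes Z: "Z \<in> Irr" "obj_class X Z \<noteq> 0"
  shows "\<phi> (obj_class Z) \<le> \<phi> (obj_class X)"
proof -
  have "real_of_int (obj_class X Z) \<ge> 1"
    using obj_class_nonneg[of X Z] Z(2) by simp
  then have "1 * \<phi> (obj_class Z) \<le> real_of_int (obj_class X Z) * \<phi> (obj_class Z)"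
    using phi_ge_1[OF Z(1)] by (intro mult_right_mono) auto
  also have "\<dots> \<le> \<phi> (obj_class X)"
    unfolding phi_obj_class[OF FP, of X]
  proof (rule member_le_sum[OF Z(1) _ finite_Irr])
    fix V assume "V \<in> Irr - {Z}"
    then show "0 \<le> real_of_int (obj_class X V) * \<phi> (obj_class V)"
      using obj_class_nonneg[of X V] phi_pos[OF FP Irr_simple, of V] by simp
  qed
  finally show ?thesis
    by simp
qed

text \<open>A non-zero dimension forces a simple constituent. This is needed for invertible objects
  and their inverses, which are not known to be simple.\<close>

lemma phi_nonzero_ge_1:
  assumes "\<phi> (obj_class X) \<noteq> 0"
  shows "\<phi> (obj_class X) \<ge> 1"
proof -
  have "(\<Sum>Z\<in>Irr. real_of_int (obj_class X Z) * \<phi> (obj_class Z)) \<noteq> 0"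
    using assms phi_obj_class[OF FP, of X] by simp
  then obtain Z where "Z \<in> Irr" "real_of_int (obj_class X Z) * \<phi> (obj_class Z) \<noteq> 0"
    using sum.not_neutral_contains_not_neutral by blast
  then show ?thesis
    using phi_constituent[of Z X] phi_ge_1[of Z] by auto
qed

text \<open>The objects with all constituents of dimension 1 form a fusion subcategory: a
  constituent of a product of two such simple objects has dimension at most 1, and at least 1 like
  every simple object. It contains the invertible objects.\<close>

lemma pointed_constituent:
  assumes X: "X \<in> pointed_subcategory" and Z: "Z \<in> Irr" "obj_class X Z \<noteq> 0"
  shows "\<phi> (obj_class Z) = 1"
proof -
  let ?J = "{i \<in> Irr. \<phi> (obj_class i) = 1}"
  have "fusion_subcategory (isotypic ?J)"
  proof (rule fusion_subcategory_isotypic)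
    show "rep \<one>\<^sub>o \<in> ?J"
      using M.u_in M.d_unit by simp
    show "star i \<in> ?J" if "i \<in> ?J" for i
      using that M.d_star star_in_Irr by simp
    show "k \<in> ?J" if "i \<in> ?J" "j \<in> ?J" "k \<in> Irr" "obj_class (i \<otimes>\<^sub>o j) k \<noteq> 0" for i j k
      using that phi_constituent[of k "i \<otimes>\<^sub>o j"] phi_tensor[OF FP, of i j] phi_ge_1[of k] by simp
  qed
  moreover have "{X. invertible X} \<subseteq> isotypic ?J"
  proof
    fix X assume "X \<in> {X. invertible X}"
    then obtain Y where "isomorphic (X \<otimes>\<^sub>o Y) \<one>\<^sub>o"
      by (auto simp: invertible_def)
    then have XY: "\<phi> (obj_class X) * \<phi> (obj_class Y) = 1"
      using phi_tensor[OF FP, of X Y] obj_class_iso phi_unit[OF FP] by metis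
    then have "\<phi> (obj_class X) \<noteq> 0" "\<phi> (obj_class Y) \<noteq> 0"
      by auto
    then have "\<phi> (obj_class X) \<ge> 1" "\<phi> (obj_class Y) \<ge> 1"
      by (simp_all add: phi_nonzero_ge_1)
    then have "\<phi> (obj_class X) \<le> 1"
      using XY mult_left_mono[of 1 "\<phi> (obj_class Y)" "\<phi> (obj_class X)"] by simp
    then show "X \<in> isotypic ?J"
      using phi_constituent[of _ X] phi_ge_1 by (fastforce simp: isotypic_def)
  qed
  ultimately have "pointed_subcategory \<subseteq> isotypic ?J"
    unfolding pointed_subcategory_def by (rule generated_subcategory_least)
  then show ?thesis
    using X Z by (auto simp: isotypic_def)
qed

text \<open>By \<open>N_invertible\<close> the product of \<open>g\<close> and \<open>star g\<close>
  has the class of the unit, and equality with the class of a simple object yields an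
  isomorphism.\<close>

lemma invertible_if_phi_1:
  assumes g: "g \<in> Irr" "\<phi> (obj_class g) = 1"
  shows "invertible g"
proof -
  let ?u = "rep \<one>\<^sub>o"
  note u = rep[OF unit_simple]
  have "obj_class (g \<otimes>\<^sub>o star g) = obj_class ?u"
  proof
    fix Z
    show "obj_class (g \<otimes>\<^sub>o star g) Z = obj_class ?u Z"
      using M.N_invertible[OF g, of Z] obj_class_tensor_unit_Irr[OF g(1) star_in_Irr[OF g(1)]] obj_class_Irr[OF u(1), of Z]
      by (cases "Z \<in> Irr"; cases "Z = ?u") auto
  qed
  then have "isomorphic (g \<otimes>\<^sub>o star g) \<one>\<^sub>o"
    using isomorphic_of_obj_class[OF u(1)] u(2) isomorphic_sym isomorphic_trans by blast
  then show ?thesis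
    unfolding invertible_def using isomorphic_tensor_commute isomorphic_trans by blast
qed

text \<open>Translates the centralizing condition between the ground field with arbitrary simple
  objects and the complex numbers with representatives; it is an equivalence because the embedding
  is injective.\<close>

lemma smatrix_qdim_iff:
  assumes X: "simple X" and Y: "simple Y"
  shows "smatrix X Y = qdim X * qdim Y \<longleftrightarrow>
    \<iota> (smatrix (rep X) (rep Y)) = of_real (\<phi> (obj_class (rep X)) * \<phi> (obj_class (rep Y)))"
proof -
  note x = rep[OF X] and y = rep[OF Y]
  have "smatrix X Y = smatrix (rep X) (rep Y)"
    using smatrix_iso[OF x(2), of Y] smatrix_iso[OF y(2), of "rep X"] by (simp add: smatrix_sym)
  moreover have "qdim X * qdim Y = qdim (rep X) * qdim (rep Y)"
    using qdim_iso[OF x(2)] qdim_iso[OF y(2)] by simp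
  moreover have "\<iota> (qdim (rep X) * qdim (rep Y)) = of_real (\<phi> (obj_class (rep X)) * \<phi> (obj_class (rep Y)))"
    using iota_mult[OF emb qdim_in_field[OF x(1)] qdim_in_field[OF y(1)]] iota_qdim[OF x(1)] iota_qdim[OF y(1)] by simp
  moreover have "smatrix (rep X) (rep Y) = qdim (rep X) * qdim (rep Y) \<longleftrightarrow>
      \<iota> (smatrix (rep X) (rep Y)) = \<iota> (qdim (rep X) * qdim (rep Y))"
    by (rule iffI[OF arg_cong iota_inj[OF emb smatrix_in_field[OF emb x(1) y(1)]
          field_mult[OF emb qdim_in_field[OF x(1)] qdim_in_field[OF y(1)]]]])
  ultimately show ?thesis
    by (simp only:)
qed

lemma rep_Irr: "X \<in> Irr \<Longrightarrow> rep X = X"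
  using rep[OF Irr_simple] Irr_isomorphic_iff by metis

text \<open>The generators on the left are arbitrary subobjects of
  \<open>X \<otimes> dual X\<close>, those on the right simple objects. Hence a subobject is
  decomposed, and each simple summand is shown to centralize the pointed subcategory.\<close>

lemma adjoint_subset_centralizer: "adjoint_subcategory \<subseteq> centralizer pointed_subcategory"
  unfolding centralizer_def generated_subcategory_def
proof (rule Inter_greatest)
  fix D assume "D \<in> {D. fusion_subcategory D \<and>
    {X. simple X \<and> (\<forall>Y\<in>pointed_subcategory. simple Y \<longrightarrow> smatrix X Y = qdim X * qdim Y)} \<subseteq> D}"
  then have D: "fusion_subcategory D"
    "\<And>X. \<lbrakk>simple X; \<And>Y. \<lbrakk>Y \<in> pointed_subcategory; simple Y\<rbrakk> \<Longrightarrow> smatrix X Y = qdim X * qdim Y\<rbrakk> \<Longrightarrow> X \<in> D"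
    by auto
  show "adjoint_subcategory \<subseteq> D"
    unfolding adjoint_subcategory_def
  proof (rule generated_subcategory_least[OF D(1)], rule subsetI)
    fix Z assume "Z \<in> {Z. \<exists>X f. simple X \<and> is_mono Z (X \<otimes>\<^sub>o dual X) f}"
    then obtain X f where X: "simple X" and f: "is_mono Z (X \<otimes>\<^sub>o dual X) f"
      by blast
    note x = rep[OF X]
    obtain Zs where Zs: "\<forall>Y\<in>set Zs. simple Y" "is_direct_sum Z Zs"
      using semisimple by blast
    then obtain i p where b: "biproduct Z {..<length Zs} (nth Zs) i p"
      by (auto simp: is_direct_sum_iff)
    note bD = biproductD[OF b]
    have "set Zs \<subseteq> D"
    proof
      fix Y assume Ys: "Y \<in> set Zs"
      then obtain a where a: "a < length Zs" "Y = Zs ! a"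
        by (auto simp: in_set_conv_nth)
      have Y: "simple Y"
        using Zs Ys by blast
      note y = rep[OF Y]
      have "is_mono Y Z (i a)"
        using bD(2,3,4)[of a] a split_mono_is_mono by auto
      moreover have "obj_class Y (rep Y) \<noteq> 0"
        using obj_class_simple[OF Y y(1)] y(2) by simp
      ultimately have "obj_class (X \<otimes>\<^sub>o dual X) (rep Y) \<noteq> 0"
        using obj_class_mono[OF y(1)] f is_mono_comp by blast
      moreover have "isomorphic (X \<otimes>\<^sub>o dual X) (rep X \<otimes>\<^sub>o star (rep X))"
        using isomorphic_tensor[OF x(2)] isomorphic_dual[OF X x(2)] isomorphic_star[OF Irr_simple[OF x(1)]] isomorphic_trans
        by blast
      \<comment> \<open>Passing to representatives puts the constituent in the form required of the
        numerical datum.\<close>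
      ultimately have N: "real_of_int (obj_class (rep X \<otimes>\<^sub>o star (rep X)) (rep Y)) \<noteq> 0"
        using obj_class_iso by simp
      show "Y \<in> D"
      proof (rule D(2)[OF Y])
        fix W assume W: "W \<in> pointed_subcategory" "simple W"
        note w = rep[OF W(2)]
        have "\<phi> (obj_class (rep W)) = 1"
          using pointed_constituent[OF W(1) w(1)] obj_class_simple[OF W(2) w(1)] w(2) by simp
        from M.invertible_centralizes_adjoint[OF w(1) this x(1) y(1) N]
        have "smatrix W Y = qdim W * qdim Y"
          unfolding smatrix_qdim_iff[OF W(2) Y] .
        then show "smatrix Y W = qdim Y * qdim W"
          by (simp add: smatrix_sym mult.commute)
      qed
    qed
    then show "Z \<in> D"
      using fusion_subcategoryD(4)[OF D(1) _ Zs(2)] by blast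
  qed
qed

lemma centralizer_subset_adjoint: "centralizer pointed_subcategory \<subseteq> adjoint_subcategory"
  unfolding adjoint_subcategory_def generated_subcategory_def
proof (rule Inter_greatest)
  fix D assume "D \<in> {D. fusion_subcategory D \<and> {Z. \<exists>X f. simple X \<and> is_mono Z (X \<otimes>\<^sub>o dual X) f} \<subseteq> D}"
  then have D: "fusion_subcategory D" "\<And>X Z f. \<lbrakk>simple X; is_mono Z (X \<otimes>\<^sub>o dual X) f\<rbrakk> \<Longrightarrow> Z \<in> D"
    by auto
  let ?J = "{i \<in> Irr. i \<in> D}"
  have J: "M.closed_set ?J"
    unfolding M.closed_set_def
  proof (intro conjI ballI impI)
    show "?J \<subseteq> Irr" "rep \<one>\<^sub>o \<in> ?J"
      using rep[OF unit_simple] fusion_subcategory_iso[OF D(1) fusion_subcategoryD(1)[OF D(1)]] by auto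
    show "star i \<in> ?J" if "i \<in> ?J" for i
      using that star_in_Irr fusion_subcategory_star[OF D(1)] by auto
    show "k \<in> ?J" if "i \<in> ?J" "j \<in> ?J" "k \<in> Irr" "real_of_int (obj_class (i \<otimes>\<^sub>o j) k) \<noteq> 0" for i j k
      using that fusion_subcategory_constituent[OF D(1) fusion_subcategoryD(2)[OF D(1)]] by auto
  qed
  have adj: "l \<in> ?J" if kl: "k \<in> Irr" "l \<in> Irr" "real_of_int (obj_class (k \<otimes>\<^sub>o star k) l) \<noteq> 0" for k l
  proof -
    have "isomorphic (k \<otimes>\<^sub>o star k) (k \<otimes>\<^sub>o dual k)"
      using isomorphic_tensor[OF isomorphic_refl] isomorphic_sym[OF isomorphic_star[OF Irr_simple[OF kl(1)]]] by blast
    then have "obj_class (k \<otimes>\<^sub>o dual k) l \<noteq> 0"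
      using kl(3) obj_class_iso by simp
    then show ?thesis
      using constituent_mono[OF kl(2)] D(2)[OF Irr_simple[OF kl(1)]] kl(2) by blast
  qed
  show "centralizer pointed_subcategory \<subseteq> D"
    unfolding centralizer_def
  proof (rule generated_subcategory_least[OF D(1)], rule subsetI)
    fix X assume "X \<in> {X. simple X \<and> (\<forall>Y\<in>pointed_subcategory. simple Y \<longrightarrow> smatrix X Y = qdim X * qdim Y)}"
    then have X: "simple X" "\<And>Y. \<lbrakk>Y \<in> pointed_subcategory; simple Y\<rbrakk> \<Longrightarrow> smatrix X Y = qdim X * qdim Y"
      by auto
    note x = rep[OF X(1)]
    \<comment> \<open>A simple \<open>g\<close> centralizing \<open>?J\<close> centralizes every
      constituent of an object \<open>k \<otimes> star k\<close>, hence is invertible and belongs to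
      the pointed subcategory, which \<open>X\<close> centralizes. The double centralizer theorem
      then applies.\<close>
    have "rep X \<in> ?J"
    proof (rule M.double_centralizer[OF J x(1)])
      fix g assume g: "g \<in> Irr" "\<And>j. j \<in> ?J \<Longrightarrow> \<iota> (smatrix g j) = complex_of_real (\<phi> (obj_class g) * \<phi> (obj_class j))"
      have "\<phi> (obj_class g) = 1"
        by (rule M.centralizer_adjoint_invertible[OF adj g(1) g(2)])
      then have "g \<in> pointed_subcategory"
        using invertible_if_phi_1[OF g(1)] generated_subcategory_superset unfolding pointed_subcategory_def by blast
      then have "smatrix X g = qdim X * qdim g"
        using X(2) Irr_simple[OF g(1)] by blast
      then show "\<iota> (smatrix (rep X) g) = complex_of_real (\<phi> (obj_class (rep X)) * \<phi> (obj_class g))"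
        unfolding smatrix_qdim_iff[OF X(1) Irr_simple[OF g(1)]] rep_Irr[OF g(1)] .
    qed
    then show "X \<in> D"
      using fusion_subcategory_iso[OF D(1) _ isomorphic_sym[OF x(2)]] by simp
  qed
qed

lemma adjoint_eq_centralizer: "adjoint_subcategory = centralizer pointed_subcategory"
  using adjoint_subset_centralizer centralizer_subset_adjoint by (rule subset_antisym)

end

end

theorem corollary6p9:
  fixes C :: "('k::{alg_closed_field,field_char_0}, 'o, 'm::ab_group_add) ribbon_data"
    and \<iota> :: "'k \<Rightarrow> complex"
    and \<phi> :: "('o \<Rightarrow> int) \<Rightarrow> real"
  assumes "modular_category C"
    and "fusion_category.is_FPdim_hom C \<phi>"
    and "ribbon_fusion_category.is_complex_embedding C \<iota>"
    and "ribbon_fusion_category.pseudounitary C \<iota> \<phi>"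
    and "ribbon_fusion_category.canonical_spherical C \<iota> \<phi>"
  shows "fusion_category.adjoint_subcategory C =
         ribbon_fusion_category.centralizer C (fusion_category.pointed_subcategory C)"
  by (rule modular_category.adjoint_eq_centralizer[OF assms(1,2,3,5)])

end
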